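(* Let $l>0$, $p>1$ and assume $(p-1)l>4$. Let $\lambda(\alpha)$, $U(x;\alpha)$ ($\alpha>0$) be the Korman solution family of \[ (\mathrm{Q}_\lambda)\qquad u''+\lambda|x|^l(u+1)^p=0,\ x\in(-1,1),\qquad u(-1)=u(1)=0 \] and let $\alpha_*>0$ be the turning parameter, all as defined in the context. Then there exist constants $\alpha_1,\alpha_2,\alpha_3$ such that $\alpha_*<\alpha_1\le\alpha_2\le\alpha_3$ and the following (i)--(vii) hold: (i) if $0<\alpha<\alpha_*$, then $m(\alpha)=0$ and $U(x;\alpha)$ is nondegenerate; (ii) if $\alpha=\alpha_*$, then $m(\alpha)=0$ and $U(x;\alpha)$ is degenerate; (iii) if $\alpha_*<\alpha<\alpha_1$, then $m(\alpha)=1$ and $U(x;\alpha)$ is nondegenerate; (iv) if $\alpha=\alpha_1$, then $m(\alpha)=1$ and $U(x;\alpha)$ is degenerate; (v) if $\alpha=\alpha_2$, then $m(\alpha)=1$, $U(x;\alpha)$ is degenerate, and the point $(\lambda(\alpha_2),U(x;\alpha_2))$ is a non-even bifurcation point, that is, for each $\varepsilon>0$ there exists $(\lambda,u)$ such that $u$ is a positive non-even solution of $(\mathrm{Q}_\lambda)$ and $|\lambda-\lambda(\alpha_2)|+\|u-U(\,\cdot\,;\alpha_2)\|_\infty<\varepsilon$; (vi) if $\alpha=\alpha_3$, then $m(\alpha)=1$ and $U(x;\alpha)$ is degenerate; (vii) if $\alpha>\alpha_3$, then $m(\alpha)=2$ and $U(x;\alpha)$ is nondegenerate. Moreover, for every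 $\lambda$ with $0<\lambda<\lambda(\alpha_3)$, problem $(\mathrm{Q}_\lambda)$ has a positive non-even solution $u=u_\lambda$, and these satisfy $\lim_{\lambda\to+0}\|u_\lambda\|_\infty=\infty$.
   Context: Solutions are classical; here $\lambda>0$. A solution is positive if $u(x)>0$ on $(-1,1)$, and even if $u(-x)=u(x)$. $\|v\|_\infty=\sup_{x\in[-1,1]}|v(x)|$. Korman solution: let $w$ be the unique solution of $w''+|x|^l(w+1)^p=0$ for $x>0$, $w(0)=w'(0)=0$. There is $x_1>0$ such that $-1<w<0$, $w'<0$, $w''<0$ on $(0,x_1)$, $w(x_1)=-1$ and $w'(x_1)<0$; let $\eta:[0,1]\to[0,x_1]$ be the inverse function of $-w|_{[0,x_1]}$. For $\alpha>0$ set \[ \lambda(\alpha)=(\alpha+1)^{1-p}\left[\eta\left(\tfrac{\alpha}{\alpha+1}\right)\right]^{l+2},\qquad U(x;\alpha)=(\alpha+1)\,w\left(\eta\left(\tfrac{\alpha}{\alpha+1}\right)|x|\right)+\alpha,\quad x\in[-1,1]. \] Then $U(\,\cdot\,;\alpha)$ is a positive even solution of $(\mathrm{Q}_{\lambda(\alpha)})$ with $\|U(\,\cdot\,;\alpha)\|_\infty=\alpha$. The number $\alpha_*>0$ is the unique one such that $\lambda'(\alpha)>0$ for $0<\alpha<\alpha_*$, $\lambda'(\alpha_* )=0$, and $\lambda'(\alpha)<0$ for $\alpha>\alpha_*$. The Morse index $m(\alpha)$ of $U(x;\alpha)$ is the number of negative eigenvalues $\mu$ of \[ \phi''+\lambda(\alpha)|x|^l\,p\,(U(x;\alpha)+1)^{p-1}\phi+\mu\phi=0,\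 x\in(-1,1),\qquad \phi(-1)=\phi(1)=0. \] $U(x;\alpha)$ is degenerate if $\mu=0$ is an eigenvalue of this problem, and nondegenerate otherwise. *)

theory Defs
  imports "HOL-Analysis.Analysis"
begin

text \<open>Functions on the closed interval from -1 to 1 are total functions on the reals of which
  only the values on that interval matter.\<close>

definition sup_norm :: "(real \<Rightarrow> real) \<Rightarrow> real"
  where "sup_norm v = (SUP x\<in>{-1..1}. \<bar>v x\<bar>)"

definition even_fun :: "(real \<Rightarrow> real) \<Rightarrow> bool"
  where "even_fun u \<longleftrightarrow> (\<forall>x\<in>{-1..1}. u (- x) = u x)"

text \<open>Classical solutions of \<open>u'' + f(x,u) = 0\<close> on the open interval, vanishing at both end points.
  Every \<open>f\<close> used below makes \<open>f(x,u(x))\<close> continuous, so such solutions are of class \<open>C\<^sup>2\<close>.\<close>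

definition dirichlet_solution :: "(real \<Rightarrow> real \<Rightarrow> real) \<Rightarrow> (real \<Rightarrow> real) \<Rightarrow> bool"
  where "dirichlet_solution f u \<longleftrightarrow>
    continuous_on {-1..1} u \<and> u (-1) = 0 \<and> u 1 = 0 \<and>
    (\<exists>u'. \<forall>x\<in>{-1<..<1}.
       (u has_real_derivative u' x) (at x) \<and>
       (u' has_real_derivative - f x (u x)) (at x))"

definition positive_solution :: "real \<Rightarrow> real \<Rightarrow> real \<Rightarrow> (real \<Rightarrow> real) \<Rightarrow> bool"
  where "positive_solution l p lam u \<longleftrightarrow>
    lam > 0 \<and>
    dirichlet_solution (\<lambda>x t. lam * \<bar>x\<bar> powr l * (t + 1) powr p) u \<and>
    (\<forall>x\<in>{-1<..<1}. u x > 0)"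

text \<open>The solution \<open>w\<close> of the initial value problem \<open>w'' + x\<^sup>l (w+1)\<^sup>p = 0\<close>, \<open>w(0) = w'(0) = 0\<close>, is only
  considered up to its first zero \<open>r\<close> of \<open>w + 1\<close>, beyond which the real power is not meaningful.
  The equation at the point 0, where the derivatives are one-sided, holds by continuity.\<close>

definition korman_profile :: "real \<Rightarrow> real \<Rightarrow> (real \<Rightarrow> real) \<Rightarrow> real \<Rightarrow> bool"
  where "korman_profile l p w r \<longleftrightarrow>
    r > 0 \<and>
    (\<exists>w'. w 0 = 0 \<and> w' 0 = 0 \<and>
       (\<forall>x\<in>{0..r}.
          (w has_real_derivative w' x) (at x within {0..r}) \<and>
          (w' has_real_derivative - (x powr l * (w x + 1) powr p)) (at x within {0..r}))) \<and>
    (\<forall>x\<in>{0<..<r}. - 1 < w x) \<and> w r = - 1"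

text \<open>The initial value problem determines \<open>w\<close> only on the interval from 0 to \<open>r\<close>; the values
  elsewhere are arbitrary (hence the choice operator) and are never used.\<close>

definition korman_w :: "real \<Rightarrow> real \<Rightarrow> real \<Rightarrow> real"
  where "korman_w l p = (SOME w. \<exists>r. korman_profile l p w r)"

definition korman_x1 :: "real \<Rightarrow> real \<Rightarrow> real"
  where "korman_x1 l p = (THE r. korman_profile l p (korman_w l p) r)"

definition korman_eta :: "real \<Rightarrow> real \<Rightarrow> real \<Rightarrow> real"
  where "korman_eta l p = inv_into {0..korman_x1 l p} (\<lambda>x. - korman_w l p x)"

definition korman_lambda :: "real \<Rightarrow> real \<Rightarrow> real \<Rightarrow> real"
  where "korman_lambda l p \<alpha> =
    (\<alpha> + 1) powr (1 - p) * korman_eta l p (\<alpha> / (\<alpha> + 1)) powr (l + 2)"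

definition korman_U :: "real \<Rightarrow> real \<Rightarrow> real \<Rightarrow> real \<Rightarrow> real"
  where "korman_U l p \<alpha> x =
    (\<alpha> + 1) * korman_w l p (korman_eta l p (\<alpha> / (\<alpha> + 1)) * \<bar>x\<bar>) + \<alpha>"

definition alpha_star :: "real \<Rightarrow> real \<Rightarrow> real"
  where "alpha_star l p = (THE a. a > 0 \<and>
    (\<forall>\<alpha>. 0 < \<alpha> \<and> \<alpha> < a \<longrightarrow> (\<exists>d>0. (korman_lambda l p has_real_derivative d) (at \<alpha>))) \<and>
    (korman_lambda l p has_real_derivative 0) (at a) \<and>
    (\<forall>\<alpha>>a. \<exists>d<0. (korman_lambda l p has_real_derivative d) (at \<alpha>)))"

definition eigenvalue :: "real \<Rightarrow> real \<Rightarrow> real \<Rightarrow> real \<Rightarrow> bool"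
  where "eigenvalue l p \<alpha> \<mu> \<longleftrightarrow>
    (\<exists>\<phi>. dirichlet_solution
           (\<lambda>x t. korman_lambda l p \<alpha> * \<bar>x\<bar> powr l * p * (korman_U l p \<alpha> x + 1) powr (p - 1) * t
                   + \<mu> * t) \<phi> \<and>
         (\<exists>x\<in>{-1..1}. \<phi> x \<noteq> 0))"

text \<open>Extended naturals, because \<open>card\<close> is 0 on infinite sets. All eigenvalues of this problem are
  simple, so multiplicities play no role.\<close>

definition morse_index :: "real \<Rightarrow> real \<Rightarrow> real \<Rightarrow> enat"
  where "morse_index l p \<alpha> =
    (if finite {\<mu>. \<mu> < 0 \<and> eigenvalue l p \<alpha> \<mu>}
     then enat (card {\<mu>. \<mu> < 0 \<and> eigenvalue l p \<alpha> \<mu>}) else \<infinity>)"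

definition degenerate :: "real \<Rightarrow> real \<Rightarrow> real \<Rightarrow> bool"
  where "degenerate l p \<alpha> \<longleftrightarrow> eigenvalue l p \<alpha> 0"

definition non_even_bifurcation_point :: "real \<Rightarrow> real \<Rightarrow> real \<Rightarrow> bool"
  where "non_even_bifurcation_point l p \<alpha> \<longleftrightarrow>
    (\<forall>\<epsilon>>0. \<exists>lam u. positive_solution l p lam u \<and> \<not> even_fun u \<and>
       \<bar>lam - korman_lambda l p \<alpha>\<bar> + sup_norm (\<lambda>x. u x - korman_U l p \<alpha> x) < \<epsilon>)"

end

(* With W = w + 1, every even solution is u = W(eta |x|) / W(eta) - 1 for some eta in (0, x_1), with
   lambda = W(eta)^(p-1) eta^(l+2); this replaces the parameter alpha = 1 / W(eta) - 1. Rescaled, the linearized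
   equation does not depend on eta: its even solution is psi = x W' + (l+2)/(p-1) W, which is decreasing
   with one zero e, and its odd solution z satisfies psi z' - psi' z > 0. Comparing z with
   W (-W')^(1/(l+1)) shows that z is negative at the end x_1, so z has exactly one zero c, and e < c. By Sturm
   comparison the Morse index at eta is the number of zeros of psi and of z in (0, eta). Hence the three parameters
   alpha_1, alpha_2, alpha_3 can all be taken to be 1 / W(c) - 1.

   Non-even solutions come from shooting from x = -1 with slope beta. The derivative of the end value with respect to
   beta at the even solution is a positive multiple of psi(eta) z(eta). For eta > c it is positive, while large slopes
   miss the target, so there is another solution with a larger slope; it is not even, because among the
   even solutions with the same lambda the one with eta > e has the largest slope. The sign change of the
   derivative at eta = c gives the bifurcation by the intermediate value theorem along the curve of
   even solutions with slightly increased slope. *)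

theory Submission
  imports Defs
begin

section \<open>Scalar second order equations\<close>

text \<open>Two obstacles shape the argument. The power is neither globally Lipschitz nor meaningful
  for negative arguments, so existence and dependence on parameters are established for a truncated
  equation, and the truncation is shown to be inactive on the solutions that matter. And
  \<open>z\<close>, unlike \<open>\<psi>\<close>, has no closed form, so its sign at the end must be
  forced indirectly; this is the only step in which the size of \<open>(p - 1) * l\<close> enters.
  Bifurcation needs no transversality: a shot whose slope lies strictly above that of the even
  solution with the same lambda, for parameters beyond \<open>e\<close>, cannot be even, so a sign
  change of the end value suffices. Since lambda and the slope at the left end determine a solution,
  recognising even solutions reduces to the monotonicity of the two scalar functions
  \<open>Lam\<close> and \<open>slope\<close>. The slope also yields the growth of the norms. A
  solution returning to its initial value has slope at most \<open>2 * lam * M powr p\<close>, where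
  \<open>M\<close> bounds \<open>u + 1\<close>; slopes that stay large while lambda tends to 0
  therefore force large solutions.\<close>

text \<open>The second derivative is an arbitrary function \<open>y2\<close> of the variable, so
  that linear, nonlinear and truncated equations share the lemmas below. Two-sided derivatives are
  required only in the interior, as the mean value theorem needs them, and nothing is asked of
  \<open>y2\<close> at the ends.\<close>

definition ode2 :: "real \<Rightarrow> real \<Rightarrow> (real \<Rightarrow> real) \<Rightarrow> (real \<Rightarrow> real) \<Rightarrow> (real \<Rightarrow> real) \<Rightarrow> bool"
  where "ode2 a b y y1 y2 \<longleftrightarrow> continuous_on {a..b} y \<and> continuous_on {a..b} y1 \<and>
    (\<forall>x\<in>{a<..<b}. (y has_real_derivative y1 x) (at x) \<and> (y1 has_real_derivative y2 x) (at x))"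

lemma ode2D:
  assumes "ode2 a b y y1 y2"
  shows "continuous_on {a..b} y" "continuous_on {a..b} y1"
    "\<And>x. a < x \<Longrightarrow> x < b \<Longrightarrow> (y has_real_derivative y1 x) (at x)"
    "\<And>x. a < x \<Longrightarrow> x < b \<Longrightarrow> (y1 has_real_derivative y2 x) (at x)"
  using assms by (auto simp: ode2_def)

lemma ode2_subset: "ode2 a b y y1 y2 \<Longrightarrow> a \<le> c \<Longrightarrow> d \<le> b \<Longrightarrow> ode2 c d y y1 y2"
  unfolding ode2_def by (auto elim!: continuous_on_subset)

lemma ode2_within:
  assumes "\<And>x. x \<in> {a..b} \<Longrightarrow> (y has_real_derivative y1 x) (at x within {a..b})"
    and "\<And>x. x \<in> {a..b} \<Longrightarrow> (y1 has_real_derivative y2 x) (at x within {a..b})"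
  shows "ode2 a b y y1 y2"
proof -
  have "continuous_on {a..b} y" "continuous_on {a..b} y1"
    using assms DERIV_continuous continuous_on_eq_continuous_within by blast+
  moreover have "at x within {a..b} = at x" if "x \<in> {a<..<b}" for x
    using that by (intro at_within_interior) auto
  ultimately show ?thesis
    using assms unfolding ode2_def by (metis greaterThanLessThan_subseteq_atLeastAtMost_iff order_refl subsetD)
qed

lemma ode2_cong:
  assumes "ode2 a b y y1 y2" "\<And>x. a < x \<Longrightarrow> x < b \<Longrightarrow> y2 x = y2' x"
  shows "ode2 a b y y1 y2'"
  using assms unfolding ode2_def by force

lemma ode2_lincomb:
  assumes "ode2 a b y y1 y2" "ode2 a b z z1 z2"
  shows "ode2 a b (\<lambda>x. c * y x + d * z x) (\<lambda>x. c * y1 x + d * z1 x) (\<lambda>x. c * y2 x + d * z2 x)"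
  using assms unfolding ode2_def by (auto intro!: continuous_intros derivative_eq_intros)

lemma ode2_scale:
  assumes "ode2 0 b y y1 y2" "c > 0" "b = c * b'"
  shows "ode2 0 b' (\<lambda>x. y (c * x)) (\<lambda>x. c * y1 (c * x)) (\<lambda>x. c\<^sup>2 * y2 (c * x))"
proof -
  have im: "(\<lambda>x. c * x) ` {0..b'} \<subseteq> {0..b}" using assms by (auto intro: mult_left_mono)
  have "continuous_on {0..b'} (\<lambda>x. y (c * x))" "continuous_on {0..b'} (\<lambda>x. y1 (c * x))"
    by (rule continuous_on_compose2[OF ode2D(1)[OF assms(1)] _ im] continuous_on_compose2[OF ode2D(2)[OF assms(1)] _ im],
        intro continuous_intros)+
  moreover have "((\<lambda>x. y (c * x)) has_real_derivative c * y1 (c * x)) (at x)"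
     "((\<lambda>x. c * y1 (c * x)) has_real_derivative c\<^sup>2 * y2 (c * x)) (at x)" if "x \<in> {0<..<b'}" for x
  proof -
    have "c * x \<in> {0<..<b}" using that assms by auto
    then have "(y has_real_derivative y1 (c*x)) (at (c * x))" "(y1 has_real_derivative y2 (c*x)) (at (c*x))"
      using assms(1) unfolding ode2_def by auto
    moreover have "((\<lambda>x. c * x) has_real_derivative c) (at x)" by (auto intro!: derivative_eq_intros)
    ultimately have d: "((\<lambda>x. y (c * x)) has_real_derivative y1 (c * x) * c) (at x)"
      "((\<lambda>x. y1 (c * x)) has_real_derivative y2 (c * x) * c) (at x)"
      by (blast intro: DERIV_chain2)+
    show "((\<lambda>x. y (c * x)) has_real_derivative c * y1 (c * x)) (at x)"
      using d(1) by (simp add: mult.commute)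
    show "((\<lambda>x. c * y1 (c * x)) has_real_derivative c\<^sup>2 * y2 (c * x)) (at x)"
      using DERIV_cmult[OF d(2), of c] by (simp add: power2_eq_square mult_ac)
  qed
  ultimately show ?thesis unfolding ode2_def by (auto intro!: continuous_intros)
qed

lemma ode2_MVT:
  assumes o: "ode2 a b y y1 y2" and "a \<le> s" "s < t" "t \<le> b"
  obtains \<xi> where "s < \<xi>" "\<xi> < t" "y t - y s = (t - s) * y1 \<xi>"
proof -
  have "continuous_on {s..t} y" using ode2D(1)[OF o] by (rule continuous_on_subset) (use assms in auto)
  moreover have "(y has_real_derivative y1 \<xi>) (at \<xi>)" if "s < \<xi>" "\<xi> < t" for \<xi>
    using ode2D(3)[OF o, of \<xi>] that assms by auto
  ultimately obtain \<xi> where "s < \<xi>" "\<xi> < t" "y t - y s = (t - s) * y1 \<xi>"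
    using MVT[OF assms(3), of y] by (metis DERIV_unique real_differentiable_def)
  then show thesis by (rule that)
qed

lemma ode2_MVT':
  assumes o: "ode2 a b y y1 y2" and "a \<le> s" "s < t" "t \<le> b"
  obtains \<xi> where "s < \<xi>" "\<xi> < t" "y1 t - y1 s = (t - s) * y2 \<xi>"
proof -
  have "continuous_on {s..t} y1" using ode2D(2)[OF o] by (rule continuous_on_subset) (use assms in auto)
  moreover have "(y1 has_real_derivative y2 \<xi>) (at \<xi>)" if "s < \<xi>" "\<xi> < t" for \<xi>
    using ode2D(4)[OF o, of \<xi>] that assms by auto
  ultimately obtain \<xi> where "s < \<xi>" "\<xi> < t" "y1 t - y1 s = (t - s) * y2 \<xi>"
    using MVT[OF assms(3), of y1] by (metis DERIV_unique real_differentiable_def)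
  then show thesis by (rule that)
qed

section \<open>Wronskians, first zeros and Sturm comparison\<close>

lemma wronskian_deriv:
  assumes "ode2 a b y y1 y2" "ode2 a b z z1 z2" "a < x" "x < b"
  shows "((\<lambda>x. y x * z1 x - y1 x * z x) has_real_derivative y x * z2 x - y2 x * z x) (at x)"
  using ode2D(3,4)[OF assms(1) assms(3,4)] ode2D(3,4)[OF assms(2) assms(3,4)]
  by (auto intro!: derivative_eq_intros)

lemma wronskian_cont:
  assumes "ode2 a b y y1 y2" "ode2 a b z z1 z2"
  shows "continuous_on {a..b} (\<lambda>x. y x * z1 x - y1 x * z x)"
  using ode2D(1,2)[OF assms(1)] ode2D(1,2)[OF assms(2)] by (auto intro!: continuous_intros)

lemma wronskian_const:
  assumes "ode2 a b y y1 (\<lambda>x. - Q x * y x)" "ode2 a b z z1 (\<lambda>x. - Q x * z x)" 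
    and "c \<in> {a..b}" "d \<in> {a..b}"
  shows "y c * z1 c - y1 c * z c = y d * z1 d - y1 d * z d"
proof -
  have "y c * z1 c - y1 c * z c = y d * z1 d - y1 d * z d" if "c < d" "c \<in> {a..b}" "d \<in> {a..b}" for c d
  proof (rule DERIV_isconst_end[OF that(1), symmetric])
    show "continuous_on {c..d} (\<lambda>x. y x * z1 x - y1 x * z x)"
      using wronskian_cont[OF assms(1,2)] by (rule continuous_on_subset) (use that in auto)
    show "((\<lambda>x. y x * z1 x - y1 x * z x) has_real_derivative 0) (at x)" if "c < x" "x < d" for x
      using wronskian_deriv[OF assms(1,2), of x] that \<open>c \<in> _\<close> \<open>d \<in> _\<close> by simp
  qed
  from this[of c d] this[of d c] show ?thesis using assms(3,4) by (metis linorder_less_linear)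
qed

text \<open>Positivity right of \<open>a\<close> is assumed instead of \<open>y a > 0\<close>,
  because the function may start from the value 0, as odd solutions do. The infimum of the
  nonpositive points is therefore taken beyond an interior point \<open>m\<close>.\<close>

lemma first_zero:
  fixes y :: "real \<Rightarrow> real"
  assumes "continuous_on {a..b} y" "a < d" "d \<le> b" "\<And>x. a < x \<Longrightarrow> x < d \<Longrightarrow> y x > 0" "y b \<le> 0"
  obtains c where "a < c" "c \<le> b" "y c = 0" "\<And>x. a < x \<Longrightarrow> x < c \<Longrightarrow> y x > 0"
proof -
  define m where "m = (a + d) / 2"
  have m: "a < m" "m < d" "y m > 0" using assms by (auto simp: m_def field_simps)
  define S where "S = {x\<in>{m..b}. y x \<le> 0}"
  have "closed S"
  proof -
    have "continuous_on {m..b} y" using assms(1) by (rule continuous_on_subset) (use m in auto)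
    then have "closed ({m..b} \<inter> y -` {..0})"
      by (rule continuous_closed_preimage) auto
    moreover have "S = {m..b} \<inter> y -` {..0}" by (auto simp: S_def)
    ultimately show ?thesis by simp
  qed
  moreover have "b \<in> S" "bdd_below S" using assms m by (auto simp: S_def bdd_below_def)
  ultimately have i: "Inf S \<in> S" using closed_contains_Inf[of S] by auto
  define c where "c = Inf S"
  have c: "c \<in> {m..b}" "y c \<le> 0" using i by (auto simp: c_def S_def)
  have pos: "y x > 0" if "a < x" "x < c" for x
  proof (cases "x < m")
    case True then show ?thesis using assms(4)[of x] that m by auto
  next
    case False
    have "x \<notin> S" using cInf_lower[OF _ \<open>bdd_below S\<close>, of x] that(2) c_def by force
    then show ?thesis using False that c by (auto simp: S_def)
  qed
  have "y c = 0"
  proof (rule ccontr)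
    assume "y c \<noteq> 0" then have "y c < 0" using c by auto
    have "continuous_on {m..c} y" using assms(1) by (rule continuous_on_subset) (use m c in auto)
    then obtain x where "m \<le> x" "x \<le> c" "y x = 0"
      using IVT2'[of y c 0 m] m \<open>y c < 0\<close> c by auto
    then show False using pos[of x] m \<open>y c < 0\<close> by (cases "x = c") auto
  qed
  with pos c m show thesis by (intro that[of c]) auto
qed

lemma zero_deriv_nonpos:
  assumes "ode2 a b y y1 y2" "a < b" "y b = 0" "\<And>x. a < x \<Longrightarrow> x < b \<Longrightarrow> y x > 0"
  shows "y1 b \<le> 0"
proof (rule ccontr)
  assume "\<not> y1 b \<le> 0" then have p: "y1 b > 0" by simp
  have "continuous_on {a..b} y1" using ode2D[OF assms(1)] by simp
  then obtain d where d: "d > 0" "\<And>x. x \<in> {a..b} \<Longrightarrow> dist x b < d \<Longrightarrow> dist (y1 x) (y1 b) < y1 b"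
    using p assms(2) unfolding continuous_on_iff by (metis atLeastAtMost_iff less_imp_le order_refl)
  define c where "c = max ((a+b)/2) (b - d/2)"
  have c: "a < c" "c < b" "b - c < d" using assms(2) d(1) by (auto simp: c_def max_def field_simps)
  have "y c < y b"
  proof (rule DERIV_pos_imp_increasing_open[OF c(2)])
    show "\<exists>z. (y has_real_derivative z) (at x) \<and> z > 0" if "c < x" "x < b" for x
      using d(2)[of x] ode2D(3)[OF assms(1), of x] that c by (force simp: dist_real_def)
    show "continuous_on {c..b} y" using ode2D(1)[OF assms(1)] by (rule continuous_on_subset) (use c in auto)
  qed
  then show False using assms(3) assms(4)[of c] c by auto
qed

lemma deriv_pos_right:
  assumes "ode2 a b y y1 y2" "a < b" "y a \<ge> 0" "y1 a > 0"
  obtains d where "a < d" "d \<le> b" "\<And>x. a < x \<Longrightarrow> x < d \<Longrightarrow> y x > 0"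
proof -
  have "continuous_on {a..b} y1" using ode2D[OF assms(1)] by simp
  then obtain d where d: "d > 0" "\<And>x. x \<in> {a..b} \<Longrightarrow> dist x a < d \<Longrightarrow> dist (y1 x) (y1 a) < y1 a"
    using assms unfolding continuous_on_iff by (metis atLeastAtMost_iff less_imp_le order_refl)
  define e where "e = min b (a + d)"
  have "y x > 0" if "a < x" "x < e" for x
  proof -
    have "y a < y x"
    proof (rule DERIV_pos_imp_increasing_open[OF that(1)])
      show "\<exists>z. (y has_real_derivative z) (at t) \<and> z > 0" if "a < t" "t < x" for t
        using d(2)[of t] ode2D(3)[OF assms(1), of t] that \<open>x < e\<close> by (force simp: dist_real_def e_def)
      show "continuous_on {a..x} y" using ode2D(1)[OF assms(1)] by (rule continuous_on_subset) (use that e_def in auto)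
    qed
    then show ?thesis using assms by simp
  qed
  then show thesis by (intro that[of e]) (use d assms e_def in auto)
qed

text \<open>With \<open>Q < R\<close> and both functions positive, the Wronskian
  \<open>y * z1 - y1 * z\<close> decreases strictly. It starts at most 0, yet at \<open>b\<close>,
  where \<open>y\<close> vanishes with \<open>y1 b \<le> 0\<close>, it equals
  \<open>- y1 b * z b \<ge> 0\<close>.\<close>

lemma sturm_comparison:
  assumes y: "ode2 a b y y1 (\<lambda>x. - Q x * y x)" and z: "ode2 a b z z1 (\<lambda>x. - R x * z x)"
    and "a < b" "\<And>x. a < x \<Longrightarrow> x < b \<Longrightarrow> Q x < R x"
    and "\<And>x. a < x \<Longrightarrow> x < b \<Longrightarrow> y x > 0" "\<And>x. a < x \<Longrightarrow> x < b \<Longrightarrow> z x > 0"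
    and "y b = 0" "y a * z1 a - y1 a * z a \<le> 0"
  shows False
proof -
  have "(\<lambda>x. y x * z1 x - y1 x * z x) b < (\<lambda>x. y x * z1 x - y1 x * z x) a"
  proof (rule DERIV_neg_imp_decreasing_open[OF \<open>a < b\<close>])
    show "continuous_on {a..b} (\<lambda>x. y x * z1 x - y1 x * z x)" by (rule wronskian_cont[OF y z])
    fix x assume x: "a < x" "x < b"
    have "y x * (- R x * z x) - (- Q x * y x) * z x = (Q x - R x) * (y x * z x)" by (simp add: algebra_simps)
    also have "\<dots> < 0" using assms(4-6)[of x] x by (intro mult_neg_pos mult_pos_pos) auto
    finally show "\<exists>d. ((\<lambda>x. y x * z1 x - y1 x * z x) has_real_derivative d) (at x) \<and> d < 0"
      using wronskian_deriv[OF y z x] by blast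
  qed
  moreover have "y1 b \<le> 0" using zero_deriv_nonpos[OF y \<open>a < b\<close> \<open>y b = 0\<close>] assms(5) by auto
  moreover have "z b \<ge> 0"
  proof (rule ccontr)
    assume n: "\<not> z b \<ge> 0"
    obtain c where "a < c" "c \<le> b" "z c = 0"
      using first_zero[OF ode2D(1)[OF z] \<open>a < b\<close> order_refl assms(6)] n by force
    then show False using assms(6)[of c] n by (cases "c = b") auto
  qed
  ultimately show False using assms(7,8) mult_nonpos_nonneg[of "y1 b" "z b"] by auto
qed

section \<open>Energy estimates and uniqueness\<close>

text \<open>Applied to differences of solutions, this gives uniqueness for
  \<open>\<delta> = 0\<close>, Lipschitz dependence on parameters for \<open>\<delta>\<close>
  proportional to their change, and the quadratic remainder in the expansion of the end
  value.\<close>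

lemma gronwall2:
  assumes o: "ode2 a b e e1 e2" and "L \<ge> 0" "\<delta> \<ge> 0"
    and bd: "\<And>x. a < x \<Longrightarrow> x < b \<Longrightarrow> \<bar>e2 x\<bar> \<le> L * \<bar>e x\<bar> + \<delta>"
    and x: "x \<in> {a..b}"
  shows "(e x)\<^sup>2 + (e1 x)\<^sup>2 \<le> ((e a)\<^sup>2 + (e1 a)\<^sup>2 + \<delta>\<^sup>2) * exp ((L + 2) * (b - a))"
proof -
  \<comment> \<open>Including \<open>\<delta>\<^sup>2\<close> in the energy treats the inhomogeneity
    like an initial value. The rate \<open>L + 2\<close> absorbs the three cross terms
    \<open>2 * e * e1\<close>, \<open>2 * L * \<bar>e1\<bar> * \<bar>e\<bar>\<close> and
    \<open>2 * \<bar>e1\<bar> * \<delta>\<close>, each split by the inequality between product and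
    squares.\<close>
  define F where "F = (\<lambda>x. ((e x)\<^sup>2 + (e1 x)\<^sup>2 + \<delta>\<^sup>2) * exp (- (L + 2) * (x - a)))"
  have "F x \<le> F a"
  proof (rule DERIV_nonpos_imp_decreasing_open[where f=F and a=a and b=x])
    show "a \<le> x" using x by simp
    show "continuous_on {a..x} F"
      unfolding F_def using ode2D(1,2)[OF o] x
      by (auto intro!: continuous_intros intro: continuous_on_subset)
    fix t assume "a < t" "t < x" then have t: "a < t" "t < b" using x by auto
    define D where "D = (2 * e t * e1 t + 2 * e1 t * e2 t - (L+2) * ((e t)\<^sup>2 + (e1 t)\<^sup>2 + \<delta>\<^sup>2)) * exp (- (L + 2) * (t - a))"
    have "(F has_real_derivative D) (at t)"
      unfolding F_def D_def using ode2D(3,4)[OF o t]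
      by (auto intro!: derivative_eq_intros simp: algebra_simps power2_eq_square)
    moreover have "D \<le> 0"
    proof -
      have "2 * e t * e1 t \<le> (e t)\<^sup>2 + (e1 t)\<^sup>2" by (rule sum_squares_bound)
      moreover have "2 * e1 t * e2 t \<le> 2 * \<bar>e1 t\<bar> * (L * \<bar>e t\<bar> + \<delta>)"
      proof -
        have "2 * e1 t * e2 t \<le> \<bar>2 * e1 t * e2 t\<bar>" by simp
        also have "\<dots> = 2 * \<bar>e1 t\<bar> * \<bar>e2 t\<bar>" by (simp add: abs_mult)
        also have "\<dots> \<le> 2 * \<bar>e1 t\<bar> * (L * \<bar>e t\<bar> + \<delta>)" using bd[OF t] by (intro mult_left_mono) auto
        finally show ?thesis .
      qed
      moreover have "2 * \<bar>e1 t\<bar> * (L * \<bar>e t\<bar> + \<delta>) = L * (2 * \<bar>e1 t\<bar> * \<bar>e t\<bar>) + 2 * \<bar>e1 t\<bar> * \<delta>"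
        by (simp add: algebra_simps)
      moreover have "L * (2 * \<bar>e1 t\<bar> * \<bar>e t\<bar>) \<le> L * ((e1 t)\<^sup>2 + (e t)\<^sup>2)"
        using sum_squares_bound[of "\<bar>e1 t\<bar>" "\<bar>e t\<bar>"] \<open>L \<ge> 0\<close> by (intro mult_left_mono) auto
      moreover have "2 * \<bar>e1 t\<bar> * \<delta> \<le> (e1 t)\<^sup>2 + \<delta>\<^sup>2"
        using sum_squares_bound[of "\<bar>e1 t\<bar>" \<delta>] by simp
      moreover have "L * \<delta>\<^sup>2 \<ge> 0" "(e t)\<^sup>2 \<ge> 0" "\<delta>\<^sup>2 \<ge> 0" using \<open>L \<ge> 0\<close> by auto
      ultimately have "2 * e t * e1 t + 2 * e1 t * e2 t - (L+2) * ((e t)\<^sup>2 + (e1 t)\<^sup>2 + \<delta>\<^sup>2) \<le> 0"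
        unfolding distrib_left distrib_right by linarith
      then show ?thesis unfolding D_def by (intro mult_nonpos_nonneg) auto
    qed
    ultimately show "\<exists>y. (F has_real_derivative y) (at t) \<and> y \<le> 0" by blast
  qed
  then have "((e x)\<^sup>2 + (e1 x)\<^sup>2 + \<delta>\<^sup>2) \<le> ((e a)\<^sup>2 + (e1 a)\<^sup>2 + \<delta>\<^sup>2) * exp ((L + 2) * (x - a))"
  proof -
    have z: "- (L + 2) * (x - a) + (L + 2) * (x - a) = 0" by (simp add: algebra_simps)
    have "(e x)\<^sup>2 + (e1 x)\<^sup>2 + \<delta>\<^sup>2 = F x * exp ((L + 2) * (x - a))"
      unfolding F_def mult.assoc mult_exp_exp z by simp
    also have "\<dots> \<le> F a * exp ((L + 2) * (x - a))" using \<open>F x \<le> F a\<close> by (intro mult_right_mono) auto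
    finally show ?thesis by (simp add: F_def)
  qed
  also have "\<dots> \<le> ((e a)\<^sup>2 + (e1 a)\<^sup>2 + \<delta>\<^sup>2) * exp ((L + 2) * (b - a))"
    using x \<open>L \<ge> 0\<close> by (intro mult_left_mono) (auto intro!: mult_left_mono)
  finally show ?thesis using zero_le_power2[of \<delta>] by linarith
qed

lemma gronwall2_abs:
  assumes o: "ode2 a b e e1 e2" and "L \<ge> 0" "\<delta> \<ge> 0"
    and "\<And>x. a < x \<Longrightarrow> x < b \<Longrightarrow> \<bar>e2 x\<bar> \<le> L * \<bar>e x\<bar> + \<delta>"
    and x: "x \<in> {a..b}"
  shows "\<bar>e x\<bar> \<le> (\<bar>e a\<bar> + \<bar>e1 a\<bar> + \<delta>) * exp ((L + 2) * (b - a))"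
proof -
  define E where "E = exp ((L + 2) * (b - a))"
  have E: "E \<ge> 1" using x \<open>L \<ge> 0\<close> by (simp add: E_def)
  define s where "s = \<bar>e a\<bar> + \<bar>e1 a\<bar> + \<delta>"
  have s: "s \<ge> 0" using \<open>\<delta> \<ge> 0\<close> by (simp add: s_def)
  have "(e x)\<^sup>2 \<le> (e x)\<^sup>2 + (e1 x)\<^sup>2" by simp
  also have "\<dots> \<le> ((e a)\<^sup>2 + (e1 a)\<^sup>2 + \<delta>\<^sup>2) * E"
    unfolding E_def by (rule gronwall2[OF assms])
  also have "\<dots> \<le> s\<^sup>2 * E"
  proof (rule mult_right_mono)
    define X where "X = \<bar>e a\<bar> * \<bar>e1 a\<bar> + \<bar>e a\<bar> * \<delta> + \<bar>e1 a\<bar> * \<delta>"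
    have "s\<^sup>2 = (e a)\<^sup>2 + (e1 a)\<^sup>2 + \<delta>\<^sup>2 + 2 * X"
      by (simp add: s_def X_def power2_eq_square algebra_simps)
    moreover have "0 \<le> X" using \<open>\<delta> \<ge> 0\<close> by (simp add: X_def)
    ultimately show "(e a)\<^sup>2 + (e1 a)\<^sup>2 + \<delta>\<^sup>2 \<le> s\<^sup>2" by linarith
  qed (use E in simp)
  \<comment> \<open>\<open>E \<ge> 1\<close> allows \<open>E\<^sup>2\<close> in place of
    \<open>E\<close>, so taking roots gives back the same exponential.\<close>
  also have "\<dots> \<le> s\<^sup>2 * E\<^sup>2" using E by (intro mult_left_mono) (auto simp: power2_eq_square)
  also have "\<dots> = (s * E)\<^sup>2" by (simp add: power_mult_distrib)
  finally have "\<bar>e x\<bar> \<le> s * E" using s E by (simp add: abs_le_square_iff[symmetric] abs_mult)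
  then show ?thesis by (simp add: s_def E_def)
qed

lemma ode2_unique:
  assumes "ode2 a b y y1 (\<lambda>x. f x (y x))" "ode2 a b z z1 (\<lambda>x. f x (z x))" "y a = z a" "y1 a = z1 a"
    and "L \<ge> 0" "\<And>x. a < x \<Longrightarrow> x < b \<Longrightarrow> \<bar>f x (y x) - f x (z x)\<bar> \<le> L * \<bar>y x - z x\<bar>"
    and "x \<in> {a..b}"
  shows "y x = z x" "y1 x = z1 x"
proof -
  have "ode2 a b (\<lambda>x. 1 * y x + (-1) * z x) (\<lambda>x. 1 * y1 x + (-1) * z1 x) (\<lambda>x. 1 * f x (y x) + (-1) * f x (z x))"
    by (rule ode2_lincomb[OF assms(1,2)])
  from gronwall2[OF this, of L 0 x] assms(3-7)
  have "(y x - z x)\<^sup>2 + (y1 x - z1 x)\<^sup>2 \<le> 0" by auto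
  then show "y x = z x" "y1 x = z1 x" by (simp_all add: sum_power2_le_zero_iff)
qed

section \<open>Existence by contraction\<close>

lemma picard2:
  fixes f :: "real \<Rightarrow> real \<Rightarrow> real"
  assumes ab: "a \<le> b" and L: "L \<ge> 0"
    and cont: "continuous_on ({a..b} \<times> UNIV) (\<lambda>(x,u). f x u)"
    and lip: "\<And>x u v. x \<in> {a..b} \<Longrightarrow> \<bar>f x u - f x v\<bar> \<le> L * \<bar>u - v\<bar>"
  obtains y y1 where "y a = A" "y1 a = B"
    "\<And>x. x \<in> {a..b} \<Longrightarrow> (y has_real_derivative y1 x) (at x within {a..b})"
    "\<And>x. x \<in> {a..b} \<Longrightarrow> (y1 has_real_derivative f x (y x)) (at x within {a..b})"
proof -
  \<comment> \<open>With the weight \<open>exp (K x)\<close> the integral operator has Lipschitz constant \<open>L / K\<^sup>2 \<le> 1 / 2\<close>.\<close>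
  define K where "K = L + 1"
  have K: "K > 0" "2 * L \<le> K\<^sup>2" using L by (auto simp: K_def power2_eq_square algebra_simps)
  \<comment> \<open>The unknown is \<open>h = exp (- (K * x)) * y\<close>, so \<open>G\<close>
    restores \<open>y\<close> before inserting it into \<open>f\<close>.\<close>
  define G where "G h t = f t (exp (K * t) * h t)" for h :: "real \<Rightarrow> real" and t
  define J where "J h s = integral {a..s} (G h)" for h s
  define I where "I h x = integral {a..x} (\<lambda>s. B + J h s)" for h x
  define \<Phi> where "\<Phi> h x = exp (- (K * x)) * (A + I h x)" for h x
  have Gc: "continuous_on {a..b} (G h)" if "continuous_on {a..b} h" for h
    unfolding G_def
    by (rule continuous_on_compose2[OF cont, of _ "\<lambda>t. (t, exp (K * t) * h t)", simplified])
       (auto intro!: continuous_intros that)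
  have Jd: "(J h has_real_derivative G h s) (at s within {a..b})" if "continuous_on {a..b} h" "s \<in> {a..b}" for h s
    unfolding J_def by (rule integral_has_real_derivative[OF Gc[OF that(1)] that(2)])
  have Jc: "continuous_on {a..b} (\<lambda>s. B + J h s)" if "continuous_on {a..b} h" for h
  proof -
    have "continuous_on {a..b} (J h)"
      using Jd[OF that] DERIV_continuous continuous_on_eq_continuous_within by blast
    then show ?thesis by (intro continuous_intros)
  qed
  have Id: "(I h has_real_derivative B + J h s) (at s within {a..b})" if "continuous_on {a..b} h" "s \<in> {a..b}" for h s
    unfolding I_def by (rule integral_has_real_derivative[OF Jc[OF that(1)] that(2)])
  have Ic: "continuous_on {a..b} (I h)" if "continuous_on {a..b} h" for h
    using Id[OF that] DERIV_continuous continuous_on_eq_continuous_within by blast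
  have \<Phi>c: "continuous_on {a..b} (\<Phi> h)" if "continuous_on {a..b} h" for h
    unfolding \<Phi>_def by (intro continuous_intros Ic that)
  have \<Phi>b: "(\<lambda>x. \<Phi> h (clamp a b x)) \<in> bcontfun" if "continuous_on {a..b} h" for h
    unfolding bcontfun_def
    using clamp_continuous_on[of a b "\<Phi> h"] clamp_bounded[of "\<Phi> h" a b] \<Phi>c[OF that] 
      compact_imp_bounded[OF compact_continuous_image[OF \<Phi>c[OF that] compact_Icc]]
    by auto
  have exp_int: "integral {a..s} (\<lambda>t. exp (K * t)) \<le> exp (K * s) / K" 
    "(\<lambda>t. exp (K * t)) integrable_on {a..s}" if "a \<le> s" for s
  proof -
    have "((\<lambda>t. exp (K * t)) has_integral (exp (K * s) / K - exp (K * a) / K)) {a..s}"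
      using that K by (intro fundamental_theorem_of_calculus)
        (auto intro!: derivative_eq_intros simp flip: has_real_derivative_iff_has_vector_derivative)
    then show "integral {a..s} (\<lambda>t. exp (K * t)) \<le> exp (K * s) / K" "(\<lambda>t. exp (K * t)) integrable_on {a..s}"
      using K by (auto simp: integral_unique integrable_on_def)
  qed
  have Jdiff: "\<bar>J h s - J k s\<bar> \<le> L * D * exp (K * s) / K"
    if h: "continuous_on {a..b} h" "continuous_on {a..b} k" and s: "s \<in> {a..b}" and D: "\<And>t. \<bar>h t - k t\<bar> \<le> D" for h k D s
  proof -
    have gi: "G h integrable_on {a..s}" "G k integrable_on {a..s}"
      using Gc[OF h(1)] Gc[OF h(2)] s by (auto intro!: integrable_continuous_real elim!: continuous_on_subset)
    have "J h s - J k s = integral {a..s} (\<lambda>t. G h t - G k t)"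
      unfolding J_def by (simp add: integral_diff gi)
    also have "norm \<dots> \<le> integral {a..s} (\<lambda>t. L * D * exp (K * t))"
    proof (rule integral_norm_bound_integral)
      show "(\<lambda>t. G h t - G k t) integrable_on {a..s}" by (intro integrable_diff gi)
      show "(\<lambda>t. L * D * exp (K * t)) integrable_on {a..s}"
        using exp_int(2)[of s] s by (intro integrable_on_mult_right) auto
      fix t assume t: "t \<in> {a..s}"
      have "\<bar>G h t - G k t\<bar> \<le> L * \<bar>exp (K * t) * h t - exp (K * t) * k t\<bar>"
        unfolding G_def using t s by (intro lip) auto
      also have "\<dots> = L * (exp (K * t) * \<bar>h t - k t\<bar>)" 
        by (simp add: abs_mult right_diff_distrib[symmetric])
      also have "\<dots> \<le> L * (exp (K * t) * D)" using D L by (intro mult_left_mono) auto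
      finally show "norm (G h t - G k t) \<le> L * D * exp (K * t)" by (simp add: mult_ac)
    qed
    also have "\<dots> = L * D * integral {a..s} (\<lambda>t. exp (K * t))" by simp
    also have "\<dots> \<le> L * D * (exp (K * s) / K)"
      using exp_int(1)[of s] s L order_trans[OF abs_ge_zero D[of a]] by (intro mult_left_mono) auto
    finally show ?thesis by simp
  qed
  have Idiff: "\<bar>I h x - I k x\<bar> \<le> L * D * exp (K * x) / K\<^sup>2"
    if h: "continuous_on {a..b} h" "continuous_on {a..b} k" and x: "x \<in> {a..b}" and D: "\<And>t. \<bar>h t - k t\<bar> \<le> D" for h k D x
  proof -
    have gi: "(\<lambda>s. B + J h s) integrable_on {a..x}" "(\<lambda>s. B + J k s) integrable_on {a..x}"
      using Jc[OF h(1)] Jc[OF h(2)] x by (auto intro!: integrable_continuous_real elim!: continuous_on_subset)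
    have "I h x - I k x = integral {a..x} (\<lambda>t. (B + J h t) - (B + J k t))"
      unfolding I_def by (rule integral_diff[OF gi, symmetric])
    also have "norm \<dots> \<le> integral {a..x} (\<lambda>t. L * D / K * exp (K * t))"
    proof (rule integral_norm_bound_integral)
      show "(\<lambda>t. (B + J h t) - (B + J k t)) integrable_on {a..x}" by (intro integrable_diff gi)
      show "(\<lambda>t. L * D / K * exp (K * t)) integrable_on {a..x}"
        using exp_int(2)[of x] x by (intro integrable_on_mult_right) auto
      fix t assume t: "t \<in> {a..x}"
      then show "norm ((B + J h t) - (B + J k t)) \<le> L * D / K * exp (K * t)"
        using Jdiff[OF h _ D, of t] x by auto
    qed
    also have "\<dots> = L * D / K * integral {a..x} (\<lambda>t. exp (K * t))" by simp
    also have "\<dots> \<le> L * D / K * (exp (K * x) / K)"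
      using exp_int(1)[of x] x L K order_trans[OF abs_ge_zero D[of a]] by (intro mult_left_mono) auto
    finally show ?thesis by (simp add: power2_eq_square)
  qed
  \<comment> \<open>\<open>clamp\<close> extends a function on \<open>{a..b}\<close> to a bounded
    continuous function on the whole line; this places the iteration in a complete space.\<close>
  define T where "T h = Bcontfun (\<lambda>x. \<Phi> (apply_bcontfun h) (clamp a b x))" for h :: "real \<Rightarrow>\<^sub>C real"
  have Tapp: "apply_bcontfun (T h) x = \<Phi> (apply_bcontfun h) (clamp a b x)" for h x
    unfolding T_def by (subst Bcontfun_inverse) (auto intro!: \<Phi>b)
  have "\<exists>!h. T h = h"
  proof (rule banach_fix_type[of "1/2"])
    show "\<forall>h k. dist (T h) (T k) \<le> 1/2 * dist h k"
    proof (intro allI dist_bound)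
      fix h k x
      define c where "c = clamp a b x"
      have c: "c \<in> {a..b}" using clamp_in_interval[of a b x] ab by (simp add: c_def)
      have "dist (T h x) (T k x) = exp (- (K * c)) * \<bar>I h c - I k c\<bar>"
        by (simp add: Tapp \<Phi>_def dist_real_def abs_mult right_diff_distrib[symmetric] c_def del: exp_minus)
      also have "\<dots> \<le> exp (- (K * c)) * (L * dist h k * exp (K * c) / K\<^sup>2)"
        using Idiff[of h k c "dist h k"] c dist_bounded[of h _ k] by (intro mult_left_mono) (auto simp: dist_real_def)
      also have "\<dots> = L / K\<^sup>2 * dist h k" by (simp add: exp_minus field_simps)
      also have "\<dots> \<le> 1/2 * dist h k" using K by (intro mult_right_mono) (auto simp: divide_simps)
      finally show "dist (T h x) (T k x) \<le> 1/2 * dist h k" .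
    qed
  qed auto
  then obtain h where h: "T h = h" by blast
  define y where "y = (\<lambda>x. A + I (apply_bcontfun h) x)"
  define y1 where "y1 = (\<lambda>x. B + J (apply_bcontfun h) x)"
  have he: "exp (K * x) * h x = y x" if "x \<in> {a..b}" for x
  proof -
    have "clamp a b x = x" using that by (intro clamp_cancel_cbox) auto
    then have "h x = \<Phi> h x" using Tapp[of h x] h by simp
    then show ?thesis by (simp add: \<Phi>_def y_def exp_minus)
  qed
  show thesis
  proof
    show "y a = A" "y1 a = B" by (auto simp: y_def y1_def I_def J_def)
    fix x assume x: "x \<in> {a..b}"
    show "(y has_real_derivative y1 x) (at x within {a..b})"
      unfolding y_def y1_def using Id[of h x] x by (auto intro!: derivative_eq_intros)
    show "(y1 has_real_derivative f x (y x)) (at x within {a..b})"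
      unfolding y1_def using Jd[of h x] x he[OF x] by (auto intro!: derivative_eq_intros simp: G_def)
  qed
qed

section \<open>Reflection at the origin\<close>

lemma deriv_glue:
  fixes h :: "real \<Rightarrow> real"
  assumes "b > 0" and x: "x \<in> {-b..b}"
    and "\<And>x. x \<in> {-b..0} \<Longrightarrow> (h has_real_derivative h' x) (at x within {-b..0})"
    and "\<And>x. x \<in> {0..b} \<Longrightarrow> (h has_real_derivative h' x) (at x within {0..b})"
  shows "(h has_real_derivative h' x) (at x within {-b..b})"
proof -
  consider "x = 0" | "x > 0" | "x < 0" by linarith
  then show ?thesis
  proof cases
    case 1
    have un: "{-b..b} = {-b..0} \<union> {0..b}" using \<open>b > 0\<close> by auto
    show ?thesis using assms(3,4)[of 0] 1 \<open>b > 0\<close>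
      unfolding un has_field_derivative_iff Lim_within_Un by auto
  next
    case 2
    have "at x within {-b..b} = at x within {0..b}"
      by (rule at_within_nhd[of x "{0<..}"]) (use 2 in auto)
    then show ?thesis using assms(4)[of x] 2 x by simp
  next
    case 3
    have "at x within {-b..b} = at x within {-b..0}"
      by (rule at_within_nhd[of x "{..<0}"]) (use 3 in auto)
    then show ?thesis using assms(3)[of x] 3 x by simp
  qed
qed

text \<open>Alternating this with the even extension turns a solution on the half interval into one
  on the whole interval when the coefficient is even. The vanishing value at 0 is what makes the two
  halves fit together, there for \<open>h\<close> and in the even case for
  \<open>h'\<close>.\<close>

lemma odd_extension_deriv:
  fixes h :: "real \<Rightarrow> real"
  assumes h: "\<And>x. x \<in> {0..b} \<Longrightarrow> (h has_real_derivative h' x) (at x within {0..b})" and "h 0 = 0" "b > 0"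
    and x: "x \<in> {-b..b}"
  shows "((\<lambda>x. sgn x * h \<bar>x\<bar>) has_real_derivative h' \<bar>x\<bar>) (at x within {-b..b})"
proof -
  have R: "((\<lambda>x. sgn x * h \<bar>x\<bar>) has_real_derivative h' \<bar>x\<bar>) (at x within {0..b})" if "x \<in> {0..b}" for x
    using has_field_derivative_transform_within[OF h[OF that] zero_less_one that, of "\<lambda>x. sgn x * h \<bar>x\<bar>"] that \<open>h 0 = 0\<close>
    by (auto simp: sgn_if)
  have Lm: "((\<lambda>x. sgn x * h \<bar>x\<bar>) has_real_derivative h' \<bar>x\<bar>) (at x within {-b..0})" if "x \<in> {-b..0}" for x
  proof -
    have "(h has_real_derivative h' (-x)) (at (-x) within uminus ` {-b..0})"
      using h[of "-x"] that by auto
    moreover have "(uminus has_real_derivative -1) (at x within {-b..0})"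
      by (auto intro!: derivative_eq_intros)
    ultimately have "((\<lambda>x. h (- x)) has_real_derivative - h' (-x)) (at x within {-b..0})"
      using DERIV_image_chain[of h "h' (- x)" uminus x "{-b..0}" "-1"] by (simp add: o_def)
    from DERIV_minus[OF this]
    have "((\<lambda>x. - h (- x)) has_real_derivative h' (-x)) (at x within {-b..0})" by simp
    from has_field_derivative_transform_within[OF this zero_less_one that, of "\<lambda>x. sgn x * h \<bar>x\<bar>"] 
    show ?thesis using that \<open>h 0 = 0\<close> by (auto simp: sgn_if)
  qed
  show ?thesis by (rule deriv_glue[OF \<open>b > 0\<close> x Lm R])
qed

lemma even_extension_deriv:
  fixes h :: "real \<Rightarrow> real"
  assumes h: "\<And>x. x \<in> {0..b} \<Longrightarrow> (h has_real_derivative h' x) (at x within {0..b})" and "h' 0 = 0" "b > 0"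
    and x: "x \<in> {-b..b}"
  shows "((\<lambda>x. h \<bar>x\<bar>) has_real_derivative sgn x * h' \<bar>x\<bar>) (at x within {-b..b})"
proof -
  have R: "((\<lambda>x. h \<bar>x\<bar>) has_real_derivative sgn x * h' \<bar>x\<bar>) (at x within {0..b})" if "x \<in> {0..b}" for x
    using has_field_derivative_transform_within[OF h[OF that] zero_less_one that, of "\<lambda>x. h \<bar>x\<bar>"] that \<open>h' 0 = 0\<close>
    by (auto simp: sgn_if)
  have Lm: "((\<lambda>x. h \<bar>x\<bar>) has_real_derivative sgn x * h' \<bar>x\<bar>) (at x within {-b..0})" if "x \<in> {-b..0}" for x
  proof -
    have "(h has_real_derivative h' (-x)) (at (-x) within uminus ` {-b..0})"
      using h[of "-x"] that by auto
    moreover have "(uminus has_real_derivative -1) (at x within {-b..0})"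
      by (auto intro!: derivative_eq_intros)
    ultimately have "((\<lambda>x. h (- x)) has_real_derivative - h' (-x)) (at x within {-b..0})"
      using DERIV_image_chain[of h "h' (- x)" uminus x "{-b..0}" "-1"] by (simp add: o_def)
    from has_field_derivative_transform_within[OF this zero_less_one that, of "\<lambda>x. h \<bar>x\<bar>"] 
    show ?thesis using that \<open>h' 0 = 0\<close> by (auto simp: sgn_if)
  qed
  show ?thesis by (rule deriv_glue[OF \<open>b > 0\<close> x Lm R])
qed

section \<open>Lipschitz and Taylor estimates for real powers\<close>

lemma powr_lipschitz:
  fixes a b K p :: real
  assumes "p \<ge> 1" "0 \<le> a" "0 \<le> b" "a \<le> K" "b \<le> K"
  shows "\<bar>a powr p - b powr p\<bar> \<le> p * K powr (p - 1) * \<bar>a - b\<bar>"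
proof -
  have *: "b powr p - a powr p \<le> p * K powr (p - 1) * (b - a)" "a powr p \<le> b powr p"
    if ab: "0 \<le> a" "a < b" "b \<le> K" for a b :: real
  proof -
    show "a powr p \<le> b powr p" using ab assms(1) by (intro powr_mono2) auto
    have "continuous_on {a..b} (\<lambda>x. x powr p)"
      using ab assms(1) by (intro continuous_on_powr' continuous_intros) auto
    moreover have "((\<lambda>x. x powr p) has_real_derivative p * x powr (p - 1)) (at x)" if "a < x" "x < b" for x
      using that ab by (auto intro!: derivative_eq_intros)
    ultimately obtain x where x: "a < x" "x < b" "b powr p - a powr p = (b - a) * (p * x powr (p - 1))"
      using mvt_simple[of a b "\<lambda>x. x powr p" "\<lambda>x y. p * x powr (p - 1) * y"] ab(2) MVT[of a b "\<lambda>x. x powr p"]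
      by (metis (no_types, lifting) DERIV_unique real_differentiable_def)
    have "x powr (p - 1) \<le> K powr (p - 1)" using x ab assms(1) by (intro powr_mono2) auto
    then show "b powr p - a powr p \<le> p * K powr (p - 1) * (b - a)"
      using x ab assms(1) by (simp add: mult_left_mono mult.commute)
  qed
  show ?thesis
    using *[of a b] *[of b a] assms by (cases a b rule: linorder_cases) auto
qed

text \<open>The second derivative has exponent \<open>p - 2\<close>, possibly negative, so the
  arguments are kept above 1/2. The even solutions to which this is applied are at least 1 after the
  shift, and small perturbations of them stay above 1/2.\<close>

lemma powr_taylor2:
  fixes p K :: real
  assumes "K \<ge> 1" "p > 0"
  obtains C where "C \<ge> 0" "\<And>a b. a \<in> {1/2..K} \<Longrightarrow> b \<in> {1/2..K} \<Longrightarrow>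
    \<bar>b powr p - a powr p - p * a powr (p - 1) * (b - a)\<bar> \<le> C * (b - a)\<^sup>2"
proof -
  have mvt: "\<exists>x. min a b \<le> x \<and> x \<le> max a b \<and> b powr s - a powr s = (b - a) * (s * x powr (s - 1))" 
    if ab: "a \<in> {1/2..K}" "b \<in> {1/2..K}" for a b s :: real
  proof -
    have *: "\<exists>x. a < x \<and> x < b \<and> b powr s - a powr s = (b - a) * (s * x powr (s - 1))" if "a < b" "a \<ge> 1/2" for a b :: real
      by (rule MVT2[OF that(1)]) (use that in \<open>auto intro!: derivative_eq_intros\<close>)
    consider "a < b" | "a = b" | "b < a" by linarith
    then show ?thesis
    proof cases
      case 1
      then obtain x where "a < x" "x < b" "b powr s - a powr s = (b - a) * (s * x powr (s - 1))" using *[of a b] ab by auto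
      then show ?thesis using 1 by (intro exI[of _ x]) auto
    next
      case 3 
      then obtain x where "b < x" "x < a" "a powr s - b powr s = (a - b) * (s * x powr (s - 1))" using *[of b a] ab by auto
      then show ?thesis using 3 by (intro exI[of _ x]) (auto simp: algebra_simps)
    qed auto
  qed
  have "continuous_on {1/2..K} (\<lambda>x. p * (p - 1) * x powr (p - 2))"
    by (intro continuous_intros) auto
  then have "bounded ((\<lambda>x. p * (p - 1) * x powr (p - 2)) ` {1/2..K})"
    by (intro compact_imp_bounded compact_continuous_image) auto
  then obtain C where C: "\<forall>x\<in>{1/2..K}. \<bar>p * (p - 1) * x powr (p - 2)\<bar> \<le> C" by (auto simp: bounded_iff)
  show thesis
  proof (rule that[of C])
    show "C \<ge> 0" using C[rule_format, of 1] assms by auto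
    fix a b assume ab: "a \<in> {1/2..K}" "b \<in> {1/2..K}"
    obtain x where x: "min a b \<le> x" "x \<le> max a b" "b powr p - a powr p = (b - a) * (p * x powr (p - 1))"
      using mvt[OF ab] by blast
    have xI: "x \<in> {1/2..K}" using x ab by auto
    obtain y where y: "min a x \<le> y" "y \<le> max a x" "x powr (p - 1) - a powr (p - 1) = (x - a) * ((p - 1) * y powr (p - 1 - 1))"
      using mvt[OF ab(1) xI, of "p - 1"] by blast
    have yI: "y \<in> {1/2..K}" using y ab xI by auto
    have "b powr p - a powr p - p * a powr (p - 1) * (b - a) = (b - a) * p * (x powr (p - 1) - a powr (p - 1))"
      using x(3) by (simp add: algebra_simps)
    also have "\<dots> = (p * (p - 1) * y powr (p - 2)) * ((b - a) * (x - a))" unfolding y(3) by simp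
    finally have "\<bar>b powr p - a powr p - p * a powr (p - 1) * (b - a)\<bar> = \<bar>p * (p - 1) * y powr (p - 2)\<bar> * (\<bar>b - a\<bar> * \<bar>x - a\<bar>)"
      by (simp add: abs_mult)
    also have "\<dots> \<le> C * (\<bar>b - a\<bar> * \<bar>b - a\<bar>)"
      using C yI x by (intro mult_mono) auto
    finally show "\<bar>b powr p - a powr p - p * a powr (p - 1) * (b - a)\<bar> \<le> C * (b - a)\<^sup>2"
      by (simp add: power2_eq_square)
  qed
qed

section \<open>Linear equations with a continuous potential\<close>

lemma linear_ode_exists:
  fixes q :: "real \<Rightarrow> real"
  assumes "a \<le> b" "continuous_on {a..b} q"
  obtains y y1 where "y a = A" "y1 a = B"
    "\<And>x. x \<in> {a..b} \<Longrightarrow> (y has_real_derivative y1 x) (at x within {a..b})"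
    "\<And>x. x \<in> {a..b} \<Longrightarrow> (y1 has_real_derivative - q x * y x) (at x within {a..b})"
proof -
  have "bounded (q ` {a..b})" using assms(2) by (intro compact_imp_bounded compact_continuous_image) auto
  then obtain M where "\<forall>x\<in>{a..b}. \<bar>q x\<bar> \<le> M" by (auto simp: bounded_iff)
  then have M: "\<bar>q x\<bar> \<le> M" if "x \<in> {a..b}" for x using that by blast
  have "M \<ge> 0" using M[of a] assms(1) by auto
  have c: "continuous_on ({a..b} \<times> UNIV) (\<lambda>(x,u). - q x * u)"
    unfolding case_prod_unfold
    by (intro continuous_intros continuous_on_compose2[OF assms(2)]) auto
  show thesis
  proof (rule picard2[where f="\<lambda>x u. - q x * u" and A=A and B=B, OF assms(1) \<open>M \<ge> 0\<close> c])
    show "\<bar>- q x * u - - q x * v\<bar> \<le> M * \<bar>u - v\<bar>" if "x \<in> {a..b}" for x u v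
    proof -
      have "- q x * u - - q x * v = - q x * (u - v)" by (simp add: algebra_simps)
      then show ?thesis using M[OF that] by (simp only: abs_mult abs_minus_cancel mult_right_mono abs_ge_zero)
    qed
  qed (rule that)
qed

lemma linear_ode_unique:
  fixes q :: "real \<Rightarrow> real"
  assumes "ode2 a b y y1 (\<lambda>x. - q x * y x)" "ode2 a b z z1 (\<lambda>x. - q x * z x)" "y a = z a" "y1 a = z1 a"
    and "continuous_on {a..b} q" "x \<in> {a..b}"
  shows "y x = z x" "y1 x = z1 x"
proof -
  have "bounded (q ` {a..b})" using assms(5) by (intro compact_imp_bounded compact_continuous_image) auto
  then obtain M where "\<forall>x\<in>{a..b}. \<bar>q x\<bar> \<le> M" by (auto simp: bounded_iff)
  then have M: "\<bar>q x\<bar> \<le> M" if "x \<in> {a..b}" for x using that by blast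
  have "M \<ge> 0" using M[of x] assms(6) by auto
  have lip: "\<bar>- q x * y x - - q x * z x\<bar> \<le> M * \<bar>y x - z x\<bar>" if "a < x" "x < b" for x
  proof -
    have "- q x * y x - - q x * z x = - q x * (y x - z x)" by (simp add: algebra_simps)
    then show ?thesis using M[of x] that by (simp add: abs_mult mult_right_mono)
  qed
  show "y x = z x" "y1 x = z1 x"
    using ode2_unique[where f="\<lambda>x u. - q x * u", OF assms(1-4) \<open>M \<ge> 0\<close> _ assms(6)] lip by auto
qed

section \<open>The rescaled profile and its linearization\<close>

text \<open>\<open>W\<close> is the profile shifted to start at 1, \<open>V\<close> is its
  derivative and \<open>r\<close> its first zero. Collecting these facts abstractly makes the
  analysis independent of how the profile was selected.\<close>

locale emden =
  fixes l p r :: real and W V :: "real \<Rightarrow> real"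
  assumes l: "l > 0" and p: "p > 1" and pl: "(p - 1) * l > 3" and r: "r > 0"
    and W_0: "W 0 = 1" and V_0: "V 0 = 0"
    and W_deriv: "\<And>x. x \<in> {0..r} \<Longrightarrow> (W has_real_derivative V x) (at x within {0..r})"
    and V_deriv: "\<And>x. x \<in> {0..r} \<Longrightarrow> (V has_real_derivative - (x powr l * W x powr p)) (at x within {0..r})"
    and W_pos: "\<And>x. 0 \<le> x \<Longrightarrow> x < r \<Longrightarrow> W x > 0" and W_r: "W r = 0"
begin

lemma W_ode: "ode2 0 r W V (\<lambda>x. - (x powr l * W x powr p))"
  by (rule ode2_within[OF W_deriv V_deriv])

lemmas W_cont = ode2D(1)[OF W_ode]
lemmas V_cont = ode2D(2)[OF W_ode]
lemmas W_D = ode2D(3)[OF W_ode]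
lemmas V_D = ode2D(4)[OF W_ode]

lemma W_nonneg: "0 \<le> x \<Longrightarrow> x \<le> r \<Longrightarrow> W x \<ge> 0"
  using W_pos[of x] W_r by (cases "x = r") auto

lemma W_powr_cont: "s > 0 \<Longrightarrow> continuous_on {0..r} (\<lambda>x. W x powr s)"
  using W_nonneg by (intro continuous_on_powr' W_cont continuous_intros) auto

lemma id_powr_cont: "s > 0 \<Longrightarrow> continuous_on {0..r} (\<lambda>x. x powr s)"
  by (intro continuous_on_powr' continuous_intros) auto

lemma V_neg:
  assumes "0 < x" "x \<le> r" shows "V x < 0"
proof -
  have "V x < V 0"
  proof (rule DERIV_neg_imp_decreasing_open[OF assms(1)])
    show "continuous_on {0..x} V" using V_cont by (rule continuous_on_subset) (use assms in auto)
    show "\<exists>d. (V has_real_derivative d) (at t) \<and> d < 0" if "0 < t" "t < x" for t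
      using V_D[of t] W_pos[of t] that assms by (intro exI[of _ "- (t powr l * W t powr p)"]) auto
  qed
  then show ?thesis using V_0 by simp
qed

lemma W_decr:
  assumes "0 \<le> x" "x < y" "y \<le> r" shows "W y < W x"
proof (rule DERIV_neg_imp_decreasing_open[OF assms(2)])
  show "continuous_on {x..y} W" using W_cont by (rule continuous_on_subset) (use assms in auto)
  show "\<exists>d. (W has_real_derivative d) (at t) \<and> d < 0" if "x < t" "t < y" for t
    using W_D[of t] V_neg[of t] that assms by (intro exI[of _ "V t"]) auto
qed

lemma V_decr:
  assumes "0 \<le> x" "x < y" "y \<le> r" shows "V y < V x"
proof (rule DERIV_neg_imp_decreasing_open[OF assms(2)])
  show "continuous_on {x..y} V" using V_cont by (rule continuous_on_subset) (use assms in auto)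
  show "\<exists>d. (V has_real_derivative d) (at t) \<and> d < 0" if "x < t" "t < y" for t
    using V_D[of t] W_pos[of t] that assms by (intro exI[of _ "- (t powr l * W t powr p)"]) auto
qed

text \<open>The potential of the linearization at \<open>W\<close>.\<close>

definition q where "q x = p * x powr l * W x powr (p - 1)"

lemma q_cont: "continuous_on {0..r} q"
  unfolding q_def using l p by (intro continuous_intros W_powr_cont id_powr_cont) auto

text \<open>If \<open>W\<close> solves the equation, then so does
  \<open>s powr k * W (s * x)\<close> for every \<open>s > 0\<close>; this fixes \<open>k\<close>
  through \<open>k * p = k + l + 2\<close>. Differentiating in \<open>s\<close> at 1 gives
  \<open>\<psi>\<close>, which hence solves the linearized equation, and \<open>\<psi>1\<close> is
  its derivative.\<close>

definition k where "k = (l + 2) / (p - 1)"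
definition \<psi> where "\<psi> x = x * V x + k * W x"
definition \<psi>1 where "\<psi>1 x = (k + 1) * V x - x powr (l + 1) * W x powr p"

lemma k_pos: "k > 0" using l p by (simp add: k_def)

lemma \<psi>_0: "\<psi> 0 = k" by (simp add: \<psi>_def W_0)
lemma \<psi>1_0: "\<psi>1 0 = 0" using l by (simp add: \<psi>1_def V_0)

lemma \<psi>_ode: "ode2 0 r \<psi> \<psi>1 (\<lambda>x. - q x * \<psi> x)"
  unfolding ode2_def
proof (intro conjI ballI)
  show "continuous_on {0..r} \<psi>" unfolding \<psi>_def by (intro continuous_intros W_cont V_cont)
  show "continuous_on {0..r} \<psi>1" unfolding \<psi>1_def using l p 
    by (intro continuous_intros V_cont W_powr_cont id_powr_cont) auto
  fix x assume "x \<in> {0<..<r}" then have x: "0 < x" "x < r" by auto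
  have W: "W x > 0" using W_pos x by auto
  have x1: "x powr (l + 1) = x * x powr l" using x by (simp add: powr_add)
  have W1: "W x powr p = W x * W x powr (p - 1)" using W by (simp add: powr_diff)
  show "(\<psi> has_real_derivative \<psi>1 x) (at x)"
    unfolding \<psi>_def using W_D[OF x] V_D[OF x]
    by (auto intro!: derivative_eq_intros simp: \<psi>1_def x1[unfolded add.commute[of l]] algebra_simps)
  have kp: "k * p = k + l + 2" using p by (simp add: k_def field_simps)
  have "(\<psi>1 has_real_derivative (k + 1) * (- (x powr l * W x powr p))
     - ((l + 1) * x powr l * W x powr p + x powr (l + 1) * (p * W x powr (p - 1) * V x))) (at x)"
    unfolding \<psi>1_def using W_D[OF x] V_D[OF x] W x
    by (auto intro!: derivative_eq_intros simp: mult_ac)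
  also have "(k + 1) * (- (x powr l * W x powr p))
     - ((l + 1) * x powr l * W x powr p + x powr (l + 1) * (p * W x powr (p - 1) * V x))
     = - (x powr l * W x powr (p - 1)) * ((k + l + 2) * W x + p * (x * V x))"
    unfolding x1 W1 by (simp add: algebra_simps)
  also have "\<dots> = - q x * \<psi> x"
    unfolding q_def \<psi>_def kp[symmetric] by (simp add: algebra_simps)
  finally show "(\<psi>1 has_real_derivative - q x * \<psi> x) (at x)" .
qed

lemma \<psi>_decr:
  assumes "0 \<le> x" "x < y" "y \<le> r" shows "\<psi> y < \<psi> x"
proof (rule DERIV_neg_imp_decreasing_open[OF assms(2)])
  show "continuous_on {x..y} \<psi>" using ode2D(1)[OF \<psi>_ode] by (rule continuous_on_subset) (use assms in auto)
  fix t assume t: "x < t" "t < y"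
  have "(k + 1) * V t < 0" using k_pos V_neg[of t] t assms by (intro mult_pos_neg) auto
  moreover have "0 \<le> t powr (l + 1) * W t powr p" by simp
  ultimately have "\<psi>1 t < 0" unfolding \<psi>1_def by linarith
  then show "\<exists>d. (\<psi> has_real_derivative d) (at t) \<and> d < 0"
    using ode2D(3)[OF \<psi>_ode, of t] t assms by auto
qed

lemma \<psi>_zero:
  obtains e where "0 < e" "e < r" "\<psi> e = 0" "\<And>x. 0 \<le> x \<Longrightarrow> x < e \<Longrightarrow> \<psi> x > 0" "\<And>x. e < x \<Longrightarrow> x \<le> r \<Longrightarrow> \<psi> x < 0"
proof -
  have neg: "\<psi> r < 0" unfolding \<psi>_def using r V_neg[of r] W_r by (simp add: mult_pos_neg)
  then obtain e where e: "0 \<le> e" "e \<le> r" "\<psi> e = 0"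
    using IVT2'[of \<psi> r 0 0] k_pos \<psi>_0 r ode2D(1)[OF \<psi>_ode] by auto
  moreover have "e \<noteq> 0" "e \<noteq> r" using e \<psi>_0 k_pos neg by auto
  ultimately show thesis using \<psi>_decr[of _ e] \<psi>_decr[of e] by (intro that[of e]) fastforce+
qed

text \<open>Since \<open>W\<close> decreases, \<open>- V x\<close>, the integral of
  \<open>t powr l * W t powr p\<close> from 0 to \<open>x\<close>, is at least
  \<open>W x powr p\<close> times the integral of \<open>t powr l\<close>. The bound controls the
  term with the negative factor \<open>d - 1\<close> in the comparison argument below.\<close>

lemma P_lower:
  assumes "0 \<le> x" "x \<le> r"
  shows "x powr (l + 1) * W x powr p \<le> (l + 1) * (- V x)"
proof -
  define N where "N x = (l + 1) * (- V x) - x powr (l + 1) * W x powr p" for x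
  have "N 0 \<le> N x"
  proof (rule DERIV_nonneg_imp_increasing_open[OF assms(1)])
    show "continuous_on {0..x} N" unfolding N_def using l p assms
      by (intro continuous_intros continuous_on_subset[OF V_cont]
        continuous_on_subset[OF W_powr_cont] continuous_on_subset[OF id_powr_cont]) auto
    fix t assume t: "0 < t" "t < x"
    then have t': "0 < t" "t < r" using assms by auto
    have W: "W t > 0" using W_pos t' by auto
    have "(N has_real_derivative (l + 1) * (t powr l * W t powr p) 
      - ((l + 1) * t powr l * W t powr p + t powr (l + 1) * (p * W t powr (p - 1) * V t))) (at t)"
      unfolding N_def using W_D[OF t'] V_D[OF t'] W t
      by (auto intro!: derivative_eq_intros simp: mult_ac)
    also have "(l + 1) * (t powr l * W t powr p) 
      - ((l + 1) * t powr l * W t powr p + t powr (l + 1) * (p * W t powr (p - 1) * V t))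
      = t powr (l + 1) * (p * W t powr (p - 1) * (- V t))" by simp
    finally show "\<exists>y. (N has_real_derivative y) (at t) \<and> 0 \<le> y"
      using V_neg[of t] t' p by (intro exI conjI) (assumption, intro mult_nonneg_nonneg, auto)
  qed
  then show ?thesis using l by (simp add: N_def V_0)
qed

text \<open>The comparison function is \<open>W (- W')\<^sup>d\<close> with \<open>d = 1 / (l + 1)\<close>, the exponent for which it behaves
  like a multiple of \<open>x\<close> at the origin; \<open>(p - 1) l > 3\<close> makes it a strict subsolution of the linearized
  equation.\<close>

lemma odd_solution_negative_at_end:
  assumes z: "ode2 0 r z z1 (\<lambda>x. - q x * z x)" and "z 0 = 0"
    and pos: "\<And>x. 0 < x \<Longrightarrow> x < r \<Longrightarrow> z x > 0"
  shows "z r < 0"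
proof (rule ccontr)
  assume "\<not> z r < 0" then have zr: "z r \<ge> 0" by simp
  define d where "d = 1 / (l + 1)"
  have d: "0 < d" "d * (l + 1) = 1" using l by (auto simp: d_def)
  define P where "P x = - V x" for x
  have P: "P x > 0" if "0 < x" "x \<le> r" for x using V_neg that by (simp add: P_def)
  have P_cont: "continuous_on {0..r} P" unfolding P_def by (intro continuous_intros V_cont)
  have P_nonneg: "P x \<ge> 0" if "0 \<le> x" "x \<le> r" for x
    using P[of x] that V_0 by (cases "x = 0") (auto simp: P_def)
  have P_powr_cont: "continuous_on {0..r} (\<lambda>x. P x powr s)" if "s > 0" for s
    using that P_nonneg by (intro continuous_on_powr' P_cont continuous_intros) auto
  define y where "y x = W x * P x powr d" for x
  define y1 where "y1 x = - (P x powr (d + 1)) + d * x powr l * W x powr (p + 1) * P x powr (d - 1)" for x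
  define y2 where "y2 x = - (d + 1) * P x powr d * (x powr l * W x powr p)
     + d * (l * x powr (l - 1) * W x powr (p + 1) * P x powr (d - 1)
     - x powr l * ((p + 1) * W x powr p * P x) * P x powr (d - 1)
     + x powr l * W x powr (p + 1) * ((d - 1) * P x powr (d - 2) * (x powr l * W x powr p)))" for x
  have P_D: "(P has_real_derivative x powr l * W x powr p) (at x)" if "0 < x" "x < r" for x
    unfolding P_def using V_D[OF that] by (auto intro!: derivative_eq_intros)
  have W_D': "(W has_real_derivative - P x) (at x)" if "0 < x" "x < r" for x
    using W_D[OF that] by (simp add: P_def)
  have y_D: "(y has_real_derivative y1 x) (at x)" if x: "0 < x" "x < r" for x
  proof -
    have W: "W x > 0" and Px: "P x > 0" using W_pos P x by auto
    have "(y has_real_derivative W x * (d * P x powr (d - 1) * (x powr l * W x powr p)) + - P x * P x powr d) (at x)"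
      unfolding y_def using W_D'[OF x] P_D[OF x] Px by (auto intro!: derivative_eq_intros simp: mult_ac)
    also have "W x * (d * P x powr (d - 1) * (x powr l * W x powr p)) + - P x * P x powr d = y1 x"
      unfolding y1_def using W Px by (simp add: powr_add algebra_simps)
    finally show ?thesis .
  qed
  have y1_D: "(y1 has_real_derivative y2 x) (at x)" if x: "0 < x" "x < r" for x
  proof -
    have W: "W x > 0" and Px: "P x > 0" using W_pos P x by auto
    show ?thesis
      unfolding y1_def y2_def using W_D'[OF x] P_D[OF x] Px W x 
      by (auto intro!: derivative_eq_intros simp: algebra_simps)
  qed
  have y2_gt: "y2 x + q x * y x > 0" if x: "0 < x" "x < r" for x
  proof -
    have W: "W x > 0" and Px: "P x > 0" using W_pos P x by auto
    define A where "A = x powr (l - 1)"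
    define B where "B = W x powr p"
    define C where "C = P x powr (d - 2)"
    have ABC: "A > 0" "B > 0" "C > 0" using x W Px by (auto simp: A_def B_def C_def)
    have e: "x powr l = x * A" "W x powr (p + 1) = W x * B" "P x powr (d - 1) = P x * C" "P x powr d = P x * P x * C"
      using x W Px by (auto simp: A_def B_def C_def powr_add powr_diff power2_eq_square divide_simps)
    have qy: "q x * y x = p * (x * A) * B * (P x * P x * C)"
      unfolding q_def y_def e(1,4) B_def using W by (simp add: powr_diff)
    \<comment> \<open>With the powers factored out, two brackets remain. The first, multiplied by
      \<open>l + 1\<close>, is \<open>(p - 1) * l - 3\<close>, which is where the constant 3 comes
      from. The second is nonnegative by \<open>P_lower\<close>, because
      \<open>1 - d = d * l\<close>.\<close>
    have "y2 x + q x * y x = A * B * C * P x * P x * x * (p - (d + 1) - d * (p + 1))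
       + d * A * W x * B * C * (l * P x - (1 - d) * (x * x * A * B))"
      unfolding qy unfolding y2_def B_def[symmetric] C_def[symmetric] A_def[symmetric] e
      by (simp add: algebra_simps)
    moreover have "p - (d + 1) - d * (p + 1) > 0"
    proof -
      have "(l + 1) * (p - (d + 1) - d * (p + 1)) = (p - 1) * (l + 1) - d * (l + 1) * (p + 2)"
        by (simp add: algebra_simps)
      also have "\<dots> > 0" using pl unfolding d(2) by (simp add: algebra_simps)
      finally show ?thesis using l by (simp add: zero_less_mult_iff)
    qed
    moreover have "(1 - d) * (x * x * A * B) \<le> l * P x"
    proof -
      have "x powr (l + 1) = x * x * A" using x by (simp add: A_def powr_add powr_diff divide_simps)
      then have "x * x * A * B \<le> (l + 1) * P x" using P_lower[of x] x by (simp add: P_def B_def)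
      then have "(d * l) * (x * x * A * B) \<le> (d * l) * ((l + 1) * P x)" using d l by (intro mult_left_mono) auto
      also have "\<dots> = (d * (l + 1)) * (l * P x)" by (simp only: mult_ac)
      also have "\<dots> = l * P x" unfolding d(2) by simp
      finally have *: "(d * l) * (x * x * A * B) \<le> l * P x" .
      have dl: "d * l = 1 - d" using d(2) by (simp add: algebra_simps)
      show ?thesis using * unfolding dl .
    qed
    ultimately show ?thesis using ABC x W Px d(1) by (simp add: add_pos_nonneg)
  qed
  \<comment> \<open>The Wronskian of \<open>z\<close> and the comparison function: its derivative is
    \<open>z\<close> times the positive defect \<open>y2 + q * y\<close>, so it increases strictly.
    If \<open>z r \<ge> 0\<close>, it is nonpositive at \<open>r\<close>, where \<open>W\<close>
    vanishes; the contradiction has to come from its behaviour at 0.\<close>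
  define H where "H x = z x * y1 x - z1 x * y x" for x
  have y_cont: "continuous_on {0..r} y"
    unfolding y_def using d by (intro continuous_intros W_cont P_powr_cont)
  have y1_cont: "continuous_on {c..r} y1" if "0 < c" for c
  proof -
    have "P x \<noteq> 0" if "x \<in> {c..r}" for x using P[of x] that \<open>0 < c\<close> by auto
    then show ?thesis
    unfolding y1_def using that p l
    by (intro continuous_intros continuous_on_subset[OF W_powr_cont] continuous_on_subset[OF id_powr_cont]
       continuous_on_subset[OF P_cont]) auto
  qed
  have H_cont: "continuous_on {c..r} H" if "0 < c" for c
    unfolding H_def using ode2D(1,2)[OF z] y_cont y1_cont[OF that] that
    by (auto intro!: continuous_intros intro: continuous_on_subset)
  have H_D: "(H has_real_derivative z x * (y2 x + q x * y x)) (at x)" if "0 < x" "x < r" for x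
    unfolding H_def using y_D[OF that] y1_D[OF that] ode2D(3,4)[OF z that]
    by (auto intro!: derivative_eq_intros simp: algebra_simps)
  have H_mono: "H c < H x" if "0 < c" "c < x" "x \<le> r" for c x
  proof (rule DERIV_pos_imp_increasing_open[OF that(2)])
    show "continuous_on {c..x} H" using H_cont[OF that(1)] by (rule continuous_on_subset) (use that in auto)
    show "\<exists>y. (H has_real_derivative y) (at t) \<and> 0 < y" if "c < t" "t < x" for t
      using H_D[of t] pos[of t] y2_gt[of t] that \<open>0 < c\<close> \<open>x \<le> r\<close> by (intro exI[of _ "z t * (y2 t + q t * y t)"]) auto
  qed
  have "H r \<le> 0"
    unfolding H_def y_def y1_def using W_r zr p by (simp add: mult_nonneg_nonpos)
  then have Hm: "H (r / 2) < 0" using H_mono[of "r/2" r] r by auto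
  \<comment> \<open>\<open>y1\<close> contains a power of \<open>P\<close> with the negative
    exponent \<open>d - 1\<close>, and \<open>P\<close> vanishes at 0, so \<open>H\<close> need not
    be continuous there. Dropping that nonnegative term leaves a lower bound \<open>G\<close> that
    is continuous with \<open>G 0 = 0\<close>.\<close>
  define G where "G x = - z x * P x powr (d + 1) - z1 x * y x" for x
  have "continuous_on {0..r} G"
    unfolding G_def using ode2D(1,2)[OF z] y_cont d
    by (intro continuous_intros P_powr_cont) auto
  moreover have "G 0 = 0" using \<open>z 0 = 0\<close> d by (simp add: G_def y_def P_def V_0)
  ultimately obtain \<delta> where \<delta>: "\<delta> > 0" "\<And>x. x \<in> {0..r} \<Longrightarrow> dist x 0 < \<delta> \<Longrightarrow> dist (G x) 0 < - H (r/2)"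
    using Hm r unfolding continuous_on_iff by (metis atLeastAtMost_iff less_imp_le neg_0_less_iff_less order_refl)
  define x where "x = min (\<delta> / 2) (r / 4)"
  have x: "0 < x" "x < \<delta>" "x < r / 2" "x < r" using \<delta> r by (auto simp: x_def min_def)
  have "G x > H (r / 2)" using \<delta>(2)[of x] x by (auto simp: dist_real_def)
  moreover have "G x \<le> H x"
  proof -
    have "0 \<le> d * x powr l * W x powr (p + 1) * P x powr (d - 1)" using d by simp
    then have "z x * (- (P x powr (d + 1))) \<le> z x * y1 x"
      unfolding y1_def using pos[of x] x by (intro mult_left_mono) auto
    then show ?thesis by (simp add: G_def H_def)
  qed
  ultimately show False using H_mono[of x "r/2"] x r by auto
qed

text \<open>The constant Wronskian makes \<open>z / \<psi>\<close> strictly increasing on each side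
  of \<open>e\<close>. Hence \<open>z\<close> is positive before \<open>e\<close> and has at most
  one zero after it; at \<open>e\<close> itself the identity \<open>\<psi>1 e * z e = - k\<close>
  with \<open>\<psi>1 e \<le> 0\<close> gives \<open>z e > 0\<close>.\<close>

lemma odd_solution_zero:
  obtains z z1 e c where "ode2 0 r z z1 (\<lambda>x. - q x * z x)" "z 0 = 0" "z1 0 = 1"
    "0 < e" "e < c" "c < r"
    "\<psi> e = 0" "\<And>x. 0 \<le> x \<Longrightarrow> x < e \<Longrightarrow> \<psi> x > 0" "\<And>x. e < x \<Longrightarrow> x \<le> r \<Longrightarrow> \<psi> x < 0"
    "z c = 0" "\<And>x. 0 < x \<Longrightarrow> x < c \<Longrightarrow> z x > 0" "\<And>x. c < x \<Longrightarrow> x \<le> r \<Longrightarrow> z x < 0"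
proof -
  obtain e where e: "0 < e" "e < r" "\<psi> e = 0" "\<And>x. 0 \<le> x \<Longrightarrow> x < e \<Longrightarrow> \<psi> x > 0" "\<And>x. e < x \<Longrightarrow> x \<le> r \<Longrightarrow> \<psi> x < 0"
    by (rule \<psi>_zero) blast
  obtain z z1 where z0: "z 0 = 0" "z1 0 = 1"
    and zd: "\<And>x. x \<in> {0..r} \<Longrightarrow> (z has_real_derivative z1 x) (at x within {0..r})"
    "\<And>x. x \<in> {0..r} \<Longrightarrow> (z1 has_real_derivative - q x * z x) (at x within {0..r})"
    using linear_ode_exists[OF less_imp_le[OF r] q_cont, of 0 1] by metis
  have z: "ode2 0 r z z1 (\<lambda>x. - q x * z x)" by (rule ode2_within[OF zd])
  have wr: "\<psi> x * z1 x - \<psi>1 x * z x = k" if "0 \<le> x" "x \<le> r" for x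
    using wronskian_const[OF \<psi>_ode z, of x 0] that r z0 \<psi>_0 by auto
  define Q where "Q x = z x / \<psi> x" for x
  have Q_incr: "Q x < Q y" if xy: "0 \<le> x" "x < y" "y \<le> r" "y < e \<or> e < x" for x y
  proof (rule DERIV_pos_imp_increasing_open[OF xy(2)])
    have n: "\<psi> t \<noteq> 0" if "x \<le> t" "t \<le> y" for t using e(4)[of t] e(5)[of t] that xy by force
    show "continuous_on {x..y} Q" unfolding Q_def
      using n xy by (intro continuous_intros continuous_on_subset[OF ode2D(1)[OF z]] 
        continuous_on_subset[OF ode2D(1)[OF \<psi>_ode]]) auto
    fix t assume t: "x < t" "t < y"
    then have t': "0 < t" "t < r" using xy by auto
    have "(Q has_real_derivative (z1 t * \<psi> t - z t * \<psi>1 t) / (\<psi> t * \<psi> t)) (at t)"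
      unfolding Q_def using ode2D(3)[OF z t'] ode2D(3)[OF \<psi>_ode t'] n[of t] t by (auto intro!: DERIV_divide)
    moreover have "z1 t * \<psi> t - z t * \<psi>1 t = k" using wr[of t] t' by (simp add: mult.commute)
    ultimately show "\<exists>y. (Q has_real_derivative y) (at t) \<and> 0 < y" 
      using k_pos n[of t] t by (intro exI[of _ "k / (\<psi> t * \<psi> t)"]) (auto simp: zero_less_mult_iff linorder_neq_iff)
  qed
  have pos1: "z x > 0" if "0 < x" "x < e" for x
    using Q_incr[of 0 x] that e(2) e(4)[of x] z0 by (auto simp: Q_def zero_less_divide_iff)
  have pos2: "z e > 0"
  proof -
    have "\<psi>1 e * z e = - k" using wr[of e] e by auto
    moreover have "\<psi>1 e \<le> 0" using zero_deriv_nonpos[OF ode2_subset[OF \<psi>_ode order_refl, of e] e(1,3)] e by auto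
    ultimately show ?thesis using k_pos by (smt (verit) mult_nonneg_nonpos mult_nonpos_nonpos)
  qed
  \<comment> \<open>Otherwise \<open>z / \<psi>\<close> is nonpositive at \<open>r\<close>, hence
    negative on all of the interval from \<open>e\<close> to \<open>r\<close>. Then \<open>z\<close>
    is positive up to \<open>r\<close>, and \<open>odd_solution_negative_at_end\<close>
    applies.\<close>
  have zr: "z r < 0"
  proof (rule ccontr)
    assume a: "\<not> z r < 0"
    have "z x > 0" if "0 < x" "x < r" for x
    proof (cases x e rule: linorder_cases)
      case greater
      have "Q r \<le> 0" using a e(5)[of r] e(2) by (auto simp: Q_def divide_nonneg_neg)
      then have "Q x < 0" using Q_incr[of x r] that greater by auto
      then show ?thesis using e(5)[of x] greater that by (auto simp: Q_def divide_less_0_iff)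
    qed (use pos1 pos2 that in auto)
    from odd_solution_negative_at_end[OF z z0(1) this] a show False by simp
  qed
  then obtain c where c: "e \<le> c" "c \<le> r" "z c = 0"
    using IVT2'[of z r 0 e] pos2 e(2) continuous_on_subset[OF ode2D(1)[OF z], of "{e..r}"] e(1) by auto
  have c': "e < c" "c < r" using c pos2 zr by (auto simp: order.order_iff_strict)
  have Qc: "Q c = 0" using c by (simp add: Q_def)
  have "z x > 0" if "0 < x" "x < c" for x
  proof (cases x e rule: linorder_cases)
    case greater
    have "Q x < 0" using Q_incr[of x c] that greater e(1) c Qc by auto
    then show ?thesis using e(5)[of x] greater that c by (auto simp: Q_def divide_less_0_iff)
  qed (use pos1 pos2 that in auto)
  moreover have "z x < 0" if "c < x" "x \<le> r" for x
  proof -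
    have "Q x > 0" using Q_incr[of c x] that c' e(1) Qc by auto
    then show ?thesis using e(5)[of x] c' that by (auto simp: Q_def zero_less_divide_iff)
  qed
  ultimately show thesis using z z0 e c' c by (intro that[of z z1 e c]) auto
qed

end

section \<open>Counting negative eigenvalues by shooting and Sturm comparison\<close>

lemma locally_lipschitz_isCont:
  fixes f :: "real \<Rightarrow> real"
  assumes "\<And>x. \<bar>x - a\<bar> \<le> 1 \<Longrightarrow> \<bar>f x - f a\<bar> \<le> K * \<bar>x - a\<bar>"
  shows "isCont f a"
proof -
  have "((\<lambda>x. K * \<bar>x - a\<bar>) \<longlongrightarrow> K * \<bar>a - a\<bar>) (at a)" by (intro tendsto_intros)
  then have lim: "((\<lambda>x. K * \<bar>x - a\<bar>) \<longlongrightarrow> 0) (at a)" by simp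
  have "\<forall>\<^sub>F x in at a. norm (f x - f a) \<le> K * \<bar>x - a\<bar>"
    unfolding eventually_at by (rule exI[of _ 1]) (auto intro!: assms simp: dist_real_def)
  then have "((\<lambda>x. f x - f a) \<longlongrightarrow> 0) (at a)" using lim by (rule Lim_null_comparison)
  then show ?thesis by (simp add: isCont_def LIM_zero_iff)
qed

text \<open>The potential on the full interval is \<open>Q \<bar>x\<bar>\<close>, so it suffices to
  solve from the centre: the data 1, 0 at 0 lead to the even and the data 0, 1 to the odd
  eigenfunctions.\<close>

locale sturm_liouville =
  fixes Q :: "real \<Rightarrow> real"
  assumes Q_cont: "continuous_on {0..1} Q"
begin

definition is_sol :: "real \<Rightarrow> real \<Rightarrow> real \<Rightarrow> (real \<Rightarrow> real) \<times> (real \<Rightarrow> real) \<Rightarrow> bool" where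
  "is_sol A B \<mu> y \<longleftrightarrow> fst y 0 = A \<and> snd y 0 = B \<and> (\<forall>x\<in>{0..1}.
     (fst y has_real_derivative snd y x) (at x within {0..1}) \<and>
     (snd y has_real_derivative - (Q x + \<mu>) * fst y x) (at x within {0..1}))"

definition sol :: "real \<Rightarrow> real \<Rightarrow> real \<Rightarrow> (real \<Rightarrow> real) \<times> (real \<Rightarrow> real)" where
  "sol A B \<mu> = (SOME y. is_sol A B \<mu> y)"

abbreviation "S A B \<mu> \<equiv> fst (sol A B \<mu>)"
abbreviation "S1 A B \<mu> \<equiv> snd (sol A B \<mu>)"

lemma is_sol_sol: "is_sol A B \<mu> (sol A B \<mu>)"
proof -
  have "continuous_on {0..1} (\<lambda>x. Q x + \<mu>)" by (intro continuous_intros Q_cont)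
  then obtain y y1 where "y 0 = A" "y1 0 = B" 
    "\<And>x. x \<in> {0..1} \<Longrightarrow> (y has_real_derivative y1 x) (at x within {0..1})"
    "\<And>x. x \<in> {0..1} \<Longrightarrow> (y1 has_real_derivative - (Q x + \<mu>) * y x) (at x within {0..1})"
    using linear_ode_exists[of 0 1 "\<lambda>x. Q x + \<mu>" A B] by auto
  then have "is_sol A B \<mu> (y, y1)" by (auto simp: is_sol_def)
  then show ?thesis unfolding sol_def by (rule someI)
qed

lemma S_0 [simp]: "S A B \<mu> 0 = A" "S1 A B \<mu> 0 = B"
  using is_sol_sol[of A B \<mu>] by (auto simp: is_sol_def)

lemma S_deriv:
  "x \<in> {0..1} \<Longrightarrow> (S A B \<mu> has_real_derivative S1 A B \<mu> x) (at x within {0..1})"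
  "x \<in> {0..1} \<Longrightarrow> (S1 A B \<mu> has_real_derivative - (Q x + \<mu>) * S A B \<mu> x) (at x within {0..1})"
  using is_sol_sol[of A B \<mu>] by (auto simp: is_sol_def)

lemma S_ode: "ode2 0 1 (S A B \<mu>) (S1 A B \<mu>) (\<lambda>x. - (Q x + \<mu>) * S A B \<mu> x)"
  by (rule ode2_within[OF S_deriv])

lemmas S_cont = ode2D(1)[OF S_ode]

lemma S_wronskian:
  assumes "x \<in> {0..1}"
  shows "S 1 0 \<mu> x * S1 0 1 \<mu> x - S1 1 0 \<mu> x * S 0 1 \<mu> x = 1"
  using wronskian_const[OF S_ode[of 1 0 \<mu>] S_ode[of 0 1 \<mu>], of x 0] assms by auto

lemma Q_bounded: obtains M where "M \<ge> 0" "\<And>x. x \<in> {0..1} \<Longrightarrow> \<bar>Q x\<bar> \<le> M"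
proof -
  have "bounded (Q ` {0..1})" using Q_cont by (intro compact_imp_bounded compact_continuous_image) auto
  then obtain M where M: "\<forall>x\<in>{0..1}. \<bar>Q x\<bar> \<le> M" by (auto simp: bounded_iff)
  moreover have "M \<ge> 0" using M[rule_format, of 0] by simp
  ultimately show thesis using that by blast
qed

text \<open>The difference of two solutions with equal data obeys the equation with inhomogeneity
  \<open>(\<mu> - \<nu>) * S A B \<nu>\<close>, so the energy estimate is linear in the change of
  the parameter. This allows the intermediate value theorem in \<open>\<mu>\<close>.\<close>

lemma S_cont_param: "isCont (\<lambda>\<mu>. S A B \<mu> 1) \<nu>"
proof -
  obtain M where M: "M \<ge> 0" "\<And>x. x \<in> {0..1} \<Longrightarrow> \<bar>Q x\<bar> \<le> M" by (rule Q_bounded) blast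
  have "bounded (S A B \<nu> ` {0..1})" by (intro compact_imp_bounded compact_continuous_image S_cont) auto
  then obtain C where C: "\<forall>x\<in>{0..1}. \<bar>S A B \<nu> x\<bar> \<le> C" by (auto simp: bounded_iff)
  have "C \<ge> 0" using C[rule_format, of 0] by simp
  define L where "L = M + \<bar>\<nu>\<bar> + 1"
  have "L \<ge> 0" using M by (simp add: L_def)
  show ?thesis
  proof (rule locally_lipschitz_isCont)
    fix \<mu> :: real assume \<mu>: "\<bar>\<mu> - \<nu>\<bar> \<le> 1"
    let ?R = "\<lambda>x. 1 * (- (Q x + \<mu>) * S A B \<mu> x) + (-1) * (- (Q x + \<nu>) * S A B \<nu> x)"
    define e where "e x = 1 * S A B \<mu> x + (-1) * S A B \<nu> x" for x
    define e1 where "e1 x = 1 * S1 A B \<mu> x + (-1) * S1 A B \<nu> x" for x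
    have o: "ode2 0 1 e e1 ?R"
      unfolding e_def e1_def by (rule ode2_lincomb[OF S_ode S_ode])
    have "\<bar>e 1\<bar> \<le> (\<bar>e 0\<bar> + \<bar>e1 0\<bar> + \<bar>\<mu> - \<nu>\<bar> * C) * exp ((L + 2) * (1 - 0))"
    proof (rule gronwall2_abs[OF o \<open>L \<ge> 0\<close>])
      show "0 \<le> \<bar>\<mu> - \<nu>\<bar> * C" using \<open>C \<ge> 0\<close> by simp
      fix x :: real assume x: "0 < x" "x < 1"
      have "?R x 
        = - ((Q x + \<mu>) * e x + (\<mu> - \<nu>) * S A B \<nu> x)"
        by (simp add: e_def algebra_simps)
      then have "\<bar>?R x\<bar>
        = \<bar>(Q x + \<mu>) * e x + (\<mu> - \<nu>) * S A B \<nu> x\<bar>"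
        by (simp only: abs_minus_cancel)
      also have "\<dots> \<le> \<bar>Q x + \<mu>\<bar> * \<bar>e x\<bar> + \<bar>\<mu> - \<nu>\<bar> * \<bar>S A B \<nu> x\<bar>"
        unfolding abs_mult[symmetric] by (rule abs_triangle_ineq)
      also have "\<dots> \<le> L * \<bar>e x\<bar> + \<bar>\<mu> - \<nu>\<bar> * C"
      proof (intro add_mono mult_right_mono mult_left_mono)
        have "\<bar>Q x + \<mu>\<bar> \<le> \<bar>Q x\<bar> + \<bar>\<nu>\<bar> + \<bar>\<mu> - \<nu>\<bar>" by linarith
        then show "\<bar>Q x + \<mu>\<bar> \<le> L" using \<mu> M(2)[of x] x by (simp add: L_def)
        show "\<bar>S A B \<nu> x\<bar> \<le> C" using C x by simp
      qed auto
      finally show "\<bar>?R x\<bar> \<le> L * \<bar>e x\<bar> + \<bar>\<mu> - \<nu>\<bar> * C" .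
    qed auto
    then show "\<bar>S A B \<mu> 1 - S A B \<nu> 1\<bar> \<le> C * exp (L + 2) * \<bar>\<mu> - \<nu>\<bar>"
      by (simp add: e_def e1_def mult_ac)
  qed
qed

section \<open>Negative eigenvalues of one parity\<close>

definition basis_data :: "real \<Rightarrow> real \<Rightarrow> bool" where
  "basis_data A B \<longleftrightarrow> (A = 1 \<and> B = 0) \<or> (A = 0 \<and> B = 1)"

lemma S_pos_near_0:
  assumes "basis_data A B"
  obtains d where "0 < d" "d \<le> 1" "\<And>x. 0 < x \<Longrightarrow> x < d \<Longrightarrow> S A B \<mu> x > 0"
proof (cases "A = 1")
  case True
  then obtain d where d: "d > 0" "\<And>x. x \<in> {0..1} \<Longrightarrow> dist x 0 < d \<Longrightarrow> dist (S A B \<mu> x) (S A B \<mu> 0) < 1"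
    using S_cont[of A B \<mu>] unfolding continuous_on_iff by (metis atLeastAtMost_iff order_refl zero_le_one zero_less_one)
  have "S A B \<mu> x > 0" if "0 < x" "x < min d 1" for x
    using d(2)[of x] that True by (auto simp: dist_real_def)
  then show thesis using d by (intro that[of "min d 1"]) auto
next
  case False
  then show thesis using deriv_pos_right[OF S_ode[of A B \<mu>]] assms that by (auto simp: basis_data_def)
qed

lemma S_first_zero:
  assumes "basis_data A B" "S A B \<mu> 1 \<le> 0"
  obtains b where "0 < b" "b \<le> 1" "S A B \<mu> b = 0" "\<And>x. 0 < x \<Longrightarrow> x < b \<Longrightarrow> S A B \<mu> x > 0"
proof -
  obtain d where d: "0 < d" "d \<le> 1" "\<And>x. 0 < x \<Longrightarrow> x < d \<Longrightarrow> S A B \<mu> x > 0" by (rule S_pos_near_0[OF assms(1)]) blast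
  show thesis using first_zero[OF S_cont d(1,2) _ assms(2)] d(3) that by blast
qed

lemma S_no_common_zero:
  assumes "basis_data A B" "x \<in> {0..1}" "S A B \<mu> x = 0" shows "S1 A B \<mu> x \<noteq> 0"
  using S_wronskian[OF assms(2), of \<mu>] assms(1,3) by (auto simp: basis_data_def)

text \<open>Equal data at 0 make the Wronskian start from 0, so the solution with the larger
  parameter must vanish before the other one does.\<close>

lemma S_sturm:
  assumes "\<mu> < \<nu>" "0 < b" "b \<le> 1" "S A B \<mu> b = 0" "\<And>x. 0 < x \<Longrightarrow> x < b \<Longrightarrow> S A B \<mu> x > 0"
    "\<And>x. 0 < x \<Longrightarrow> x < b \<Longrightarrow> S A B \<nu> x > 0"
  shows False
  by (rule sturm_comparison[OF ode2_subset[OF S_ode[of A B \<mu>] order_refl assms(3)] ode2_subset[OF S_ode[of A B \<nu>] order_refl assms(3)]])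
    (use assms in auto)

text \<open>Lowering the parameter delays the first zero, which for parameter 0 is not before 1.
  Positivity is asked only in the open interval, so the degenerate case of a zero at 1 is
  covered.\<close>

lemma no_negative_eigenvalue:
  assumes "basis_data A B" "\<And>x. 0 < x \<Longrightarrow> x < 1 \<Longrightarrow> S A B 0 x > 0"
  shows "{\<mu>. \<mu> < 0 \<and> S A B \<mu> 1 = 0} = {}"
proof -
  have False if \<mu>: "\<mu> < 0" "S A B \<mu> 1 = 0" for \<mu>
  proof -
    obtain b where b: "0 < b" "b \<le> 1" "S A B \<mu> b = 0" "\<And>x. 0 < x \<Longrightarrow> x < b \<Longrightarrow> S A B \<mu> x > 0"
      using S_first_zero[OF assms(1), of \<mu>] \<mu>(2) by auto
    show False by (rule S_sturm[OF \<mu>(1) b(1-3)]) (use assms(2) b in auto)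
  qed
  then show ?thesis by auto
qed

text \<open>Existence: the value at 1 is negative for parameter 0 and positive for a very negative
  one. Uniqueness: of two negative eigenvalues the larger would have an eigenfunction with a zero
  inside, and comparison with parameter 0 would force a second sign change of the latter beyond
  \<open>c\<close>.\<close>

lemma unique_negative_eigenvalue:
  assumes "basis_data A B" "0 < c" "c < 1" "\<And>x. c < x \<Longrightarrow> x \<le> 1 \<Longrightarrow> S A B 0 x < 0"
    "\<And>x. 0 < x \<Longrightarrow> x < c \<Longrightarrow> S A B 0 x > 0"
  shows "\<exists>\<mu>. {\<mu>. \<mu> < 0 \<and> S A B \<mu> 1 = 0} = {\<mu>}"
proof -
  obtain M where M: "M \<ge> 0" "\<And>x. x \<in> {0..1} \<Longrightarrow> \<bar>Q x\<bar> \<le> M" by (rule Q_bounded) blast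
  have "S A B (- M - 1) 1 > 0"
  proof (rule ccontr)
    assume "\<not> S A B (- M - 1) 1 > 0"
    then obtain b where b: "0 < b" "b \<le> 1" "S A B (- M - 1) b = 0" "\<And>x. 0 < x \<Longrightarrow> x < b \<Longrightarrow> S A B (- M - 1) x > 0"
      using S_first_zero[OF assms(1), of "- M - 1"] by auto
    \<comment> \<open>For the parameter \<open>- M - 1\<close> the coefficient is negative, so the
      straight line with the same data, which solves the equation with coefficient 0, would have to
      vanish first; it does not.\<close>
    have "ode2 0 b (\<lambda>x. A + B * x) (\<lambda>x. B) (\<lambda>x. - 0 * (A + B * x))"
      unfolding ode2_def by (auto intro!: continuous_intros derivative_eq_intros)
    then show False
    proof (rule sturm_comparison[OF ode2_subset[OF S_ode[of A B "- M - 1"] order_refl b(2)] _ b(1)])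
      show "Q x + (- M - 1) < 0" if "0 < x" "x < b" for x using M(2)[of x] that b(2) by auto
      show "S A B (- M - 1) 0 * B - S1 A B (- M - 1) 0 * (A + B * 0) \<le> 0" by simp
    qed (use b assms(1) in \<open>auto simp: basis_data_def\<close>)
  qed
  then obtain \<mu> where \<mu>: "- M - 1 \<le> \<mu>" "\<mu> \<le> 0" "S A B \<mu> 1 = 0"
    using IVT2'[of "\<lambda>\<mu>. S A B \<mu> 1" 0 0 "- M - 1"] assms(4)[of 1] assms(3) M(1) S_cont_param[where A=A and B=B]
    by (auto simp: continuous_at_imp_continuous_on)
  have "\<mu> \<noteq> 0" using \<mu>(3) assms(3) assms(4)[of 1] by auto
  have uniq: False if m: "\<mu>1 < \<mu>2" "\<mu>2 < 0" "S A B \<mu>1 1 = 0" "S A B \<mu>2 1 = 0" for \<mu>1 \<mu>2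
  proof -
    let ?y = "S A B \<mu>2" and ?y1 = "S1 A B \<mu>2"
    obtain b1 where b1: "0 < b1" "b1 \<le> 1" "S A B \<mu>1 b1 = 0" "\<And>x. 0 < x \<Longrightarrow> x < b1 \<Longrightarrow> S A B \<mu>1 x > 0"
      using S_first_zero[OF assms(1), of \<mu>1] m by auto
    obtain b2 where b2: "0 < b2" "b2 \<le> 1" "?y b2 = 0" "\<And>x. 0 < x \<Longrightarrow> x < b2 \<Longrightarrow> ?y x > 0"
      using S_first_zero[OF assms(1), of \<mu>2] m by auto
    have "b2 < b1"
    proof (rule ccontr)
      assume "\<not> b2 < b1"
      then show False by (intro S_sturm[OF m(1) b1(1-3)]) (use b1(4) b2(4) in auto)
    qed
    then have "b2 < 1" using b1 by simp
    have cb: "c < b2"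
    proof (rule ccontr)
      assume "\<not> c < b2"
      then show False by (intro S_sturm[OF m(2) b2(1-3)]) (use b2(4) assms(5) in auto)
    qed
    have "?y1 b2 \<le> 0" 
      by (rule zero_deriv_nonpos[OF ode2_subset[OF S_ode order_refl b2(2)] b2(1,3)]) (use b2(4) in auto)
    then have y1: "?y1 b2 < 0" using S_no_common_zero[OF assms(1) _ b2(3)] b2 by (auto simp: order.order_iff_strict)
    have o: "ode2 b2 1 (\<lambda>x. (-1) * ?y x + 0 * ?y x) (\<lambda>x. (-1) * ?y1 x + 0 * ?y1 x)
       (\<lambda>x. (-1) * (- (Q x + \<mu>2) * ?y x) + 0 * (- (Q x + \<mu>2) * ?y x))"
      by (rule ode2_lincomb; rule ode2_subset[OF S_ode]) (use b2 in auto)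
    have o: "ode2 b2 1 (\<lambda>x. - ?y x) (\<lambda>x. - ?y1 x) (\<lambda>x. - (Q x + \<mu>2) * (- ?y x))"
      using o by simp
    \<comment> \<open>The solution for \<open>\<mu>2\<close> changes sign at \<open>b2 < 1\<close>,
      so its vanishing at 1 forces a further zero \<open>b3\<close>. Between \<open>b2\<close> and
      \<open>b3\<close> the solution for parameter 0 would then have to vanish, although it is
      negative beyond \<open>c < b2\<close>.\<close>
    obtain d where d: "b2 < d" "d \<le> 1" "\<And>x. b2 < x \<Longrightarrow> x < d \<Longrightarrow> - ?y x > 0"
      by (rule deriv_pos_right[OF o \<open>b2 < 1\<close>]) (use y1 b2 in auto)
    obtain b3 where b3: "b2 < b3" "b3 \<le> 1" "- ?y b3 = 0" "\<And>x. b2 < x \<Longrightarrow> x < b3 \<Longrightarrow> - ?y x > 0"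
      by (rule first_zero[OF ode2D(1)[OF o] d(1,2)]) (use m d(3) in auto)
    have o0: "ode2 b2 1 (\<lambda>x. (-1) * S A B 0 x + 0 * S A B 0 x) (\<lambda>x. (-1) * S1 A B 0 x + 0 * S1 A B 0 x)
       (\<lambda>x. (-1) * (- (Q x + 0) * S A B 0 x) + 0 * (- (Q x + 0) * S A B 0 x))"
      by (rule ode2_lincomb; rule ode2_subset[OF S_ode]) (use b2 in auto)
    then have o0: "ode2 b2 1 (\<lambda>x. - S A B 0 x) (\<lambda>x. - S1 A B 0 x) (\<lambda>x. - Q x * (- S A B 0 x))"
      by simp
    show False
    proof (rule sturm_comparison[OF ode2_subset[OF o order_refl b3(2)] ode2_subset[OF o0 order_refl b3(2)] b3(1)])
      show "Q x + \<mu>2 < Q x" for x using m by simp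
      show "- ?y x > 0" if "b2 < x" "x < b3" for x using b3(4)[OF that] .
      show "- S A B 0 x > 0" if "b2 < x" "x < b3" for x using assms(4)[of x] that cb b3 by auto
      show "- ?y b3 = 0" by (rule b3)
      show "- ?y b2 * - S1 A B 0 b2 - - ?y1 b2 * - S A B 0 b2 \<le> 0"
        using y1 assms(4)[of b2] cb \<open>b2 < 1\<close> b2(3) by (simp add: mult_nonpos_nonpos)
    qed
  qed
  have "\<mu> < 0" using \<mu>(2) \<open>\<mu> \<noteq> 0\<close> by simp
  have "\<nu> = \<mu>" if "\<nu> < 0" "S A B \<nu> 1 = 0" for \<nu>
    using uniq[OF _ \<open>\<mu> < 0\<close> that(2) \<mu>(3)] uniq[OF _ that(1) \<mu>(3) that(2)] by (metis linorder_neq_iff)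
  then have "{\<mu>. \<mu> < 0 \<and> S A B \<mu> 1 = 0} = {\<mu>}" using \<open>\<mu> < 0\<close> \<mu>(3) by blast
  then show ?thesis by blast
qed

section \<open>Eigenfunctions on the full interval\<close>

text \<open>A fundamental system of even and odd solutions normalised at 0, with derivatives.
  \<open>sgn 0 = 0\<close> yields the right value at the centre, since it multiplies only functions
  that vanish there.\<close>

definition Se :: "real \<Rightarrow> real \<Rightarrow> real" where "Se \<mu> x = S 1 0 \<mu> \<bar>x\<bar>"
definition Se1 :: "real \<Rightarrow> real \<Rightarrow> real" where "Se1 \<mu> x = sgn x * S1 1 0 \<mu> \<bar>x\<bar>"
definition So :: "real \<Rightarrow> real \<Rightarrow> real" where "So \<mu> x = sgn x * S 0 1 \<mu> \<bar>x\<bar>"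
definition So1 :: "real \<Rightarrow> real \<Rightarrow> real" where "So1 \<mu> x = S1 0 1 \<mu> \<bar>x\<bar>"

lemma Se_ode: "ode2 (-1) 1 (Se \<mu>) (Se1 \<mu>) (\<lambda>x. - (Q \<bar>x\<bar> + \<mu>) * Se \<mu> x)"
  unfolding Se_def Se1_def
  by (rule ode2_within[OF even_extension_deriv odd_extension_deriv[where h'="\<lambda>x. - (Q x + \<mu>) * S 1 0 \<mu> x"]])
    (use S_deriv in auto)

lemma So_ode: "ode2 (-1) 1 (So \<mu>) (So1 \<mu>) (\<lambda>x. - (Q \<bar>x\<bar> + \<mu>) * So \<mu> x)"
  unfolding So_def So1_def
  by (rule ode2_within[OF odd_extension_deriv even_extension_deriv[where h'="\<lambda>x. - (Q x + \<mu>) * S 0 1 \<mu> x", THEN DERIV_cong]])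
    (use S_deriv in auto)

lemma Se_0 [simp]: "Se \<mu> 0 = 1" "Se1 \<mu> 0 = 0" "So \<mu> 0 = 0" "So1 \<mu> 0 = 1"
  by (auto simp: Se_def Se1_def So_def So1_def)

lemma Se_wronskian:
  "x \<in> {-1..1} \<Longrightarrow> Se \<mu> x * So1 \<mu> x - Se1 \<mu> x * So \<mu> x = 1"
  using wronskian_const[OF Se_ode[of \<mu>] So_ode[of \<mu>], of x 0] by auto

text \<open>Every solution is \<open>A * Se + B * So\<close>. The conditions at the two ends differ
  only in the sign of the odd part, so their sum and difference decouple.\<close>

lemma eigenvalue_iff:
  "(\<exists>\<phi>. dirichlet_solution (\<lambda>x t. Q \<bar>x\<bar> * t + \<mu> * t) \<phi> \<and> (\<exists>x\<in>{-1..1}. \<phi> x \<noteq> 0))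
    \<longleftrightarrow> S 1 0 \<mu> 1 = 0 \<or> S 0 1 \<mu> 1 = 0"
proof
  have ex: "dirichlet_solution (\<lambda>x t. Q \<bar>x\<bar> * t + \<mu> * t) y"
    if o: "ode2 (-1) 1 y y1 (\<lambda>x. - (Q \<bar>x\<bar> + \<mu>) * y x)" and z: "y 1 = 0" "y (-1) = 0" for y y1
  proof -
    have "(y has_real_derivative y1 x) (at x) \<and> (y1 has_real_derivative - (Q \<bar>x\<bar> * y x + \<mu> * y x)) (at x)" 
      if "x \<in> {-1<..<1}" for x
      using ode2D(3,4)[OF o, of x] that by (auto simp: algebra_simps)
    then show ?thesis unfolding dirichlet_solution_def using ode2D(1)[OF o] z by blast
  qed
  assume "S 1 0 \<mu> 1 = 0 \<or> S 0 1 \<mu> 1 = 0"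
  then show "\<exists>\<phi>. dirichlet_solution (\<lambda>x t. Q \<bar>x\<bar> * t + \<mu> * t) \<phi> \<and> (\<exists>x\<in>{-1..1}. \<phi> x \<noteq> 0)"
  proof
    assume "S 1 0 \<mu> 1 = 0"
    then show ?thesis by (intro exI[of _ "Se \<mu>"] conjI ex[OF Se_ode] bexI[of _ 0]) (auto simp: Se_def)
  next
    assume a: "S 0 1 \<mu> 1 = 0"
    have "\<exists>x\<in>{-1..1}. So \<mu> x \<noteq> 0"
    proof -
      obtain d where d: "0 < d" "d \<le> 1" "\<And>x. 0 < x \<Longrightarrow> x < d \<Longrightarrow> S 0 1 \<mu> x > 0" 
        by (rule S_pos_near_0[of 0 1 \<mu>]) (auto simp: basis_data_def)
      have "So \<mu> (d/2) > 0" using d(1) d(3)[of "d/2"] by (simp add: So_def)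
      then show ?thesis using d by (intro bexI[of _ "d/2"]) auto
    qed
    then show ?thesis using a by (intro exI[of _ "So \<mu>"] conjI ex[OF So_ode]) (auto simp: So_def)
  qed
next
  assume "\<exists>\<phi>. dirichlet_solution (\<lambda>x t. Q \<bar>x\<bar> * t + \<mu> * t) \<phi> \<and> (\<exists>x\<in>{-1..1}. \<phi> x \<noteq> 0)"
  then obtain \<phi> \<phi>1 x0 where c: "continuous_on {-1..1} \<phi>" "\<phi> (-1) = 0" "\<phi> 1 = 0" and x0: "x0 \<in> {-1..1}" "\<phi> x0 \<noteq> 0"
    and d: "\<forall>x\<in>{-1<..<1}. (\<phi> has_real_derivative \<phi>1 x) (at x) \<and> (\<phi>1 has_real_derivative - (Q \<bar>x\<bar> * \<phi> x + \<mu> * \<phi> x)) (at x)"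
    unfolding dirichlet_solution_def by auto
  define A where "A = \<phi> 0" 
  define B where "B = \<phi>1 0"
  have rep: "\<phi> x = A * Se \<mu> x + B * So \<mu> x" if x: "x \<in> {-1<..<1}" for x
  proof -
    \<comment> \<open>\<open>\<phi>1\<close> is known only inside the open interval, so the
      comparison is made on compact subintervals. The constant Wronskians with \<open>Se\<close> and
      \<open>So\<close> then give the coefficients by Cramer's rule.\<close>
    define t where "t = \<bar>x\<bar>"
    have t: "0 \<le> t" "t < 1" "x \<in> {-t..t}" using x by (auto simp: t_def)
    have o: "ode2 (-t) t \<phi> \<phi>1 (\<lambda>x. - (Q \<bar>x\<bar> + \<mu>) * \<phi> x)"
      unfolding ode2_def
    proof (intro conjI ballI)
      show "continuous_on {-t..t} \<phi>" using c(1) by (rule continuous_on_subset) (use t in auto)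
      have "isCont \<phi>1 x" if "x \<in> {-t..t}" for x
      proof -
        have "x \<in> {-1<..<1}" using that t by auto
        with d show ?thesis by (blast intro: DERIV_isCont)
      qed
      then show "continuous_on {-t..t} \<phi>1" by (simp add: continuous_at_imp_continuous_on)
    qed (use d t in \<open>auto simp: algebra_simps\<close>)
    have oe: "ode2 (-t) t (Se \<mu>) (Se1 \<mu>) (\<lambda>x. - (Q \<bar>x\<bar> + \<mu>) * Se \<mu> x)"
      and oo: "ode2 (-t) t (So \<mu>) (So1 \<mu>) (\<lambda>x. - (Q \<bar>x\<bar> + \<mu>) * So \<mu> x)"
      by (rule ode2_subset[OF Se_ode] ode2_subset[OF So_ode]; use t in simp)+
    have 1: "\<phi> x * So1 \<mu> x - \<phi>1 x * So \<mu> x = A" 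
      using wronskian_const[OF o oo, of x 0] t by (auto simp: A_def)
    have 2: "\<phi> x * Se1 \<mu> x - \<phi>1 x * Se \<mu> x = - B"
      using wronskian_const[OF o oe, of x 0] t by (auto simp: B_def)
    have "A * Se \<mu> x + B * So \<mu> x = \<phi> x * (Se \<mu> x * So1 \<mu> x - Se1 \<mu> x * So \<mu> x)"
    proof -
      have B: "B = \<phi>1 x * Se \<mu> x - \<phi> x * Se1 \<mu> x" using 2 by simp
      show ?thesis unfolding 1[symmetric] B by (simp add: algebra_simps)
    qed
    then show ?thesis using Se_wronskian[of x \<mu>] x by auto
  qed
  \<comment> \<open>Continuity of \<open>\<phi>\<close> carries the representation to the ends,
    where no derivative is available.\<close>
  have rep': "\<phi> x = A * Se \<mu> x + B * So \<mu> x" if x: "x \<in> {-1..1}" for x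
  proof -
    have cl: "closure {-1<..<1} = {-1..1::real}" by simp
    have "continuous_on {-1..1} (\<lambda>x. \<phi> x - (A * Se \<mu> x + B * So \<mu> x))"
      by (intro continuous_intros c ode2D(1)[OF Se_ode] ode2D(1)[OF So_ode])
    then have "\<phi> x - (A * Se \<mu> x + B * So \<mu> x) = 0"
      using continuous_constant_on_closure[of "{-1<..<1}" "\<lambda>x. \<phi> x - (A * Se \<mu> x + B * So \<mu> x)" 0 x] rep x
      unfolding cl by auto
    then show ?thesis by simp
  qed
  have 1: "A * S 1 0 \<mu> 1 + B * S 0 1 \<mu> 1 = 0" "A * S 1 0 \<mu> 1 - B * S 0 1 \<mu> 1 = 0"
    using rep'[of 1] rep'[of "-1"] c by (auto simp: Se_def So_def)
  show "S 1 0 \<mu> 1 = 0 \<or> S 0 1 \<mu> 1 = 0"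
  proof (rule ccontr)
    assume "\<not> ?thesis"
    then have "A = 0" "B = 0" using 1 by auto
    then show False using rep'[OF x0(1)] x0(2) by simp
  qed
qed

text \<open>The Wronskian at 1 is 1, so the two basis solutions cannot vanish there together; the
  even and the odd counts simply add up.\<close>

lemma negative_eigenvalues_disjoint:
  "{\<mu>. \<mu> < 0 \<and> S 1 0 \<mu> 1 = 0} \<inter> {\<mu>. \<mu> < 0 \<and> S 0 1 \<mu> 1 = 0} = {}"
proof -
  have "\<not> (S 1 0 \<mu> 1 = 0 \<and> S 0 1 \<mu> 1 = 0)" for \<mu> using S_wronskian[of 1 \<mu>] by auto
  then show ?thesis by blast
qed

end

section \<open>Eigenvalues along the family of even solutions\<close>

locale emden_odd = emden +
  fixes z z1 :: "real \<Rightarrow> real" and e c :: real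
  assumes z_ode: "ode2 0 r z z1 (\<lambda>x. - q x * z x)" and z_0: "z 0 = 0" and z1_0: "z1 0 = 1"
    and ec: "0 < e" "e < c" "c < r"
    and \<psi>_e: "\<psi> e = 0" and \<psi>_pos: "\<And>x. 0 \<le> x \<Longrightarrow> x < e \<Longrightarrow> \<psi> x > 0"
    and \<psi>_neg: "\<And>x. e < x \<Longrightarrow> x \<le> r \<Longrightarrow> \<psi> x < 0"
    and z_c: "z c = 0" and z_pos: "\<And>x. 0 < x \<Longrightarrow> x < c \<Longrightarrow> z x > 0"
    and z_neg: "\<And>x. c < x \<Longrightarrow> x \<le> r \<Longrightarrow> z x < 0"
begin

text \<open>The eigenvalue problem at the even solution with parameter \<open>\<eta>\<close>, whose
  coefficient is the potential \<open>q\<close> stretched by \<open>\<eta>\<close>.\<close>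

definition eig :: "real \<Rightarrow> real \<Rightarrow> bool" where
  "eig \<eta> \<mu> \<longleftrightarrow> (\<exists>\<phi>. dirichlet_solution (\<lambda>x t. \<eta>\<^sup>2 * q (\<eta> * \<bar>x\<bar>) * t + \<mu> * t) \<phi> \<and> (\<exists>x\<in>{-1..1}. \<phi> x \<noteq> 0))"

lemma scaled_sturm_liouville:
  assumes "0 < \<eta>" "\<eta> \<le> r" shows "sturm_liouville (\<lambda>x. \<eta>\<^sup>2 * q (\<eta> * x))"
proof
  have im: "(*) \<eta> ` {0..1} \<subseteq> {0..r}"
    using assms by (auto intro: order_trans[OF mult_left_le_one_le] simp: mult_le_one)
  show "continuous_on {0..1} (\<lambda>x. \<eta>\<^sup>2 * q (\<eta> * x))"
    by (intro continuous_intros continuous_on_compose2[OF q_cont _ im])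
qed

text \<open>For eigenvalue parameter 0 the stretched problem is solved by stretching
  \<open>\<psi>\<close> and \<open>z\<close>, so moving \<open>\<eta>\<close> only moves the end
  point at which fixed functions are evaluated.\<close>

lemma scaled_solutions:
  assumes "0 < \<eta>" "\<eta> \<le> r" "x \<in> {0..1}"
  shows "sturm_liouville.S (\<lambda>x. \<eta>\<^sup>2 * q (\<eta> * x)) 1 0 0 x = \<psi> (\<eta> * x) / k"
    "sturm_liouville.S (\<lambda>x. \<eta>\<^sup>2 * q (\<eta> * x)) 0 1 0 x = z (\<eta> * x) / \<eta>"
    "sturm_liouville.S1 (\<lambda>x. \<eta>\<^sup>2 * q (\<eta> * x)) 1 0 0 x = \<eta> * \<psi>1 (\<eta> * x) / k"
    "sturm_liouville.S1 (\<lambda>x. \<eta>\<^sup>2 * q (\<eta> * x)) 0 1 0 x = z1 (\<eta> * x)"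
proof -
  interpret sturm_liouville "\<lambda>x. \<eta>\<^sup>2 * q (\<eta> * x)" by (rule scaled_sturm_liouville[OF assms(1,2)])
  have sc: "ode2 0 1 (\<lambda>x. d * y (\<eta> * x) + 0 * y (\<eta> * x)) (\<lambda>x. d * (\<eta> * y1 (\<eta> * x)) + 0 * (\<eta> * y1 (\<eta> * x)))
    (\<lambda>x. - (\<eta>\<^sup>2 * q (\<eta> * x) + 0) * (d * y (\<eta> * x) + 0 * y (\<eta> * x)))" 
    if y: "ode2 0 r y y1 (\<lambda>x. - q x * y x)" for d y y1
  proof -
    have "ode2 0 \<eta> y y1 (\<lambda>x. - q x * y x)" by (rule ode2_subset[OF y]) (use assms in auto)
    then have *: "ode2 0 1 (\<lambda>x. y (\<eta> * x)) (\<lambda>x. \<eta> * y1 (\<eta> * x)) (\<lambda>x. \<eta>\<^sup>2 * (- q (\<eta> * x) * y (\<eta> * x)))"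
      by (rule ode2_scale) (use assms in auto)
    show ?thesis by (rule ode2_cong[OF ode2_lincomb[OF * *]]) simp
  qed
  show "S 1 0 0 x = \<psi> (\<eta> * x) / k" "S1 1 0 0 x = \<eta> * \<psi>1 (\<eta> * x) / k"
    using linear_ode_unique[OF sc[OF \<psi>_ode, of "1/k"] S_ode[of 1 0 0]] k_pos \<psi>_0 \<psi>1_0 Q_cont assms(3) by auto
  show "S 0 1 0 x = z (\<eta> * x) / \<eta>" "S1 0 1 0 x = z1 (\<eta> * x)"
    using linear_ode_unique[OF sc[OF z_ode, of "1/\<eta>"] S_ode[of 0 1 0]] z_0 z1_0 Q_cont assms by auto
qed

lemma eig_iff:
  assumes "0 < \<eta>" "\<eta> \<le> r"
  shows "eig \<eta> \<mu> \<longleftrightarrow> sturm_liouville.S (\<lambda>x. \<eta>\<^sup>2 * q (\<eta> * x)) 1 0 \<mu> 1 = 0 \<or>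
    sturm_liouville.S (\<lambda>x. \<eta>\<^sup>2 * q (\<eta> * x)) 0 1 \<mu> 1 = 0"
proof -
  interpret sturm_liouville "\<lambda>x. \<eta>\<^sup>2 * q (\<eta> * x)" by (rule scaled_sturm_liouville[OF assms])
  show ?thesis unfolding eig_def by (rule eigenvalue_iff)
qed

lemma eig_0_iff:
  assumes "0 < \<eta>" "\<eta> < r" shows "eig \<eta> 0 \<longleftrightarrow> \<eta> = e \<or> \<eta> = c"
proof -
  have "eig \<eta> 0 \<longleftrightarrow> \<psi> \<eta> = 0 \<or> z \<eta> = 0"
    using eig_iff[of \<eta> 0] scaled_solutions[of \<eta> 1] assms k_pos by auto
  moreover have "\<psi> \<eta> = 0 \<longleftrightarrow> \<eta> = e"
    using \<psi>_pos[of \<eta>] \<psi>_neg[of \<eta>] \<psi>_e assms by (cases \<eta> e rule: linorder_cases) auto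
  moreover have "z \<eta> = 0 \<longleftrightarrow> \<eta> = c"
    using z_pos[of \<eta>] z_neg[of \<eta>] z_c assms by (cases \<eta> c rule: linorder_cases) auto
  ultimately show ?thesis by simp
qed

text \<open>The even part contributes one eigenvalue exactly when \<open>e\<close> is interior, the
  odd part exactly when \<open>c\<close> is. At \<open>\<eta> = e\<close> and
  \<open>\<eta> = c\<close> the zero sits at the end point and is not yet counted, hence the
  inequalities in the case distinction.\<close>

lemma negative_eigenvalues:
  assumes \<eta>: "0 < \<eta>" "\<eta> < r"
  shows "finite {\<mu>. \<mu> < 0 \<and> eig \<eta> \<mu>}"
    and "card {\<mu>. \<mu> < 0 \<and> eig \<eta> \<mu>} = (if \<eta> \<le> e then 0 else if \<eta> \<le> c then 1 else 2)"
proof -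
  interpret sturm_liouville "\<lambda>x. \<eta>\<^sup>2 * q (\<eta> * x)" by (rule scaled_sturm_liouville) (use \<eta> in auto)
  define E where "E = {\<mu>. \<mu> < 0 \<and> S 1 0 \<mu> 1 = 0}"
  define F where "F = {\<mu>. \<mu> < 0 \<and> S 0 1 \<mu> 1 = 0}"
  have EF: "{\<mu>. \<mu> < 0 \<and> eig \<eta> \<mu>} = E \<union> F" using eig_iff[OF \<eta>(1)] \<eta>(2) by (auto simp: E_def F_def)
  have dis: "E \<inter> F = {}" unfolding E_def F_def by (rule negative_eigenvalues_disjoint)
  have lt: "\<eta> * x < \<eta>" if "x < 1" for x using mult_strict_left_mono[OF that \<eta>(1)] by simp
  have le: "\<eta> * x \<le> \<eta>" if "x \<le> 1" for x using mult_left_mono[OF that, of \<eta>] \<eta>(1) by simp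
  have bd: "basis_data 1 0" "basis_data 0 1" by (auto simp: basis_data_def)
  have E0: "E = {}" if "\<eta> \<le> e"
    unfolding E_def
  proof (rule no_negative_eigenvalue[OF bd(1)])
    show "S 1 0 0 x > 0" if "0 < x" "x < 1" for x
    proof -
      have "\<eta> * x < e" using lt[OF that(2)] \<open>\<eta> \<le> e\<close> by linarith
      then show ?thesis using scaled_solutions(1)[of \<eta> x] \<psi>_pos[of "\<eta> * x"] that \<eta> k_pos by auto
    qed
  qed
  have E1: "\<exists>\<mu>. E = {\<mu>}" if "e < \<eta>"
    unfolding E_def
  proof (rule unique_negative_eigenvalue[OF bd(1), of "e / \<eta>"])
    show "0 < e / \<eta>" "e / \<eta> < 1" using that \<eta> ec by auto
    show "S 1 0 0 x < 0" if "e / \<eta> < x" "x \<le> 1" for x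
    proof -
      have "0 < x" using that(1) ec \<eta> \<open>0 < e / \<eta>\<close> by linarith
      moreover have "e < \<eta> * x" using that(1) \<eta> by (simp add: pos_divide_less_eq mult.commute)
      moreover have "\<eta> * x \<le> r" using le[OF that(2)] \<eta> by linarith
      ultimately show ?thesis
        using scaled_solutions(1)[of \<eta> x] \<psi>_neg[of "\<eta> * x"] that \<eta> k_pos by (auto simp: divide_less_0_iff)
    qed
    show "S 1 0 0 x > 0" if "0 < x" "x < e / \<eta>" for x
    proof -
      have "\<eta> * x < e" using that(2) \<eta> by (simp add: pos_less_divide_eq mult.commute)
      moreover have "x < 1" using that(2) \<open>e / \<eta> < 1\<close> by simp
      ultimately show ?thesis
        using scaled_solutions(1)[of \<eta> x] \<psi>_pos[of "\<eta> * x"] that \<eta> k_pos by auto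
    qed
  qed
  have F0: "F = {}" if "\<eta> \<le> c"
    unfolding F_def
  proof (rule no_negative_eigenvalue[OF bd(2)])
    show "S 0 1 0 x > 0" if "0 < x" "x < 1" for x
    proof -
      have "\<eta> * x < c" using lt[OF that(2)] \<open>\<eta> \<le> c\<close> by linarith
      then show ?thesis using scaled_solutions(2)[of \<eta> x] z_pos[of "\<eta> * x"] that \<eta> by auto
    qed
  qed
  have F1: "\<exists>\<mu>. F = {\<mu>}" if "c < \<eta>"
    unfolding F_def
  proof (rule unique_negative_eigenvalue[OF bd(2), of "c / \<eta>"])
    show "0 < c / \<eta>" "c / \<eta> < 1" using that \<eta> ec by auto
    show "S 0 1 0 x < 0" if "c / \<eta> < x" "x \<le> 1" for x
    proof -
      have "0 < x" using that(1) ec \<eta> \<open>0 < c / \<eta>\<close> by linarith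
      moreover have "c < \<eta> * x" using that(1) \<eta> by (simp add: pos_divide_less_eq mult.commute)
      moreover have "\<eta> * x \<le> r" using le[OF that(2)] \<eta> by linarith
      ultimately show ?thesis
        using scaled_solutions(2)[of \<eta> x] z_neg[of "\<eta> * x"] that \<eta> by (auto simp: divide_less_0_iff)
    qed
    show "S 0 1 0 x > 0" if "0 < x" "x < c / \<eta>" for x
    proof -
      have "\<eta> * x < c" using that(2) \<eta> by (simp add: pos_less_divide_eq mult.commute)
      moreover have "x < 1" using that(2) \<open>c / \<eta> < 1\<close> by simp
      ultimately show ?thesis
        using scaled_solutions(2)[of \<eta> x] z_pos[of "\<eta> * x"] that \<eta> by auto
    qed
  qed
  consider "\<eta> \<le> e" "\<eta> \<le> c" | "e < \<eta>" "\<eta> \<le> c" | "e < \<eta>" "c < \<eta>" using ec by linarith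
  then have "finite (E \<union> F) \<and> card (E \<union> F) = (if \<eta> \<le> e then 0 else if \<eta> \<le> c then 1 else 2)"
  proof cases
    case 1 then show ?thesis using E0 F0 by simp
  next
    case 2
    then obtain \<mu> where "E = {\<mu>}" using E1 by blast
    then show ?thesis using 2 F0 by simp
  next
    case 3
    then obtain \<mu> \<nu> where "E = {\<mu>}" "F = {\<nu>}" using E1 F1 by blast
    then show ?thesis using 3 dis by auto
  qed
  then show "finite {\<mu>. \<mu> < 0 \<and> eig \<eta> \<mu>}"
    and "card {\<mu>. \<mu> < 0 \<and> eig \<eta> \<mu>} = (if \<eta> \<le> e then 0 else if \<eta> \<le> c then 1 else 2)"
    unfolding EF by auto
qed

end

lemma (in emden) emden_odd_exists:
  obtains z z1 e c where "emden_odd l p r W V z z1 e c"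
  by (rule odd_solution_zero, rule that, unfold_locales; (assumption | simp))

section \<open>Shooting from the left end point\<close>

lemma chord_below:
  assumes o: "ode2 a b y y1 y2" and mono: "\<And>s t. a \<le> s \<Longrightarrow> s \<le> t \<Longrightarrow> t \<le> b \<Longrightarrow> y1 t \<le> y1 s"
    and "a \<le> s" "s \<le> x" "x \<le> t" "t \<le> b"
  shows "y s * (t - x) + y t * (x - s) \<le> y x * (t - s)"
proof (cases "s = x \<or> x = t")
  case True
  then show ?thesis by (auto simp: algebra_simps)
next
  case False
  then have st: "s < x" "x < t" using assms by auto
  obtain \<xi> where \<xi>: "s < \<xi>" "\<xi> < x" "y x - y s = (x - s) * y1 \<xi>" by (rule ode2_MVT[OF o assms(3) st(1)]) (use st assms in auto)
  obtain \<zeta> where \<zeta>: "x < \<zeta>" "\<zeta> < t" "y t - y x = (t - x) * y1 \<zeta>" by (rule ode2_MVT[OF o _ st(2) assms(6)]) (use st assms in auto)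
  have "y1 \<zeta> \<le> y1 \<xi>" using mono \<xi> \<zeta> assms by auto
  then have "(x - s) * (t - x) * y1 \<zeta> \<le> (x - s) * (t - x) * y1 \<xi>" using st by (intro mult_left_mono) auto
  then have "(x - s) * (y t - y x) \<le> (t - x) * (y x - y s)" unfolding \<xi>(3) \<zeta>(3) by (simp add: mult_ac)
  then show ?thesis by (simp add: algebra_simps)
qed

text \<open>The cut at 0 lets a solution that has become negative continue as a straight line
  instead of meeting a power of a negative number.\<close>

definition truncated_powr :: "real \<Rightarrow> real \<Rightarrow> real \<Rightarrow> real"
  where "truncated_powr p K u = max 0 (min K u) powr p"

lemma truncated_powr_eq: "0 \<le> u \<Longrightarrow> u \<le> K \<Longrightarrow> truncated_powr p K u = u powr p"
  by (simp add: truncated_powr_def)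

lemma truncated_powr_nonneg: "truncated_powr p K u \<ge> 0"
  by (simp add: truncated_powr_def)

lemma truncated_powr_le: "K \<ge> 0 \<Longrightarrow> p \<ge> 0 \<Longrightarrow> truncated_powr p K u \<le> K powr p"
  unfolding truncated_powr_def by (intro powr_mono2) auto

lemma truncated_powr_lipschitz:
  assumes "K \<ge> 0" "p \<ge> 1"
  shows "\<bar>truncated_powr p K u - truncated_powr p K v\<bar> \<le> p * K powr (p - 1) * \<bar>u - v\<bar>"
proof -
  have "\<bar>truncated_powr p K u - truncated_powr p K v\<bar> \<le> p * K powr (p - 1) * \<bar>max 0 (min K u) - max 0 (min K v)\<bar>"
    unfolding truncated_powr_def by (intro powr_lipschitz) (use assms in auto)
  also have "\<dots> \<le> p * K powr (p - 1) * \<bar>u - v\<bar>"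
    using assms by (intro mult_left_mono) (auto simp: max_def min_def)
  finally show ?thesis .
qed

lemma truncated_powr_cont: "p > 0 \<Longrightarrow> continuous_on A (truncated_powr p K)"
  unfolding truncated_powr_def by (intro continuous_on_powr' continuous_intros) auto

text \<open>Truncation at \<open>K\<close> makes the equation globally Lipschitz; it is inactive on positive solutions
  with initial slope \<open>\<beta>\<close> as soon as \<open>1 + 2 \<beta> \<le> K\<close>.\<close>

locale shooting =
  fixes l p K :: real
  assumes l: "l > 0" and p: "p > 1" and K: "K \<ge> 1"
begin

abbreviation "g \<equiv> truncated_powr p K"

lemma absx_powr: "x \<in> {-1..1} \<Longrightarrow> 0 \<le> \<bar>x\<bar> powr l" "x \<in> {-1..1} \<Longrightarrow> \<bar>x\<bar> powr l \<le> 1"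
  using l powr_mono2[of l "\<bar>x\<bar>" 1] by auto

lemma absx_cont: "continuous_on A (\<lambda>x. \<bar>x\<bar> powr l)"
  using l by (intro continuous_on_powr' continuous_intros) auto

text \<open>The unknown is \<open>u + 1\<close>, so a shot starts at 1 and its target value at the
  right end is again 1.\<close>

definition is_shot :: "real \<Rightarrow> real \<Rightarrow> (real \<Rightarrow> real) \<times> (real \<Rightarrow> real) \<Rightarrow> bool" where
  "is_shot lam \<beta> y \<longleftrightarrow> fst y (-1) = 1 \<and> snd y (-1) = \<beta> \<and>
     ode2 (-1) 1 (fst y) (snd y) (\<lambda>x. - (lam * \<bar>x\<bar> powr l * g (fst y x)))"

definition shot where "shot lam \<beta> = (SOME y. is_shot lam \<beta> y)"
abbreviation "v lam \<beta> \<equiv> fst (shot lam \<beta>)"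
abbreviation "v1 lam \<beta> \<equiv> snd (shot lam \<beta>)"

lemma lip: 
  assumes "x \<in> {-1..1}"
  shows "\<bar>lam * \<bar>x\<bar> powr l * g u - lam * \<bar>x\<bar> powr l * g w\<bar> \<le> \<bar>lam\<bar> * (p * K powr (p - 1)) * \<bar>u - w\<bar>"
proof -
  have "lam * \<bar>x\<bar> powr l * g u - lam * \<bar>x\<bar> powr l * g w = lam * \<bar>x\<bar> powr l * (g u - g w)"
    by (simp add: algebra_simps)
  then have "\<bar>lam * \<bar>x\<bar> powr l * g u - lam * \<bar>x\<bar> powr l * g w\<bar> = \<bar>lam\<bar> * \<bar>x\<bar> powr l * \<bar>g u - g w\<bar>"
    by (simp add: abs_mult)
  also have "\<dots> \<le> \<bar>lam\<bar> * 1 * (p * K powr (p - 1) * \<bar>u - w\<bar>)"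
    using absx_powr[OF assms] truncated_powr_lipschitz[of K p u w] K p 
    by (intro mult_mono mult_left_mono) auto
  finally show ?thesis by simp
qed

lemma is_shot_shot: "is_shot lam \<beta> (shot lam \<beta>)"
proof -
  have c: "continuous_on ({-1..1} \<times> UNIV) (\<lambda>(x,u). - (lam * \<bar>x\<bar> powr l * g u))"
    unfolding case_prod_unfold using p
    by (intro continuous_intros continuous_on_compose2[OF absx_cont[of UNIV]] 
      continuous_on_compose2[OF truncated_powr_cont[of p UNIV K]]) auto
  have L: "0 \<le> \<bar>lam\<bar> * (p * K powr (p - 1))" using p by simp
  obtain y y1 where "y (-1) = 1" "y1 (-1) = \<beta>" 
    "\<And>x. x \<in> {-1..1} \<Longrightarrow> (y has_real_derivative y1 x) (at x within {-1..1})"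
    "\<And>x. x \<in> {-1..1} \<Longrightarrow> (y1 has_real_derivative - (lam * \<bar>x\<bar> powr l * g (y x))) (at x within {-1..1})"
  proof (rule picard2[where f="\<lambda>x u. - (lam * \<bar>x\<bar> powr l * g u)" and A=1 and B=\<beta>, OF _ L c])
    show "\<bar>- (lam * \<bar>x\<bar> powr l * g u) - - (lam * \<bar>x\<bar> powr l * g w)\<bar> \<le> \<bar>lam\<bar> * (p * K powr (p - 1)) * \<bar>u - w\<bar>" 
      if "x \<in> {-1..1}" for x u w
      using lip[OF that, of lam w u] by (simp add: abs_minus_commute)
  qed auto
  then have "is_shot lam \<beta> (y, y1)" by (auto simp: is_shot_def intro!: ode2_within)
  then show ?thesis unfolding shot_def by (rule someI)
qed

lemma v_init [simp]: "v lam \<beta> (-1) = 1" "v1 lam \<beta> (-1) = \<beta>"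
  using is_shot_shot[of lam \<beta>] by (auto simp: is_shot_def)

lemma v_ode: "ode2 (-1) 1 (v lam \<beta>) (v1 lam \<beta>) (\<lambda>x. - (lam * \<bar>x\<bar> powr l * g (v lam \<beta> x)))"
  using is_shot_shot[of lam \<beta>] by (auto simp: is_shot_def)

lemmas v_cont = ode2D(1)[OF v_ode]

lemma v_unique:
  assumes "ode2 (-1) 1 y y1 (\<lambda>x. - (lam * \<bar>x\<bar> powr l * g (y x)))" "y (-1) = 1" "y1 (-1) = \<beta>" "x \<in> {-1..1}"
  shows "v lam \<beta> x = y x" "v1 lam \<beta> x = y1 x"
proof -
  have L: "0 \<le> \<bar>lam\<bar> * (p * K powr (p - 1))" using p by simp
  have b: "\<bar>- (lam * \<bar>x\<bar> powr l * g (v lam \<beta> x)) - - (lam * \<bar>x\<bar> powr l * g (y x))\<bar> 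
      \<le> \<bar>lam\<bar> * (p * K powr (p - 1)) * \<bar>v lam \<beta> x - y x\<bar>" if "-1 < x" "x < 1" for x
    using lip[of x lam "y x" "v lam \<beta> x"] that by (simp add: abs_minus_commute)
  show "v lam \<beta> x = y x" "v1 lam \<beta> x = y1 x"
    by (rule ode2_unique[where f="\<lambda>x u. - (lam * \<bar>x\<bar> powr l * g u)", OF v_ode assms(1) _ _ L b]; use assms in simp)+
qed

text \<open>The explicit constant serves three purposes: continuity of the end value along curves of
  parameters, the linear bound inside the slope expansion, and closeness in the supremum norm at the
  bifurcation point. The final factor 2 is the length of the interval.\<close>

lemma v_dependence:
  assumes "0 \<le> lam" "lam \<le> M" "x \<in> {-1..1}"
  shows "\<bar>v lam \<beta> x - v lam' \<beta>' x\<bar> \<le> (\<bar>\<beta> - \<beta>'\<bar> + \<bar>lam - lam'\<bar> * K powr p) * exp ((M * (p * K powr (p - 1)) + 2) * 2)"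
proof -
  let ?R = "\<lambda>x. 1 * (- (lam * \<bar>x\<bar> powr l * g (v lam \<beta> x))) + (-1) * (- (lam' * \<bar>x\<bar> powr l * g (v lam' \<beta>' x)))"
  define e where "e x = 1 * v lam \<beta> x + (-1) * v lam' \<beta>' x" for x
  define e1 where "e1 x = 1 * v1 lam \<beta> x + (-1) * v1 lam' \<beta>' x" for x
  have o: "ode2 (-1) 1 e e1 ?R"
    unfolding e_def e1_def by (rule ode2_lincomb[OF v_ode v_ode])
  have "\<bar>e x\<bar> \<le> (\<bar>e (-1)\<bar> + \<bar>e1 (-1)\<bar> + \<bar>lam - lam'\<bar> * K powr p) * exp ((M * (p * K powr (p - 1)) + 2) * (1 - (-1)))"
  proof (rule gronwall2_abs[OF o _ _ _ assms(3)])
    show "0 \<le> M * (p * K powr (p - 1))" "0 \<le> \<bar>lam - lam'\<bar> * K powr p" using p assms by auto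
    fix x :: real assume x: "-1 < x" "x < 1"
    have "?R x
      = - ((lam * \<bar>x\<bar> powr l * g (v lam \<beta> x) - lam * \<bar>x\<bar> powr l * g (v lam' \<beta>' x)) + (lam - lam') * (\<bar>x\<bar> powr l * g (v lam' \<beta>' x)))"
      by (simp add: algebra_simps)
    then have "\<bar>?R x\<bar>
      = \<bar>(lam * \<bar>x\<bar> powr l * g (v lam \<beta> x) - lam * \<bar>x\<bar> powr l * g (v lam' \<beta>' x)) + (lam - lam') * (\<bar>x\<bar> powr l * g (v lam' \<beta>' x))\<bar>"
      by (simp only: abs_minus_cancel)
    also have "\<dots> \<le> \<bar>lam * \<bar>x\<bar> powr l * g (v lam \<beta> x) - lam * \<bar>x\<bar> powr l * g (v lam' \<beta>' x)\<bar> + \<bar>(lam - lam') * (\<bar>x\<bar> powr l * g (v lam' \<beta>' x))\<bar>"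
      by (rule abs_triangle_ineq)
    also have "\<dots> \<le> M * (p * K powr (p - 1)) * \<bar>e x\<bar> + \<bar>lam - lam'\<bar> * K powr p"
    proof (rule add_mono)
      have "\<bar>lam * \<bar>x\<bar> powr l * g (v lam \<beta> x) - lam * \<bar>x\<bar> powr l * g (v lam' \<beta>' x)\<bar> \<le> \<bar>lam\<bar> * (p * K powr (p - 1)) * \<bar>v lam \<beta> x - v lam' \<beta>' x\<bar>"
        using lip[of x] x by simp
      also have "\<dots> \<le> M * (p * K powr (p - 1)) * \<bar>e x\<bar>"
        unfolding e_def using assms p by (intro mult_mono mult_right_mono) auto
      finally show "\<bar>lam * \<bar>x\<bar> powr l * g (v lam \<beta> x) - lam * \<bar>x\<bar> powr l * g (v lam' \<beta>' x)\<bar> \<le> M * (p * K powr (p - 1)) * \<bar>e x\<bar>" .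
      have "\<bar>x\<bar> powr l * g (v lam' \<beta>' x) \<le> 1 * K powr p"
        using absx_powr[of x] x truncated_powr_le[of K p] K p truncated_powr_nonneg by (intro mult_mono) auto
      then show "\<bar>(lam - lam') * (\<bar>x\<bar> powr l * g (v lam' \<beta>' x))\<bar> \<le> \<bar>lam - lam'\<bar> * K powr p"
        using truncated_powr_nonneg[of p K "v lam' \<beta>' x"] unfolding abs_mult by (intro mult_left_mono) auto
    qed
    finally show "\<bar>?R x\<bar>
      \<le> M * (p * K powr (p - 1)) * \<bar>e x\<bar> + \<bar>lam - lam'\<bar> * K powr p" .
  qed
  then show ?thesis by (simp add: e_def e1_def)
qed

text \<open>Stated along a curve in order to cover both later applications of the intermediate value
  theorem: varying the slope at fixed lambda, and varying both along the even solutions.\<close>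

lemma v_continuous_compose:
  fixes L G :: "real \<Rightarrow> real"
  assumes L: "continuous_on A L" and G: "continuous_on A G" and b: "\<And>a. a \<in> A \<Longrightarrow> 0 \<le> L a \<and> L a \<le> M"
    and x: "x \<in> {-1..1}"
  shows "continuous_on A (\<lambda>a. v (L a) (G a) x)"
  unfolding continuous_on_def
proof
  fix a assume a: "a \<in> A"
  define C where "C = exp ((M * (p * K powr (p - 1)) + 2) * 2)"
  have "((\<lambda>y. (\<bar>G y - G a\<bar> + \<bar>L y - L a\<bar> * K powr p) * C) \<longlongrightarrow> (\<bar>G a - G a\<bar> + \<bar>L a - L a\<bar> * K powr p) * C) (at a within A)"
    using L G a unfolding continuous_on_def by (intro tendsto_intros) auto
  then have lim: "((\<lambda>y. (\<bar>G y - G a\<bar> + \<bar>L y - L a\<bar> * K powr p) * C) \<longlongrightarrow> 0) (at a within A)" by simp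
  have "\<forall>\<^sub>F y in at a within A. norm (v (L y) (G y) x - v (L a) (G a) x) \<le> (\<bar>G y - G a\<bar> + \<bar>L y - L a\<bar> * K powr p) * C"
    unfolding eventually_at C_def using v_dependence[OF _ _ x] b by (intro exI[of _ 1]) auto
  then have "((\<lambda>y. v (L y) (G y) x - v (L a) (G a) x) \<longlongrightarrow> 0) (at a within A)"
    using lim by (rule Lim_null_comparison)
  then show "((\<lambda>a. v (L a) (G a) x) \<longlongrightarrow> v (L a) (G a) x) (at a within A)" by (simp add: LIM_zero_iff)
qed

lemma v1_antimono:
  assumes "lam \<ge> 0" "-1 \<le> s" "s \<le> t" "t \<le> 1"
  shows "v1 lam \<beta> t \<le> v1 lam \<beta> s"
proof (rule DERIV_nonpos_imp_decreasing_open[OF assms(3)])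
  show "continuous_on {s..t} (v1 lam \<beta>)" using ode2D(2)[OF v_ode] by (rule continuous_on_subset) (use assms in auto)
  fix x assume x: "s < x" "x < t"
  have "0 \<le> lam * \<bar>x\<bar> powr l * g (v lam \<beta> x)" 
    using assms truncated_powr_nonneg[of p K] absx_powr(1)[of x] by (intro mult_nonneg_nonneg) auto
  then show "\<exists>d. (v1 lam \<beta> has_real_derivative d) (at x) \<and> d \<le> 0"
    using ode2D(4)[OF v_ode[of lam \<beta>], of x] x assms by (intro exI conjI) (assumption | auto)+
qed

lemma v_le:
  assumes "lam \<ge> 0" "\<beta> \<ge> 0" "x \<in> {-1..1}"
  shows "v lam \<beta> x \<le> 1 + \<beta> * (x + 1)" "v lam \<beta> x \<le> 1 + 2 * \<beta>"
proof -
  show *: "v lam \<beta> x \<le> 1 + \<beta> * (x + 1)"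
  proof (cases "x = -1")
    case False
    then obtain \<xi> where \<xi>: "-1 < \<xi>" "\<xi> < x" "v lam \<beta> x - v lam \<beta> (-1) = (x - (-1)) * v1 lam \<beta> \<xi>"
      using ode2_MVT[OF v_ode[of lam \<beta>], of "-1" x] assms by auto
    have "v1 lam \<beta> \<xi> \<le> \<beta>" using v1_antimono[OF assms(1), of "-1" \<xi> \<beta>] \<xi> assms by auto
    then have "(x + 1) * v1 lam \<beta> \<xi> \<le> (x + 1) * \<beta>" using assms by (intro mult_left_mono) auto
    then show ?thesis using \<xi>(3) by (simp add: mult.commute)
  qed simp
  have "\<beta> * (x + 1) \<le> \<beta> * 2" using assms by (intro mult_left_mono) auto
  then show "v lam \<beta> x \<le> 1 + 2 * \<beta>" using * by simp
qed

lemma v_chord: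
  assumes "lam \<ge> 0" "-1 \<le> s" "s \<le> x" "x \<le> t" "t \<le> 1"
  shows "v lam \<beta> s * (t - x) + v lam \<beta> t * (x - s) \<le> v lam \<beta> x * (t - s)"
  by (rule chord_below[OF v_ode v1_antimono]) (use assms in auto)

text \<open>The shot rises above 1 at once, and by concavity it stays above the chord from such a
  point to the right end.\<close>

lemma v_gt_1:
  assumes "lam \<ge> 0" "\<beta> > 0" "v lam \<beta> 1 \<ge> 1" "-1 < x" "x < 1"
  shows "v lam \<beta> x > 1"
proof -
  have o: "ode2 (-1) 1 (\<lambda>x. v lam \<beta> x - 1) (v1 lam \<beta>) (\<lambda>x. - (lam * \<bar>x\<bar> powr l * g (v lam \<beta> x)))"
    using v_ode[of lam \<beta>] unfolding ode2_def by (auto intro!: continuous_intros derivative_eq_intros)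
  obtain d where d: "-1 < d" "d \<le> 1" "\<And>x. -1 < x \<Longrightarrow> x < d \<Longrightarrow> v lam \<beta> x - 1 > 0"
    by (rule deriv_pos_right[OF o]) (use assms in auto)
  define s where "s = (-1 + min d x) / 2"
  have s: "-1 < s" "s < d" "s < x" using d assms by (auto simp: s_def min_def field_simps)
  have "1 * (1 - s) = 1 * (1 - x) + 1 * (x - s)" by simp
  also have "\<dots> < v lam \<beta> s * (1 - x) + v lam \<beta> 1 * (x - s)"
    by (intro add_less_le_mono mult_strict_right_mono mult_right_mono) (use d(3)[of s] s assms in auto)
  also have "\<dots> \<le> v lam \<beta> x * (1 - s)"
    using v_chord[OF assms(1), of s x 1 \<beta>] s assms by auto
  finally have "1 * (1 - s) < v lam \<beta> x * (1 - s)" .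
  then show ?thesis using s assms by (simp add: mult_less_cancel_right)
qed

lemma v_positive_solution:
  assumes "lam > 0" "\<beta> > 0" "v lam \<beta> 1 = 1" "1 + 2 * \<beta> \<le> K"
  shows "positive_solution l p lam (\<lambda>x. v lam \<beta> x - 1)"
proof -
  have "((\<lambda>x. v lam \<beta> x - 1) has_real_derivative v1 lam \<beta> x) (at x) \<and>
       (v1 lam \<beta> has_real_derivative - (lam * \<bar>x\<bar> powr l * (v lam \<beta> x - 1 + 1) powr p)) (at x)" if "x \<in> {-1<..<1}" for x
  proof -
    have "v lam \<beta> x > 1" using v_gt_1[of lam \<beta> x] assms that by auto
    moreover have "v lam \<beta> x \<le> K" using v_le(2)[of lam \<beta> x] assms that by auto
    ultimately have "g (v lam \<beta> x) = v lam \<beta> x powr p" by (intro truncated_powr_eq) auto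
    then show ?thesis using ode2D(3,4)[OF v_ode[of lam \<beta>], of x] that 
      by (auto intro!: derivative_eq_intros)
  qed
  moreover have "\<forall>x\<in>{-1<..<1}. v lam \<beta> x - 1 > 0" using v_gt_1[of lam \<beta>] assms by auto
  moreover have "continuous_on {-1..1} (\<lambda>x. v lam \<beta> x - 1)" by (intro continuous_intros v_cont)
  ultimately show ?thesis using assms unfolding positive_solution_def dirichlet_solution_def
    by (intro conjI exI[of _ "v1 lam \<beta>"] ballI) auto
qed

lemma v1_drop:
  assumes "lam \<ge> 0" "-1 \<le> s" "s < t" "t \<le> 1" "M \<ge> 0" "\<And>x. x \<in> {-1..1} \<Longrightarrow> v lam \<beta> x \<le> M"
  shows "v1 lam \<beta> s - v1 lam \<beta> t \<le> 2 * lam * M powr p"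
proof -
  obtain \<xi> where \<xi>: "s < \<xi>" "\<xi> < t" "v1 lam \<beta> t - v1 lam \<beta> s = (t - s) * (- (lam * \<bar>\<xi>\<bar> powr l * g (v lam \<beta> \<xi>)))"
    by (rule ode2_MVT'[OF v_ode[of lam \<beta>] assms(2-4)])
  have "g (v lam \<beta> \<xi>) \<le> M powr p"
    unfolding truncated_powr_def using assms(5) assms(6)[of \<xi>] \<xi> assms(2,4) K p by (intro powr_mono2) auto
  then have "(t - s) * (lam * \<bar>\<xi>\<bar> powr l * g (v lam \<beta> \<xi>)) \<le> 2 * (lam * 1 * M powr p)"
    using assms \<xi> absx_powr[of \<xi>] truncated_powr_nonneg[of p K]
    by (intro mult_mono mult_left_mono mult_nonneg_nonneg) auto
  then show ?thesis using \<xi>(3) by simp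
qed

text \<open>Equal end values produce a critical point, and the slope lost on the way to it is
  bounded by the equation. This is what converts a large slope into a large norm.\<close>

lemma slope_bound:
  assumes "lam \<ge> 0" "v lam \<beta> 1 = 1" "M \<ge> 0" "\<And>x. x \<in> {-1..1} \<Longrightarrow> v lam \<beta> x \<le> M"
  shows "\<beta> \<le> 2 * lam * M powr p"
proof -
  obtain \<xi> where \<xi>: "-1 < \<xi>" "\<xi> < 1" "v lam \<beta> 1 - v lam \<beta> (-1) = (1 - (-1)) * v1 lam \<beta> \<xi>"
    using ode2_MVT[OF v_ode[of lam \<beta>], of "-1" 1] by auto
  then have "v1 lam \<beta> \<xi> = 0" using assms by simp
  then show ?thesis using v1_drop[OF assms(1) _ \<xi>(1) _ assms(3,4)] \<xi> by simp
qed

text \<open>A concave function on the interval that is nonnegative at both ends is at least a quarter of its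
  maximum on the middle half, where the equation then forces a drop of the slope of order
  \<open>M\<^sup>p\<close>; as the slopes involved are only of order \<open>M\<close>, this bounds the maximum \<open>M\<close>.\<close>

lemma apriori_bound:
  assumes lam: "lam > 0" and \<beta>: "\<beta> > 0" and K\<beta>: "1 + 2 * \<beta> \<le> K" and v1: "v lam \<beta> 1 \<ge> 1"
  obtains M where "M \<ge> 1" "\<beta> \<le> M + 2 * lam * M powr p" "lam * (1/4) powr (l + p + 1) * M powr (p - 1) \<le> 3"
proof -
  let ?v = "v lam \<beta>" and ?v1 = "v1 lam \<beta>"
  obtain m where m: "m \<in> {-1..1}" "\<And>x. x \<in> {-1..1} \<Longrightarrow> ?v x \<le> ?v m"
    using continuous_attains_sup[of "{-1..1}" ?v] v_cont[of lam \<beta>] by auto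
  define M where "M = ?v m"
  have M: "M \<ge> 1" using m(2)[of "-1"] by (simp add: M_def)
  have vM: "?v x \<le> M" if "x \<in> {-1..1}" for x using m(2)[OF that] by (simp add: M_def)
  \<comment> \<open>A point of \<open>{0..1/2}\<close> has distance at least 1/2 from both ends,
    while the chord from an end to the maximum point spans at most 2; the quotient is the factor
    1/4.\<close>
  have low: "?v x \<ge> M / 4" if x: "x \<in> {0..1/2}" for x
  proof (cases "x \<le> m")
    case True
    have "?v (-1) * (m - x) + M * (x - (-1)) \<le> ?v x * (m - (-1))"
      unfolding M_def using v_chord[of lam "-1" x m \<beta>] lam x True m by auto
    moreover have "?v (-1) * (m - x) \<ge> 0" using True by simp
    moreover have "M * (x - (-1)) \<ge> M * (1/2)" using M x by (intro mult_left_mono) auto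
    ultimately have a: "M / 2 \<le> ?v x * (m + 1)" by (simp add: algebra_simps)
    then have "?v x > 0" using M m by (smt (verit) atLeastAtMost_iff divide_pos_pos mult_nonpos_nonneg)
    then have "?v x * (m + 1) \<le> ?v x * 2" using m by (intro mult_left_mono) auto
    then show ?thesis using a by simp
  next
    case False
    have "M * (1 - x) + ?v 1 * (x - m) \<le> ?v x * (1 - m)"
      unfolding M_def using v_chord[of lam m x 1 \<beta>] lam x False m by auto
    moreover have "?v 1 * (x - m) \<ge> 0" using False v1 by simp
    moreover have "M * (1 - x) \<ge> M * (1/2)" using M x by (intro mult_left_mono) auto
    ultimately have a: "M / 2 \<le> ?v x * (1 - m)" by (simp add: algebra_simps)
    then have "?v x > 0" using M m by (smt (verit) atLeastAtMost_iff divide_pos_pos mult_nonpos_nonneg)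
    then have "?v x * (1 - m) \<le> ?v x * 2" using m by (intro mult_left_mono) auto
    then show ?thesis using a by simp
  qed
  have pos: "?v x \<ge> 1" if "x \<in> {-1..1}" for x
    using v_gt_1[of lam \<beta> x] lam \<beta> v1 that by (cases "x = -1 \<or> x = 1") auto
  \<comment> \<open>Mean slopes over the intervals before 1/4 and after 1/2 bound the slopes at
    these two points, so the drop between them is at most \<open>3 * M\<close>. The interval from
    1/4 to 1/2 stays away from the centre, where the weight vanishes.\<close>
  obtain a where a: "-1 < a" "a < 1/4" "?v (1/4) - ?v (-1) = (1/4 - (-1)) * ?v1 a"
    using ode2_MVT[OF v_ode[of lam \<beta>], of "-1" "1/4"] by auto
  have "?v1 (1/4) \<le> ?v1 a" using v1_antimono[of lam a "1/4" \<beta>] lam a by auto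
  then have s1: "?v1 (1/4) \<le> M" using a(3) vM[of "1/4"] M by auto
  obtain b where b: "1/2 < b" "b < 1" "?v 1 - ?v (1/2) = (1 - 1/2) * ?v1 b"
    using ode2_MVT[OF v_ode[of lam \<beta>], of "1/2" 1] by auto
  have "?v1 b \<le> ?v1 (1/2)" using v1_antimono[of lam "1/2" b \<beta>] lam b by auto
  then have s2: "?v1 (1/2) \<ge> - 2 * M" using b(3) vM[of "1/2"] v1 by auto
  obtain c where c: "1/4 < c" "c < 1/2" "?v1 (1/2) - ?v1 (1/4) = (1/2 - 1/4) * (- (lam * \<bar>c\<bar> powr l * g (?v c)))"
    using ode2_MVT'[OF v_ode[of lam \<beta>], of "1/4" "1/2"] by auto
  have "g (?v c) = ?v c powr p"
    by (rule truncated_powr_eq) (use pos[of c] v_le(2)[of lam \<beta> c] c lam \<beta> K\<beta> in auto)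
  then have "(1/4) * (lam * (1/4) powr l * (M/4) powr p) \<le> (1/4) * (lam * \<bar>c\<bar> powr l * g (?v c))"
    using low[of c] c M lam l p by (auto intro!: mult_mono powr_mono2)
  also have "\<dots> \<le> 3 * M" using s1 s2 c(3) by simp
  finally have "(1/4) * (lam * (1/4) powr l * (M/4) powr p) \<le> 3 * M" .
  moreover have "(1/4) * (lam * (1/4) powr l * (M/4) powr p) = lam * (1/4) powr (l + p + 1) * M powr (p - 1) * M"
  proof -
    have "(M/4) powr p = (1/4) powr p * M powr p" using M by (simp add: powr_divide)
    moreover have "M powr p = M powr (p - 1) * M" using M by (simp add: powr_diff)
    moreover have "(1/4::real) powr (l + p + 1) = (1/4) powr l * (1/4) powr p * (1/4)" by (simp only: powr_add powr_one)
    ultimately show ?thesis by simp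
  qed
  ultimately have "lam * (1/4) powr (l + p + 1) * M powr (p - 1) * M \<le> 3 * M" by (simp only:)
  then have "lam * (1/4) powr (l + p + 1) * M powr (p - 1) \<le> 3"
    by (rule mult_right_le_imp_le) (use M in simp)
  moreover have "\<beta> \<le> M + 2 * lam * M powr p"
  proof -
    have "?v1 (-1) - ?v1 (1/4) \<le> 2 * lam * M powr p"
      by (rule v1_drop) (use lam M vM in auto)
    then show ?thesis using s1 by simp
  qed
  ultimately show thesis using M by (intro that[of M])
qed

end

lemma shooting_misses_for_large_slope:
  assumes "l > 0" "p > 1" "lam > 0"
  obtains B where "B > 0" "\<And>K \<beta>. K \<ge> 1 \<Longrightarrow> \<beta> > B \<Longrightarrow> 1 + 2 * \<beta> \<le> K \<Longrightarrow> fst (shooting.shot l p K lam \<beta>) 1 < 1"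
proof -
  define \<kappa> where "\<kappa> = lam * (1/4) powr (l + p + 1)"
  have \<kappa>: "\<kappa> > 0" using assms by (simp add: \<kappa>_def)
  define M0 where "M0 = (3 / \<kappa>) powr (1 / (p - 1))"
  have M0: "M0 > 0" using \<kappa> by (simp add: M0_def)
  define B where "B = M0 + 2 * lam * M0 powr p"
  have "B > 0" using M0 assms by (auto simp: B_def intro!: add_pos_nonneg)
  moreover have "fst (shooting.shot l p K lam \<beta>) 1 < 1" if K\<beta>: "K \<ge> 1" "\<beta> > B" "1 + 2 * \<beta> \<le> K" for K \<beta>
  proof (rule ccontr)
    interpret shooting l p K by unfold_locales (use assms that in auto)
    assume "\<not> fst (shot lam \<beta>) 1 < 1"
    then obtain M where M: "M \<ge> 1" "\<beta> \<le> M + 2 * lam * M powr p" "\<kappa> * M powr (p - 1) \<le> 3"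
      unfolding \<kappa>_def using apriori_bound[of lam \<beta>] assms(3) K\<beta> \<open>B > 0\<close> by auto
    have "M \<le> M0"
    proof -
      have "M powr (p - 1) \<le> 3 / \<kappa>" using M \<kappa> by (simp add: field_simps)
      then have "(M powr (p - 1)) powr (1 / (p - 1)) \<le> M0" unfolding M0_def using assms by (intro powr_mono2) auto
      then show ?thesis using M assms by (simp add: powr_powr)
    qed
    then have "M powr p \<le> M0 powr p" using M assms by (intro powr_mono2) auto
    then have "2 * lam * M powr p \<le> 2 * lam * M0 powr p" using assms by (intro mult_left_mono) auto
    then show False using \<open>M \<le> M0\<close> M(2) K\<beta>(2) by (simp add: B_def)
  qed
  ultimately show thesis by (rule that)
qed

section \<open>Even solutions\<close>

context emden
begin

text \<open>\<open>E \<eta>\<close> is the even solution shifted by 1, \<open>Lam \<eta>\<close> its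
  lambda, and \<open>slope \<eta>\<close> its derivative at the left end.\<close>

definition Lam :: "real \<Rightarrow> real" where "Lam \<eta> = W \<eta> powr (p - 1) * \<eta> powr (l + 2)"
definition slope :: "real \<Rightarrow> real" where "slope \<eta> = - \<eta> * V \<eta> / W \<eta>"
definition E :: "real \<Rightarrow> real \<Rightarrow> real" where "E \<eta> x = W (\<eta> * \<bar>x\<bar>) / W \<eta>"

text \<open>The logarithmic derivative is
  \<open>(p - 1) * V \<eta> / W \<eta> + (l + 2) / \<eta>\<close>, which equals
  \<open>(p - 1) * \<psi> \<eta> / (\<eta> * W \<eta>)\<close>; hence the zero of
  \<open>\<psi>\<close> is the turning point.\<close>

lemma Lam_deriv:
  assumes "0 < \<eta>" "\<eta> < r"
  shows "(Lam has_real_derivative (p - 1) * W \<eta> powr (p - 2) * \<eta> powr (l + 1) * \<psi> \<eta>) (at \<eta>)"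
proof -
  have W: "W \<eta> > 0" using W_pos assms by auto
  have "(Lam has_real_derivative (p - 1) * W \<eta> powr (p - 1 - 1) * V \<eta> * \<eta> powr (l + 2) + W \<eta> powr (p - 1) * ((l + 2) * \<eta> powr (l + 2 - 1))) (at \<eta>)"
    unfolding Lam_def using W_D[OF assms] W assms by (auto intro!: derivative_eq_intros)
  moreover have "(p - 1) * W \<eta> powr (p - 1 - 1) * V \<eta> * \<eta> powr (l + 2) + W \<eta> powr (p - 1) * ((l + 2) * \<eta> powr (l + 2 - 1))
    = (p - 1) * W \<eta> powr (p - 2) * \<eta> powr (l + 1) * \<psi> \<eta>"
  proof -
    have a: "W \<eta> powr (p - 1) = W \<eta> powr (p - 2) * W \<eta>" using powr_add[of "W \<eta>" "p - 2" 1] W by simp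
    have b: "\<eta> powr (l + 2) = \<eta> powr (l + 1) * \<eta>" using powr_add[of \<eta> "l + 1" 1] assms by (simp add: add.commute[of l 2])
    have c: "(p - 1) * k = l + 2" using p by (simp add: k_def)
    have "(p - 1) * W \<eta> powr (p - 2) * \<eta> powr (l + 1) * \<psi> \<eta> = 
       (p - 1) * W \<eta> powr (p - 2) * V \<eta> * (\<eta> powr (l + 1) * \<eta>) + W \<eta> powr (p - 2) * W \<eta> * (((p - 1) * k) * \<eta> powr (l + 1))"
      unfolding \<psi>_def by (simp add: algebra_simps)
    then show ?thesis unfolding c a[symmetric] b[symmetric] by (simp add: add.commute[of l 1])
  qed
  ultimately show ?thesis by simp
qed

lemma Lam_cont: "continuous_on {0..r} Lam"
  unfolding Lam_def using l p by (intro continuous_intros W_powr_cont id_powr_cont) auto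

lemma Lam_pos: "0 < \<eta> \<Longrightarrow> \<eta> < r \<Longrightarrow> Lam \<eta> > 0"
  using W_pos[of \<eta>] by (simp add: Lam_def)

lemma Lam_r: "Lam r = 0" using p by (simp add: Lam_def W_r)

text \<open>Both factors of the numerator grow and the denominator shrinks. Monotonicity lets the
  slope identify an even solution.\<close>

lemma slope_strict_mono:
  assumes "0 < \<eta>" "\<eta> < \<eta>'" "\<eta>' < r" shows "slope \<eta> < slope \<eta>'"
proof -
  have "\<eta> * (- V \<eta>) < \<eta>' * (- V \<eta>')"
    using assms V_decr[of \<eta> \<eta>'] V_neg[of \<eta>] by (intro mult_strict_mono) auto
  moreover have "W \<eta>' < W \<eta>" "W \<eta>' > 0" using assms W_decr[of \<eta> \<eta>'] W_pos[of \<eta>'] by auto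
  moreover have "0 < \<eta> * (- V \<eta>)" using assms V_neg[of \<eta>] by (simp add: mult_pos_neg)
  ultimately have "\<eta> * (- V \<eta>) / W \<eta> < \<eta>' * (- V \<eta>') / W \<eta>'" by (intro frac_less) auto
  then show ?thesis by (simp add: slope_def)
qed

lemma slope_pos: "0 < \<eta> \<Longrightarrow> \<eta> < r \<Longrightarrow> slope \<eta> > 0"
  using V_neg[of \<eta>] W_pos[of \<eta>] by (simp add: slope_def divide_neg_pos mult_pos_neg)

lemma slope_cont: "0 < a \<Longrightarrow> b < r \<Longrightarrow> continuous_on {a..b} slope"
proof -
  assume ab: "0 < a" "b < r"
  have "W \<eta> \<noteq> 0" if "\<eta> \<in> {a..b}" for \<eta> using W_pos[of \<eta>] ab that by auto
  then show ?thesis unfolding slope_def using ab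
    by (intro continuous_intros continuous_on_subset[OF W_cont] continuous_on_subset[OF V_cont]) auto
qed

lemma scaled_deriv:
  assumes \<eta>: "0 < \<eta>" "\<eta> \<le> r" and x: "x \<in> {0..1}"
    and h: "\<And>x. x \<in> {0..r} \<Longrightarrow> (h has_real_derivative h' x) (at x within {0..r})"
  shows "((\<lambda>x. h (\<eta> * x)) has_real_derivative h' (\<eta> * x) * \<eta>) (at x within {0..1})"
proof -
  have im: "(*) \<eta> ` {0..1} \<subseteq> {0..r}"
    using \<eta> by (auto intro: order_trans[OF mult_left_le_one_le] simp: mult_le_one)
  have "\<eta> * x \<in> {0..r}" using im x by blast
  then have "(h has_real_derivative h' (\<eta> * x)) (at (\<eta> * x) within (*) \<eta> ` {0..1})"
    by (rule has_field_derivative_subset[OF h im])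
  moreover have "((*) \<eta> has_real_derivative \<eta>) (at x within {0..1})" by (auto intro!: derivative_eq_intros)
  ultimately show ?thesis using DERIV_image_chain[of h "h' (\<eta> * x)" "(*) \<eta>" x "{0..1}" \<eta>] by (simp add: o_def)
qed

lemma scaled_equation:
  assumes "0 < \<eta>" "\<eta> < r" "0 \<le> y" "y \<le> 1"
  shows "\<eta> * ((\<eta> * y) powr l * W (\<eta> * y) powr p * \<eta>) / W \<eta> = Lam \<eta> * y powr l * (W (\<eta> * y) / W \<eta>) powr p"
proof -
  have W: "W \<eta> > 0" using W_pos assms by auto
  have "\<eta> * y \<le> \<eta>" using assms by (simp add: mult_left_le)
  then have "\<eta> * y \<le> r" using assms by linarith
  then have Wy: "W (\<eta> * y) \<ge> 0" using assms by (intro W_nonneg) auto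
  have 1: "(\<eta> * y) powr l = \<eta> powr l * y powr l" using assms by (simp add: powr_mult)
  have 2: "(W (\<eta> * y) / W \<eta>) powr p = W (\<eta> * y) powr p / W \<eta> powr p" using W Wy by (simp add: powr_divide)
  have 3: "\<eta> powr (l + 2) = \<eta> powr l * \<eta> * \<eta>" using powr_add[of \<eta> l 2] assms by (simp add: power2_eq_square)
  have 4: "W \<eta> powr (p - 1) / W \<eta> powr p = 1 / W \<eta>" using W by (simp add: powr_diff)
  have "Lam \<eta> * y powr l * (W (\<eta> * y) / W \<eta>) powr p 
    = (W \<eta> powr (p - 1) / W \<eta> powr p) * \<eta> powr (l + 2) * y powr l * W (\<eta> * y) powr p"
    unfolding Lam_def 2 by simp
  then show ?thesis unfolding 4 3 1 by simp
qed

lemma E_ode: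
  assumes \<eta>: "0 < \<eta>" "\<eta> < r"
  shows "ode2 (-1) 1 (E \<eta>) (\<lambda>x. sgn x * (\<eta> * V (\<eta> * \<bar>x\<bar>) / W \<eta>)) (\<lambda>x. - (Lam \<eta> * \<bar>x\<bar> powr l * E \<eta> x powr p))"
proof -
  have W: "W \<eta> > 0" using W_pos \<eta> by auto
  have d1: "((\<lambda>x. W (\<eta> * x) / W \<eta>) has_real_derivative \<eta> * V (\<eta> * x) / W \<eta>) (at x within {0..1})" if "x \<in> {0..1}" for x
    using DERIV_cdivide[OF scaled_deriv[OF \<eta>(1) less_imp_le[OF \<eta>(2)] that W_deriv], of "W \<eta>"] by (simp add: mult.commute)
  have d2: "((\<lambda>x. \<eta> * V (\<eta> * x) / W \<eta>) has_real_derivative - (Lam \<eta> * x powr l * (W (\<eta> * x) / W \<eta>) powr p)) (at x within {0..1})" if x: "x \<in> {0..1}" for x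
  proof -
    have "((\<lambda>x. \<eta> * V (\<eta> * x) / W \<eta>) has_real_derivative \<eta> * (- ((\<eta> * x) powr l * W (\<eta> * x) powr p) * \<eta>) / W \<eta>) (at x within {0..1})"
      by (intro DERIV_cdivide DERIV_cmult scaled_deriv[OF \<eta>(1) less_imp_le[OF \<eta>(2)] x V_deriv])
    moreover have "\<eta> * (- ((\<eta> * x) powr l * W (\<eta> * x) powr p) * \<eta>) / W \<eta> = - (Lam \<eta> * x powr l * (W (\<eta> * x) / W \<eta>) powr p)"
      using scaled_equation[OF \<eta>, of x] x by simp
    ultimately show ?thesis by (simp only:)
  qed
  show ?thesis
    unfolding E_def
  proof (rule ode2_within)
    fix x :: real assume x: "x \<in> {-1..1}"
    show "((\<lambda>x. W (\<eta> * \<bar>x\<bar>) / W \<eta>) has_real_derivative sgn x * (\<eta> * V (\<eta> * \<bar>x\<bar>) / W \<eta>)) (at x within {-1..1})"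
      by (rule even_extension_deriv[OF d1 _ zero_less_one x]) (auto simp: V_0)
    show "((\<lambda>x. sgn x * (\<eta> * V (\<eta> * \<bar>x\<bar>) / W \<eta>)) has_real_derivative - (Lam \<eta> * \<bar>x\<bar> powr l * (W (\<eta> * \<bar>x\<bar>) / W \<eta>) powr p)) (at x within {-1..1})"
      by (rule odd_extension_deriv[OF d2 _ zero_less_one x]) (auto simp: V_0)
  qed
qed

text \<open>The upper bound uses that \<open>V\<close> decreases: the fall of \<open>W\<close> from
  1 is at most \<open>\<eta>\<close> times the final steepness. It makes the truncation inactive
  once \<open>1 + slope \<eta> \<le> K\<close>.\<close>

lemma E_bounds:
  assumes \<eta>: "0 < \<eta>" "\<eta> < r" and x: "x \<in> {-1..1}"
  shows "1 \<le> E \<eta> x" "E \<eta> x \<le> 1 + slope \<eta>"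
proof -
  have W: "W \<eta> > 0" using W_pos \<eta> by auto
  have b: "0 \<le> \<eta> * \<bar>x\<bar>" "\<eta> * \<bar>x\<bar> \<le> \<eta>" using \<eta> x mult_left_le[of "\<bar>x\<bar>" \<eta>] by auto
  have "W (\<eta> * \<bar>x\<bar>) \<ge> W \<eta>" using W_decr[of "\<eta> * \<bar>x\<bar>" \<eta>] b \<eta> by (cases "\<eta> * \<bar>x\<bar> = \<eta>") auto
  then show "1 \<le> E \<eta> x" using W by (simp add: E_def)
  have "W (\<eta> * \<bar>x\<bar>) \<le> 1" using W_decr[of 0 "\<eta> * \<bar>x\<bar>"] b \<eta> W_0 by (cases "\<eta> * \<bar>x\<bar> = 0") auto
  moreover have "1 - W \<eta> \<le> - \<eta> * V \<eta>"
  proof -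
    obtain \<xi> where \<xi>: "0 < \<xi>" "\<xi> < \<eta>" "W \<eta> - W 0 = (\<eta> - 0) * V \<xi>"
      using ode2_MVT[OF W_ode, of 0 \<eta>] \<eta> by auto
    have "\<eta> * V \<eta> \<le> \<eta> * V \<xi>" using V_decr[of \<xi> \<eta>] \<xi> \<eta> by (intro mult_left_mono) auto
    then show ?thesis using \<xi>(3) W_0 by simp
  qed
  ultimately have "W (\<eta> * \<bar>x\<bar>) \<le> W \<eta> + (- \<eta> * V \<eta>)" by simp
  then have "W (\<eta> * \<bar>x\<bar>) / W \<eta> \<le> (W \<eta> + (- \<eta> * V \<eta>)) / W \<eta>" using W by (intro divide_right_mono) auto
  then show "E \<eta> x \<le> 1 + slope \<eta>" using W by (simp add: E_def slope_def add_divide_distrib diff_divide_distrib)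
qed

lemma linearized_coefficient:
  assumes \<eta>: "0 < \<eta>" "\<eta> < r" and x: "x \<in> {-1..1}"
  shows "\<eta>\<^sup>2 * q (\<eta> * \<bar>x\<bar>) = Lam \<eta> * \<bar>x\<bar> powr l * (p * E \<eta> x powr (p - 1))"
proof -
  have W: "W \<eta> > 0" using W_pos \<eta> by auto
  have "\<eta> * \<bar>x\<bar> \<le> \<eta>" using \<eta> x by (intro mult_left_le) auto
  then have "\<eta> * \<bar>x\<bar> \<le> r" using \<eta> by linarith
  then have Wx: "W (\<eta> * \<bar>x\<bar>) \<ge> 0" using \<eta> by (intro W_nonneg) auto
  have 1: "(\<eta> * \<bar>x\<bar>) powr l = \<eta> powr l * \<bar>x\<bar> powr l" using \<eta> by (simp add: powr_mult)
  have 2: "E \<eta> x powr (p - 1) = W (\<eta> * \<bar>x\<bar>) powr (p - 1) / W \<eta> powr (p - 1)"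
    unfolding E_def using W Wx by (simp add: powr_divide)
  have 3: "\<eta> powr (l + 2) = \<eta> powr l * \<eta>\<^sup>2" using \<eta> by (simp add: powr_add)
  show ?thesis unfolding q_def Lam_def 1 2 3 using W by simp
qed

lemma E_end: "0 < \<eta> \<Longrightarrow> \<eta> < r \<Longrightarrow> E \<eta> 1 = 1" "0 < \<eta> \<Longrightarrow> \<eta> < r \<Longrightarrow> E \<eta> (-1) = 1"
  using W_pos[of \<eta>] by (auto simp: E_def)

lemma shot_eq_E:
  assumes \<eta>: "0 < \<eta>" "\<eta> < r" and HK: "1 + slope \<eta> \<le> K" and x: "x \<in> {-1..1}"
  shows "fst (shooting.shot l p K (Lam \<eta>) (slope \<eta>)) x = E \<eta> x"
proof -
  interpret shooting l p K using l p slope_pos[OF \<eta>] HK by unfold_locales auto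
  have "truncated_powr p K (E \<eta> x) = E \<eta> x powr p" if "-1 < x" "x < 1" for x
    by (rule truncated_powr_eq) (use E_bounds[OF \<eta>, of x] that HK in auto)
  then have "ode2 (-1) 1 (E \<eta>) (\<lambda>x. sgn x * (\<eta> * V (\<eta> * \<bar>x\<bar>) / W \<eta>)) (\<lambda>x. - (Lam \<eta> * \<bar>x\<bar> powr l * g (E \<eta> x)))"
    by (intro ode2_cong[OF E_ode[OF \<eta>]]) auto
  then show ?thesis
    by (rule v_unique(1)) (use E_end[OF \<eta>] x in \<open>auto simp: slope_def\<close>)
qed

text \<open>Evenness gives derivative 0 at the centre; dividing by the central value and stretching
  then produces a solution of the initial value problem for \<open>W\<close>, which is
  unique.\<close>

lemma even_shot:
  assumes HK: "K \<ge> 1" "1 + 2 * \<beta> \<le> K" and lam: "lam > 0" and \<beta>: "\<beta> > 0"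
    and end1: "fst (shooting.shot l p K lam \<beta>) 1 = 1"
    and ev: "even_fun (\<lambda>x. fst (shooting.shot l p K lam \<beta>) x - 1)"
  obtains \<eta> where "0 < \<eta>" "\<eta> < r" "lam = Lam \<eta>" "\<beta> = slope \<eta>"
proof -
  interpret shooting l p K using l p HK by unfold_locales auto
  let ?v = "v lam \<beta>" and ?v1 = "v1 lam \<beta>"
  have ev': "?v (- x) = ?v x" if "x \<in> {-1..1}" for x using ev that by (auto simp: even_fun_def)
  have odd1: "?v1 (- x) = - ?v1 x" if x: "-1 < x" "x < 1" for x
  proof -
    have "(?v has_real_derivative ?v1 (- x)) (at (- x))" using ode2D(3)[OF v_ode, of "- x"] x by auto
    moreover have "(uminus has_real_derivative -1) (at x)" by (auto intro!: derivative_eq_intros)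
    ultimately have "((\<lambda>x. ?v (- x)) has_real_derivative ?v1 (- x) * (-1)) (at x)" by (rule DERIV_chain2)
    then have "(?v has_real_derivative ?v1 (- x) * (-1)) (at x)"
      by (rule has_field_derivative_transform_within_open[of _ _ _ "{-1<..<1}"]) (use x ev' in auto)
    then show ?thesis using DERIV_unique[OF _ ode2D(3)[OF v_ode x]] by fastforce
  qed
  \<comment> \<open>Differentiation gives oddness only inside; continuity extends it to the ends,
    where it relates the final slope to \<open>\<beta>\<close>.\<close>
  have odd1': "?v1 (- x) = - ?v1 x" if x: "x \<in> {-1..1}" for x
  proof -
    have cl: "closure {-1<..<1} = {-1..1::real}" by simp
    have "continuous_on {-1..1} (\<lambda>x. ?v1 (- x) + ?v1 x)"
      by (intro continuous_intros continuous_on_compose2[OF ode2D(2)[OF v_ode[of lam \<beta>]]] ode2D(2)[OF v_ode]) auto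
    then have "?v1 (- x) + ?v1 x = 0"
      using continuous_constant_on_closure[of "{-1<..<1}" "\<lambda>x. ?v1 (- x) + ?v1 x" 0 x] odd1 x unfolding cl by auto
    then show ?thesis by simp
  qed
  have v10: "?v1 0 = 0" using odd1[of 0] by simp
  define d where "d = ?v 0"
  have d: "d > 1" unfolding d_def using v_gt_1[of lam \<beta> 0] lam \<beta> end1 by auto
  \<comment> \<open>For \<open>w y = ?v (y / \<eta>) / d\<close> the coefficient of
    \<open>y powr l * w y powr p\<close> is
    \<open>lam * d powr (p - 1) / \<eta> powr (l + 2)\<close>; this choice makes it 1.\<close>
  define \<eta> where "\<eta> = (lam * d powr (p - 1)) powr (1 / (l + 2))"
  have \<eta>: "\<eta> > 0" using lam d by (simp add: \<eta>_def)
  have \<eta>l: "\<eta> powr (l + 2) = lam * d powr (p - 1)" unfolding \<eta>_def using lam d l by (simp add: powr_powr)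
  have v_mono: "?v x \<le> d" "1 \<le> ?v x" if x: "x \<in> {0..1}" for x
  proof -
    have "?v x \<le> ?v 0"
    proof (rule DERIV_nonpos_imp_decreasing_open[where f="?v" and a=0 and b=x])
      show "0 \<le> x" using x by simp
      show "continuous_on {0..x} ?v" using v_cont by (rule continuous_on_subset) (use x in auto)
      fix t assume t: "0 < t" "t < x"
      then show "\<exists>y. (?v has_real_derivative y) (at t) \<and> y \<le> 0"
        using ode2D(3)[OF v_ode, of t] v1_antimono[of lam 0 t \<beta>] lam v10 x by auto
    qed
    then show "?v x \<le> d" by (simp add: d_def)
    show "1 \<le> ?v x" using v_gt_1[of lam \<beta> x] lam \<beta> end1 x by (cases "x = 1") auto
  qed
  define w where "w y = ?v (y / \<eta>) / d" for y
  define w1 where "w1 y = ?v1 (y / \<eta>) / (d * \<eta>)" for y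
  have w_ode: "ode2 0 \<eta> w w1 (\<lambda>y. - (y powr l * truncated_powr p 1 (w y)))"
  proof -
    let ?R = "\<lambda>x. (1/\<eta>)\<^sup>2 * (- (lam * \<bar>(1/\<eta>) * x\<bar> powr l * g (?v ((1/\<eta>) * x))))"
    have a: "ode2 0 1 ?v ?v1 (\<lambda>x. - (lam * \<bar>x\<bar> powr l * g (?v x)))" by (rule ode2_subset[OF v_ode]) auto
    have *: "ode2 0 \<eta> (\<lambda>x. ?v ((1/\<eta>) * x)) (\<lambda>x. (1/\<eta>) * ?v1 ((1/\<eta>) * x)) ?R"
      by (rule ode2_scale[OF a]) (use \<eta> in auto)
    have "ode2 0 \<eta> w w1 (\<lambda>x. (1/d) * ?R x + 0 * ?R x)"
      using ode2_lincomb[OF * *, of "1/d" 0] by (simp add: w_def[abs_def] w1_def[abs_def] mult.commute)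
    then show ?thesis
    proof (rule ode2_cong)
      fix x assume x: "0 < x" "x < \<eta>"
      define y where "y = x / \<eta>"
      have y: "0 < y" "y < 1" "x = \<eta> * y" using x \<eta> by (auto simp: y_def)
      have b: "1 \<le> ?v y" "?v y \<le> d" using v_mono[of y] y by auto
      have g1: "g (?v y) = ?v y powr p" by (rule truncated_powr_eq) (use b v_le(2)[of lam \<beta> y] lam \<beta> HK y in auto)
      have g2: "truncated_powr p 1 (w x) = ?v y powr p / d powr p"
      proof -
        have "w x = ?v y / d" by (simp add: w_def y_def)
        moreover have "truncated_powr p 1 (?v y / d) = (?v y / d) powr p" by (rule truncated_powr_eq) (use b d in auto)
        ultimately show ?thesis using b d by (simp add: powr_divide)
      qed
      have xl: "x powr l = \<eta> powr l * y powr l" unfolding y(3) using \<eta> y by (simp add: powr_mult)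
      have "\<eta> powr l * \<eta>\<^sup>2 = lam * d powr p / d" 
        using \<eta>l \<eta> d by (simp add: powr_add powr_diff)
      then have e1: "\<eta> powr l / d powr p = lam / (d * \<eta>\<^sup>2)" using \<eta> d by (simp add: field_simps)
      have "x powr l * truncated_powr p 1 (w x) = (\<eta> powr l / d powr p) * y powr l * ?v y powr p"
        unfolding g2 xl by simp
      then have "x powr l * truncated_powr p 1 (w x) = lam / (d * \<eta>\<^sup>2) * y powr l * ?v y powr p"
        unfolding e1 .
      moreover have "(1/\<eta>) * x = y" by (simp add: y_def)
      ultimately show "(1/d) * ?R x + 0 * ?R x
        = - (x powr l * truncated_powr p 1 (w x))"
        using g1 y by (simp add: power2_eq_square divide_simps)
    qed
  qed
  \<comment> \<open>Before \<open>\<eta> < r\<close> is known, the two functions can be compared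
    only on the shorter of their intervals.\<close>
  define m where "m = min \<eta> r"
  have m: "0 < m" "m \<le> \<eta>" "m \<le> r" using \<eta> r by (auto simp: m_def)
  have W_ode': "ode2 0 m W V (\<lambda>y. - (y powr l * truncated_powr p 1 (W y)))"
  proof (rule ode2_cong[OF ode2_subset[OF W_ode order_refl m(3)]])
    fix x assume x: "0 < x" "x < m"
    have "truncated_powr p 1 (W x) = W x powr p"
      by (rule truncated_powr_eq) (use W_pos[of x] W_decr[of 0 x] W_0 x m in auto)
    then show "- (x powr l * W x powr p) = - (x powr l * truncated_powr p 1 (W x))" by simp
  qed
  have eq: "w m = W m" "w1 m = V m"
  proof -
    have lip: "\<bar>- (x powr l * truncated_powr p 1 (w x)) - - (x powr l * truncated_powr p 1 (W x))\<bar> \<le> (m powr l * p) * \<bar>w x - W x\<bar>"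
      if "0 < x" "x < m" for x
    proof -
      have "\<bar>- (x powr l * truncated_powr p 1 (w x)) - - (x powr l * truncated_powr p 1 (W x))\<bar> = x powr l * \<bar>truncated_powr p 1 (w x) - truncated_powr p 1 (W x)\<bar>"
      proof -
        have "- (x powr l * truncated_powr p 1 (w x)) - - (x powr l * truncated_powr p 1 (W x)) = - (x powr l * (truncated_powr p 1 (w x) - truncated_powr p 1 (W x)))"
          by (simp add: algebra_simps)
        then show ?thesis by (simp only: abs_minus_cancel abs_mult) simp
      qed
      also have "\<dots> \<le> m powr l * (p * \<bar>w x - W x\<bar>)"
        using truncated_powr_lipschitz[of 1 p "w x" "W x"] that l p by (intro mult_mono powr_mono2) auto
      finally show ?thesis by simp
    qed
    have L: "0 \<le> m powr l * p" using p by simp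
    have i: "w 0 = W 0" "w1 0 = V 0" using d v10 by (auto simp: w_def w1_def d_def W_0 V_0)
    have mm: "m \<in> {0..m}" using m by simp
    show "w m = W m" "w1 m = V m"
      using ode2_unique[where f="\<lambda>x u. - (x powr l * truncated_powr p 1 u)", OF ode2_subset[OF w_ode order_refl m(2)] W_ode' i L lip mm]
      by auto
  qed
  \<comment> \<open>At \<open>r\<close> the profile is 0, whereas the rescaled shot is at least
    \<open>1 / d\<close>.\<close>
  have "\<eta> < r"
  proof (rule ccontr)
    assume "\<not> \<eta> < r"
    then have "m = r" by (simp add: m_def)
    then have "?v (m / \<eta>) = 0" using eq(1) W_r d by (simp add: w_def)
    moreover have "?v (m / \<eta>) \<ge> 1" using m \<eta> by (intro v_mono(2)) auto
    ultimately show False by simp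
  qed
  then have "m = \<eta>" by (simp add: m_def)
  then have W\<eta>: "W \<eta> = 1 / d" "V \<eta> = ?v1 1 / (d * \<eta>)" using eq end1 \<eta> by (auto simp: w_def w1_def)
  have "Lam \<eta> = lam"
    unfolding Lam_def W\<eta> \<eta>l using d by (simp add: powr_divide)
  moreover have "slope \<eta> = \<beta>"
    unfolding slope_def W\<eta> using d \<eta> odd1'[of 1] by simp
  ultimately show thesis using \<eta> \<open>\<eta> < r\<close> by (intro that) auto
qed

end

text \<open>Continuity supplies the boundedness without which a real \<open>SUP\<close> carries no
  information.\<close>

lemma sup_norm_ge:
  assumes "continuous_on {-1..1} u" "x \<in> {-1..1}"
  shows "\<bar>u x\<bar> \<le> sup_norm u"
proof -
  have "compact ((\<lambda>x. \<bar>u x\<bar>) ` {-1..1})" 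
    by (intro compact_continuous_image continuous_intros assms) auto
  then have "bdd_above ((\<lambda>x. \<bar>u x\<bar>) ` {-1..1})" by (intro bounded_imp_bdd_above compact_imp_bounded)
  then show ?thesis unfolding sup_norm_def using assms(2) by (intro cSUP_upper) auto
qed

lemma sup_norm_le:
  assumes "\<And>x. x \<in> {-1..1} \<Longrightarrow> \<bar>u x\<bar> \<le> C"
  shows "sup_norm u \<le> C"
  unfolding sup_norm_def by (rule cSUP_least) (use assms in auto)

section \<open>Expansion of the end value at an even solution\<close>

context emden_odd
begin

text \<open>The derivative of the end value of the shot with respect to its slope, at the even solution.\<close>

definition D :: "real \<Rightarrow> real" where "D \<eta> = 2 * (\<psi> \<eta> / k) * (z \<eta> / \<eta>)"

text \<open>\<open>E \<eta> + t * \<phi>\<close> is the first order approximation of the shot, with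
  \<open>\<phi>\<close> the linearized solution having value 0 and slope 1 at the left end. The
  remainder has zero data there and satisfies the linearized equation up to an error of order
  \<open>t\<^sup>2\<close>.\<close>

lemma slope_expansion:
  assumes \<eta>: "0 < \<eta>" "\<eta> < r" and HK: "K \<ge> 1 + 2 * (slope \<eta> + 1)"
  obtains C t0 where "C \<ge> 0" "0 < t0" "t0 \<le> 1" "\<And>t. 0 < t \<Longrightarrow> t < t0 \<Longrightarrow>
    \<bar>fst (shooting.shot l p K (Lam \<eta>) (slope \<eta> + t)) 1 - 1 - t * D \<eta>\<bar> \<le> C * t\<^sup>2"
proof -
  let ?lam = "Lam \<eta>" and ?s = "slope \<eta>"
  have s: "?s > 0" by (rule slope_pos[OF \<eta>])
  have lam: "?lam > 0" by (rule Lam_pos[OF \<eta>])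
  interpret sh: shooting l p K using l p HK s by unfold_locales auto
  interpret sl: sturm_liouville "\<lambda>x. \<eta>\<^sup>2 * q (\<eta> * x)" by (rule scaled_sturm_liouville) (use \<eta> in auto)
  define C1 where "C1 = exp ((?lam * (p * K powr (p - 1)) + 2) * 2)"
  have C1: "C1 > 0" by (simp add: C1_def)
  obtain C2 where C2: "C2 \<ge> 0" "\<And>a b. a \<in> {1/2..K} \<Longrightarrow> b \<in> {1/2..K} \<Longrightarrow>
    \<bar>b powr p - a powr p - p * a powr (p - 1) * (b - a)\<bar> \<le> C2 * (b - a)\<^sup>2"
    using powr_taylor2[of K p] sh.K p by auto
  obtain M where M: "M \<ge> 0" "\<And>x. x \<in> {0..1} \<Longrightarrow> \<bar>\<eta>\<^sup>2 * q (\<eta> * x)\<bar> \<le> M" by (rule sl.Q_bounded) blast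
  have vE: "sh.v ?lam ?s x = E \<eta> x" if "x \<in> {-1..1}" for x
    by (rule shot_eq_E[OF \<eta> _ that]) (use HK s in auto)
  \<comment> \<open>The end values of the basis solutions, used crosswise as coefficients: this
    makes \<open>\<phi>\<close> vanish at -1, gives \<open>\<phi>1 (-1) = 1\<close> by the
    Wronskian, and yields \<open>\<phi> 1 = 2 * b * a\<close>.\<close>
  define a where "a = sl.S 0 1 0 1"
  define b where "b = sl.S 1 0 0 1"
  have ab: "2 * b * a = D \<eta>" 
    unfolding a_def b_def D_def using scaled_solutions[of \<eta> 1] \<eta> by simp
  define \<phi> where "\<phi> x = a * sl.Se 0 x + b * sl.So 0 x" for x
  define \<phi>1 where "\<phi>1 x = a * sl.Se1 0 x + b * sl.So1 0 x" for x
  have \<phi>_ode: "ode2 (-1) 1 \<phi> \<phi>1 (\<lambda>x. - (\<eta>\<^sup>2 * q (\<eta> * \<bar>x\<bar>)) * \<phi> x)"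
    unfolding \<phi>_def \<phi>1_def by (rule ode2_cong[OF ode2_lincomb[OF sl.Se_ode sl.So_ode]]) (simp add: algebra_simps)
  have \<phi>m1: "\<phi> (-1) = 0" by (simp add: \<phi>_def sl.Se_def sl.So_def a_def b_def)
  have \<phi>1m1: "\<phi>1 (-1) = 1"
  proof -
    define X where "X = sl.S1 1 0 0 1"
    define Y where "Y = sl.S1 0 1 0 1"
    have "b * Y - X * a = 1" using sl.S_wronskian[of 1 0] by (simp add: X_def Y_def a_def b_def)
    moreover have "\<phi>1 (-1) = a * (- X) + b * Y" by (simp add: \<phi>1_def sl.Se1_def sl.So1_def X_def Y_def)
    moreover have "a * (- X) + b * Y = b * Y - X * a" by simp
    ultimately show ?thesis by simp
  qed
  have \<phi>_1: "\<phi> 1 = D \<eta>" unfolding ab[symmetric] by (simp add: \<phi>_def sl.Se_def sl.So_def a_def b_def)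
  define \<delta> where "\<delta> = ?lam * (C2 * C1\<^sup>2)"
  have \<delta>: "\<delta> \<ge> 0" using lam C2 by (simp add: \<delta>_def)
  define C where "C = \<delta> * exp ((M + 2) * (1 - (-1)))"
  \<comment> \<open>The bound 1 keeps the slopes within the range allowed by \<open>K\<close>; the
    other keeps the shot above 1/2, where the Taylor estimate holds.\<close>
  define t0 where "t0 = min 1 (1 / (2 * C1))"
  show thesis
  proof (rule that[of C t0])
    show "C \<ge> 0" using \<delta> by (simp add: C_def)
    show "0 < t0" "t0 \<le> 1" using C1 by (auto simp: t0_def)
    fix t assume t: "0 < t" "t < t0"
    then have t1: "t < 1" "C1 * t \<le> 1/2" using C1 by (auto simp: t0_def field_simps)
    let ?v = "sh.v ?lam (?s + t)" and ?v1 = "sh.v1 ?lam (?s + t)"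
    let ?E1 = "\<lambda>x. sgn x * (\<eta> * V (\<eta> * \<bar>x\<bar>) / W \<eta>)"
    have h: "\<bar>?v x - E \<eta> x\<bar> \<le> C1 * t" if "x \<in> {-1..1}" for x
      using sh.v_dependence[of ?lam ?lam x "?s + t" ?lam ?s] vE[OF that] that lam t by (simp add: C1_def mult.commute)
    let ?R = "\<lambda>x. 1 * (1 * (- (?lam * \<bar>x\<bar> powr l * truncated_powr p K (?v x))) + (-1) * (- (?lam * \<bar>x\<bar> powr l * E \<eta> x powr p)))
      + (-t) * (- (\<eta>\<^sup>2 * q (\<eta> * \<bar>x\<bar>)) * \<phi> x)"
    define e where "e x = 1 * (1 * ?v x + (-1) * E \<eta> x) + (-t) * \<phi> x" for x
    define e1 where "e1 x = 1 * (1 * ?v1 x + (-1) * ?E1 x) + (-t) * \<phi>1 x" for x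
    have o: "ode2 (-1) 1 e e1 ?R"
      unfolding e_def e1_def by (rule ode2_lincomb[OF ode2_lincomb[OF sh.v_ode E_ode[OF \<eta>]] \<phi>_ode])
    have "\<bar>e 1\<bar> \<le> (\<bar>e (-1)\<bar> + \<bar>e1 (-1)\<bar> + \<delta> * t\<^sup>2) * exp ((M + 2) * (1 - (-1)))"
    proof (rule gronwall2_abs[OF o M(1)])
      show "0 \<le> \<delta> * t\<^sup>2" using \<delta> by simp
      fix x :: real assume "-1 < x" "x < 1"
      then have x: "x \<in> {-1..1}" by simp
      have E1: "1 \<le> E \<eta> x" "E \<eta> x \<le> K" using E_bounds[OF \<eta> x] HK s by auto
      have vx: "1/2 \<le> ?v x" using h[OF x] t1 E1 by linarith
      have vK: "?v x \<le> K" using sh.v_le(2)[of ?lam "?s + t" x] lam s t t1 x HK by auto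
      have tr: "truncated_powr p K (?v x) = ?v x powr p" by (rule truncated_powr_eq) (use vx vK in auto)
      define R where "R = ?v x powr p - E \<eta> x powr p - p * E \<eta> x powr (p - 1) * (?v x - E \<eta> x)"
      have "\<bar>R\<bar> \<le> C2 * (?v x - E \<eta> x)\<^sup>2" unfolding R_def by (rule C2(2)) (use E1 vx vK in auto)
      also have "\<dots> \<le> C2 * (C1 * t)\<^sup>2" using h[OF x] C2(1) C1 t by (intro mult_left_mono) (auto simp: abs_le_square_iff[symmetric])
      finally have R: "\<bar>R\<bar> \<le> C2 * (C1 * t)\<^sup>2" .
      have "?R x
         = - ((\<eta>\<^sup>2 * q (\<eta> * \<bar>x\<bar>)) * e x + ?lam * \<bar>x\<bar> powr l * R)"
        unfolding tr linearized_coefficient[OF \<eta> x] R_def e_def by (simp add: algebra_simps)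
      then have "\<bar>?R x\<bar> = \<bar>(\<eta>\<^sup>2 * q (\<eta> * \<bar>x\<bar>)) * e x + ?lam * \<bar>x\<bar> powr l * R\<bar>"
        by (simp only: abs_minus_cancel)
      also have "\<dots> \<le> \<bar>(\<eta>\<^sup>2 * q (\<eta> * \<bar>x\<bar>)) * e x\<bar> + \<bar>?lam * \<bar>x\<bar> powr l * R\<bar>" by (rule abs_triangle_ineq)
      also have "\<dots> \<le> M * \<bar>e x\<bar> + \<delta> * t\<^sup>2"
      proof (rule add_mono)
        show "\<bar>(\<eta>\<^sup>2 * q (\<eta> * \<bar>x\<bar>)) * e x\<bar> \<le> M * \<bar>e x\<bar>"
          unfolding abs_mult[of _ "e x"] by (intro mult_right_mono M(2)) (use x in auto)
        have "\<bar>?lam * \<bar>x\<bar> powr l * R\<bar> = ?lam * \<bar>x\<bar> powr l * \<bar>R\<bar>" using lam by (simp add: abs_mult)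
        also have "\<dots> \<le> ?lam * 1 * (C2 * (C1 * t)\<^sup>2)"
          using R sh.absx_powr[OF x] lam by (intro mult_mono mult_left_mono) auto
        also have "\<dots> = \<delta> * t\<^sup>2" by (simp add: \<delta>_def power_mult_distrib)
        finally show "\<bar>?lam * \<bar>x\<bar> powr l * R\<bar> \<le> \<delta> * t\<^sup>2" .
      qed
      finally show "\<bar>?R x\<bar> \<le> M * \<bar>e x\<bar> + \<delta> * t\<^sup>2" .
    qed auto
    moreover have "e (-1) = 0" using E_end[OF \<eta>] \<phi>m1 by (simp add: e_def)
    moreover have "e1 (-1) = 0" using \<phi>1m1 by (simp add: e1_def slope_def)
    moreover have "e 1 = ?v 1 - 1 - t * D \<eta>" using E_end[OF \<eta>] \<phi>_1 by (simp add: e_def)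
    ultimately show "\<bar>?v 1 - 1 - t * D \<eta>\<bar> \<le> C * t\<^sup>2" by (simp add: C_def mult_ac)
  qed
qed

lemma shot_sign:
  assumes \<eta>: "0 < \<eta>" "\<eta> < r" and HK: "K \<ge> 1 + 2 * (slope \<eta> + 1)" and "D \<eta> \<noteq> 0"
  obtains t0 where "0 < t0" "t0 \<le> 1" "\<And>t. 0 < t \<Longrightarrow> t < t0 \<Longrightarrow>
    (fst (shooting.shot l p K (Lam \<eta>) (slope \<eta> + t)) 1 - 1) * D \<eta> > 0"
proof -
  obtain C t0 where C: "C \<ge> 0" "0 < t0" "t0 \<le> 1" "\<And>t. 0 < t \<Longrightarrow> t < t0 \<Longrightarrow>
    \<bar>fst (shooting.shot l p K (Lam \<eta>) (slope \<eta> + t)) 1 - 1 - t * D \<eta>\<bar> \<le> C * t\<^sup>2"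
    by (rule slope_expansion[OF \<eta> HK]) blast
  \<comment> \<open>Below \<open>t1\<close> the quadratic error is smaller than the linear term; the
    1 added to \<open>C\<close> guards against division by 0.\<close>
  define t1 where "t1 = min t0 (\<bar>D \<eta>\<bar> / (C + 1))"
  have "0 < t1" "t1 \<le> 1" using C assms(4) by (auto simp: t1_def)
  moreover have "(fst (shooting.shot l p K (Lam \<eta>) (slope \<eta> + t)) 1 - 1) * D \<eta> > 0" if t: "0 < t" "t < t1" for t
  proof -
    let ?F = "fst (shooting.shot l p K (Lam \<eta>) (slope \<eta> + t)) 1 - 1"
    have "\<bar>?F - t * D \<eta>\<bar> \<le> C * t\<^sup>2" using C(4)[of t] t by (auto simp: t1_def)
    also have "\<dots> = t * (C * t)" by (simp add: power2_eq_square)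
    also have "\<dots> < t * \<bar>D \<eta>\<bar>"
    proof (rule mult_strict_left_mono)
      have "t < \<bar>D \<eta>\<bar> / (C + 1)" using t by (simp add: t1_def)
      then have "t * (C + 1) < \<bar>D \<eta>\<bar>" using C(1) by (simp add: pos_less_divide_eq)
      then show "C * t < \<bar>D \<eta>\<bar>" using t by (simp add: algebra_simps)
    qed (use t in simp)
    finally have lt: "\<bar>?F - t * D \<eta>\<bar> < t * \<bar>D \<eta>\<bar>" .
    show ?thesis
    proof (cases "D \<eta> > 0")
      case True
      then have "?F > 0" using lt by simp
      then show ?thesis using True by simp
    next
      case False
      then have D: "D \<eta> < 0" using assms(4) by simp
      then have "?F < 0" using lt by simp
      then show ?thesis using D by (simp add: mult_neg_neg)
    qed
  qed
  ultimately show thesis by (rule that)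
qed

lemma D_pos: "c < \<eta> \<Longrightarrow> \<eta> < r \<Longrightarrow> D \<eta> > 0"
  using \<psi>_neg[of \<eta>] z_neg[of \<eta>] ec k_pos
  by (simp add: D_def mult_neg_neg divide_neg_pos)

lemma D_neg: "e < \<eta> \<Longrightarrow> \<eta> < c \<Longrightarrow> D \<eta> < 0"
  using \<psi>_neg[of \<eta>] z_pos[of \<eta>] ec k_pos
  by (simp add: D_def mult_neg_pos divide_neg_pos)

lemma Lam_decr:
  assumes "e \<le> \<eta>" "\<eta> < \<eta>'" "\<eta>' \<le> r" shows "Lam \<eta>' < Lam \<eta>"
proof (rule DERIV_neg_imp_decreasing_open[OF assms(2)])
  show "continuous_on {\<eta>..\<eta>'} Lam" using Lam_cont by (rule continuous_on_subset) (use assms ec in auto)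
  fix x assume x: "\<eta> < x" "x < \<eta>'"
  then have x': "0 < x" "x < r" using assms ec by auto
  have "(p - 1) * W x powr (p - 2) * x powr (l + 1) > 0" using p W_pos[of x] x' by simp
  then have "(p - 1) * W x powr (p - 2) * x powr (l + 1) * \<psi> x < 0"
    using \<psi>_neg[of x] x assms x' by (intro mult_pos_neg) auto
  then show "\<exists>d. (Lam has_real_derivative d) (at x) \<and> d < 0" using Lam_deriv[OF x'] by blast
qed

lemma shot_not_even:
  assumes "K \<ge> 1" "1 + 2 * \<beta> \<le> K" "e \<le> \<eta>" "\<eta> < r" "\<beta> > slope \<eta>"
    and "fst (shooting.shot l p K (Lam \<eta>) \<beta>) 1 = 1"
  shows "\<not> even_fun (\<lambda>x. fst (shooting.shot l p K (Lam \<eta>) \<beta>) x - 1)"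
proof
  assume ev: "even_fun (\<lambda>x. fst (shooting.shot l p K (Lam \<eta>) \<beta>) x - 1)"
  have \<eta>: "0 < \<eta>" using assms ec by auto
  obtain \<eta>' where \<eta>': "0 < \<eta>'" "\<eta>' < r" "Lam \<eta> = Lam \<eta>'" "\<beta> = slope \<eta>'"
    using even_shot[OF assms(1,2) Lam_pos[OF \<eta> assms(4)] _ assms(6) ev] slope_pos[OF \<eta> assms(4)] assms(5) by auto
  have "\<eta> < \<eta>'"
    using slope_strict_mono[of \<eta>' \<eta>] \<eta>' assms by (cases \<eta> \<eta>' rule: linorder_cases) auto
  then show False using Lam_decr[OF assms(3), of \<eta>'] \<eta>' by auto
qed

section \<open>Non-even solutions\<close>

text \<open>The last conclusion records a lower bound for the norm; it becomes effective as
  \<open>\<eta>\<close> approaches \<open>r\<close>, where the slope is unbounded.\<close>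

lemma noneven_solution_exists:
  assumes \<eta>: "c < \<eta>" "\<eta> < r"
  obtains u where "positive_solution l p (Lam \<eta>) u" "\<not> even_fun u"
    "slope \<eta> < 2 * Lam \<eta> * (sup_norm u + 1) powr p"
proof -
  have \<eta>0: "0 < \<eta>" using \<eta> ec by auto
  let ?lam = "Lam \<eta>" and ?s = "slope \<eta>"
  have s: "?s > 0" by (rule slope_pos[OF \<eta>0 \<eta>(2)])
  have lam: "?lam > 0" by (rule Lam_pos[OF \<eta>0 \<eta>(2)])
  obtain B where B: "B > 0" "\<And>K \<beta>. K \<ge> 1 \<Longrightarrow> \<beta> > B \<Longrightarrow> 1 + 2 * \<beta> \<le> K \<Longrightarrow> fst (shooting.shot l p K ?lam \<beta>) 1 < 1"
    by (rule shooting_misses_for_large_slope[OF l p lam]) blast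
  \<comment> \<open>\<open>B'\<close> exceeds both the missing threshold \<open>B\<close> and every
    slope used near the even solution; \<open>K\<close> then makes the truncation inactive for all
    slopes up to \<open>B'\<close>.\<close>
  define B' where "B' = max B ?s + 2"
  define K where "K = 1 + 2 * B'"
  have B': "B' > B" "B' \<ge> ?s + 2" by (auto simp: B'_def)
  interpret sh: shooting l p K using l p B B' by unfold_locales (auto simp: K_def)
  obtain t0 where t0: "0 < t0" "t0 \<le> 1" "\<And>t. 0 < t \<Longrightarrow> t < t0 \<Longrightarrow> (sh.v ?lam (?s + t) 1 - 1) * D \<eta> > 0"
    using shot_sign[OF \<eta>0 \<eta>(2), of K] B' D_pos[OF \<eta>] by (auto simp: K_def)
  define t where "t = t0 / 2"
  have t: "0 < t" "t < t0" using t0 by (auto simp: t_def)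
  have lo: "sh.v ?lam (?s + t) 1 > 1" using t0(3)[OF t] D_pos[OF \<eta>] by (simp add: zero_less_mult_iff)
  have hi: "sh.v ?lam B' 1 < 1" by (rule B(2)) (use B' sh.K in \<open>auto simp: K_def\<close>)
  have "continuous_on {?s + t..B'} (\<lambda>\<beta>. sh.v ?lam \<beta> 1)"
    by (rule sh.v_continuous_compose[where M="?lam"]) (use lam in \<open>auto intro!: continuous_intros\<close>)
  then obtain \<beta> where \<beta>: "?s + t \<le> \<beta>" "\<beta> \<le> B'" "sh.v ?lam \<beta> 1 = 1"
    using IVT2'[of "\<lambda>\<beta>. sh.v ?lam \<beta> 1" B' 1 "?s + t"] lo hi B' t t0 by auto
  have \<beta>K: "1 + 2 * \<beta> \<le> K" using \<beta> by (simp add: K_def)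
  have \<beta>s: "\<beta> > ?s" "\<beta> > 0" using \<beta> t s by auto
  define u where "u = (\<lambda>x. sh.v ?lam \<beta> x - 1)"
  have uc: "continuous_on {-1..1} u" unfolding u_def by (intro continuous_intros sh.v_cont)
  have "positive_solution l p ?lam u" unfolding u_def by (rule sh.v_positive_solution[OF lam \<beta>s(2) \<beta>(3) \<beta>K])
  moreover have "\<not> even_fun u" unfolding u_def
    by (rule shot_not_even[OF sh.K \<beta>K _ \<eta>(2) \<beta>s(1) \<beta>(3)]) (use \<eta> ec in auto)
  moreover have "?s < 2 * ?lam * (sup_norm u + 1) powr p"
  proof -
    have ub: "\<bar>u x\<bar> \<le> sup_norm u" if "x \<in> {-1..1}" for x by (rule sup_norm_ge[OF uc that])
    have "\<beta> \<le> 2 * ?lam * (sup_norm u + 1) powr p"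
    proof (rule sh.slope_bound)
      show "sh.v ?lam \<beta> x \<le> sup_norm u + 1" if "x \<in> {-1..1}" for x using ub[OF that] by (simp add: u_def)
      show "0 \<le> sup_norm u + 1" using ub[of 0] by simp
    qed (use lam \<beta> in auto)
    then show ?thesis using \<beta>s by simp
  qed
  ultimately show thesis by (rule that)
qed

text \<open>The increment \<open>t\<close> of the slope is held fixed and \<open>\<eta>\<close>
  varies, so the solution found is off the even curve whichever \<open>\<eta>\<close> the
  intermediate value theorem returns.\<close>

lemma bifurcation:
  assumes "\<epsilon> > 0"
  obtains lam u where "positive_solution l p lam u" "\<not> even_fun u"
    "\<bar>lam - Lam c\<bar> + sup_norm (\<lambda>x. u x - (E c x - 1)) < \<epsilon>"
proof -
  have c0: "0 < c" using ec by simp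
  \<comment> \<open>Staying beyond \<open>e\<close> keeps \<open>Lam\<close> decreasing, with
    maximum \<open>Lam a\<close>; staying below \<open>r\<close> keeps the slopes bounded by
    \<open>slope b\<close>, which determines \<open>K\<close>.\<close>
  define a where "a = (e + c) / 2"
  define b where "b = (c + r) / 2"
  have ab: "e < a" "a < c" "c < b" "b < r" "0 < a" using ec by (auto simp: a_def b_def)
  define K where "K = 1 + 2 * (slope b + 1)"
  have sb: "slope b > 0" using slope_pos[of b] ab by auto
  interpret sh: shooting l p K using l p sb by unfold_locales (auto simp: K_def)
  have s_le: "slope \<eta> \<le> slope b" if "\<eta> \<in> {a..b}" for \<eta>
    using slope_strict_mono[of \<eta> b] that ab by (cases "\<eta> = b") auto
  have Lc: "continuous_on {a..b} Lam" using Lam_cont by (rule continuous_on_subset) (use ab in auto)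
  have sc: "continuous_on {a..b} slope" by (rule slope_cont) (use ab in auto)
  have L_le: "0 \<le> Lam \<eta> \<and> Lam \<eta> \<le> Lam a" if "\<eta> \<in> {a..b}" for \<eta>
    using Lam_pos[of \<eta>] Lam_decr[of a \<eta>] that ab ec by (cases "\<eta> = a") auto
  define C where "C = exp ((Lam a * (p * K powr (p - 1)) + 2) * 2)"
  have C: "C > 0" by (simp add: C_def)
  \<comment> \<open>The denominator collects all constants of the final estimate, which then totals
    \<open>\<epsilon> / 2\<close>.\<close>
  define \<epsilon>' where "\<epsilon>' = \<epsilon> / (2 * (1 + C + K powr p * C))"
  have den: "1 + C + K powr p * C > 0" using C by (simp add: add_pos_nonneg)
  have \<epsilon>': "\<epsilon>' > 0" using assms den by (simp add: \<epsilon>'_def)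
  have cab: "c \<in> {a..b}" using ab by auto
  obtain d1 where d1: "d1 > 0" "\<And>\<eta>. \<eta> \<in> {a..b} \<Longrightarrow> dist \<eta> c < d1 \<Longrightarrow> dist (Lam \<eta>) (Lam c) < \<epsilon>'"
    using Lc cab \<epsilon>' unfolding continuous_on_iff by metis
  obtain d2 where d2: "d2 > 0" "\<And>\<eta>. \<eta> \<in> {a..b} \<Longrightarrow> dist \<eta> c < d2 \<Longrightarrow> dist (slope \<eta>) (slope c) < \<epsilon>' / 2"
    using sc cab \<epsilon>' unfolding continuous_on_iff by (metis half_gt_zero)
  define d where "d = min (min d1 d2) (min (c - a) (b - c)) / 2"
  have d: "d > 0" "d < d1" "d < d2" "a \<le> c - d" "c + d \<le> b" using d1 d2 ab by (auto simp: d_def min_def field_simps)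
  define \<eta>1 where "\<eta>1 = c - d"
  define \<eta>2 where "\<eta>2 = c + d"
  have \<eta>12: "a \<le> \<eta>1" "\<eta>1 < c" "c < \<eta>2" "\<eta>2 \<le> b" using d by (auto simp: \<eta>1_def \<eta>2_def)
  have near: "\<bar>\<eta> - c\<bar> < d1" "\<bar>\<eta> - c\<bar> < d2" if "\<eta> \<in> {\<eta>1..\<eta>2}" for \<eta>
    using that d by (auto simp: \<eta>1_def \<eta>2_def)
  have K1: "K \<ge> 1 + 2 * (slope \<eta> + 1)" if "\<eta> \<in> {a..b}" for \<eta> using s_le[OF that] by (simp add: K_def)
  obtain t1 where t1: "0 < t1" "t1 \<le> 1" "\<And>t. 0 < t \<Longrightarrow> t < t1 \<Longrightarrow> (sh.v (Lam \<eta>1) (slope \<eta>1 + t) 1 - 1) * D \<eta>1 > 0"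
    using shot_sign[of \<eta>1 K] K1[of \<eta>1] D_neg[of \<eta>1] \<eta>12 ab by auto
  obtain t2 where t2: "0 < t2" "t2 \<le> 1" "\<And>t. 0 < t \<Longrightarrow> t < t2 \<Longrightarrow> (sh.v (Lam \<eta>2) (slope \<eta>2 + t) 1 - 1) * D \<eta>2 > 0"
    using shot_sign[of \<eta>2 K] K1[of \<eta>2] D_pos[of \<eta>2] \<eta>12 ab by auto
  \<comment> \<open>The smallness required by \<open>shot_sign\<close> depends on the parameter, so
    \<open>t\<close> is chosen only after \<open>\<eta>1\<close> and \<open>\<eta>2\<close>, to work
    for both at once.\<close>
  define t where "t = min (min t1 t2) \<epsilon>' / 2"
  have t: "0 < t" "t < t1" "t < t2" "t \<le> \<epsilon>' / 2" using t1 t2 \<epsilon>' by (auto simp: t_def min_def)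
  have lo: "sh.v (Lam \<eta>1) (slope \<eta>1 + t) 1 < 1"
    using t1(3)[OF t(1,2)] D_neg[of \<eta>1] \<eta>12 ab by (auto simp: zero_less_mult_iff)
  have hi: "sh.v (Lam \<eta>2) (slope \<eta>2 + t) 1 > 1"
    using t2(3)[OF t(1,3)] D_pos[of \<eta>2] \<eta>12 ab by (auto simp: zero_less_mult_iff)
  have sub: "{\<eta>1..\<eta>2} \<subseteq> {a..b}" using \<eta>12 by auto
  have "continuous_on {\<eta>1..\<eta>2} (\<lambda>\<eta>. sh.v (Lam \<eta>) (slope \<eta> + t) 1)"
    by (rule sh.v_continuous_compose[where M="Lam a" and L=Lam and G="\<lambda>\<eta>. slope \<eta> + t"])
      (use L_le sub in \<open>auto intro!: continuous_intros intro: continuous_on_subset[OF Lc sub] continuous_on_subset[OF sc sub]\<close>)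
  then obtain \<eta> where \<eta>: "\<eta>1 \<le> \<eta>" "\<eta> \<le> \<eta>2" "sh.v (Lam \<eta>) (slope \<eta> + t) 1 = 1"
    using IVT'[of "\<lambda>\<eta>. sh.v (Lam \<eta>) (slope \<eta> + t) 1" \<eta>1 1 \<eta>2] lo hi \<eta>12 by auto
  have \<eta>I: "\<eta> \<in> {\<eta>1..\<eta>2}" "\<eta> \<in> {a..b}" using \<eta> \<eta>12 by auto
  have \<eta>0: "0 < \<eta>" "\<eta> < r" "e \<le> \<eta>" using \<eta>I ab by auto
  let ?\<beta> = "slope \<eta> + t"
  have \<beta>: "?\<beta> > 0" "?\<beta> > slope \<eta>" using slope_pos[OF \<eta>0(1,2)] t by auto
  have \<beta>K: "1 + 2 * ?\<beta> \<le> K" using K1[OF \<eta>I(2)] t t1 by auto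
  define u where "u = (\<lambda>x. sh.v (Lam \<eta>) ?\<beta> x - 1)"
  have "positive_solution l p (Lam \<eta>) u"
    unfolding u_def by (rule sh.v_positive_solution[OF Lam_pos[OF \<eta>0(1,2)] \<beta>(1) \<eta>(3) \<beta>K])
  moreover have "\<not> even_fun u"
    unfolding u_def by (rule shot_not_even[OF sh.K \<beta>K \<eta>0(3,2) \<beta>(2) \<eta>(3)])
  moreover have "\<bar>Lam \<eta> - Lam c\<bar> + sup_norm (\<lambda>x. u x - (E c x - 1)) < \<epsilon>"
  proof -
    have 1: "\<bar>Lam \<eta> - Lam c\<bar> < \<epsilon>'" using d1(2)[OF \<eta>I(2)] near(1)[OF \<eta>I(1)] by (simp add: dist_real_def)
    have 2: "\<bar>?\<beta> - slope c\<bar> \<le> \<epsilon>'" 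
    proof -
      have "\<bar>slope \<eta> - slope c\<bar> < \<epsilon>' / 2" using d2(2)[OF \<eta>I(2)] near(2)[OF \<eta>I(1)] by (simp add: dist_real_def)
      then show ?thesis using t(1,4) by linarith
    qed
    have vE: "sh.v (Lam c) (slope c) x = E c x" if "x \<in> {-1..1}" for x
      by (rule shot_eq_E[OF c0 ec(3) _ that]) (use K1[OF cab] slope_pos[OF c0 ec(3)] in auto)
    have "sup_norm (\<lambda>x. u x - (E c x - 1)) \<le> (\<epsilon>' + \<epsilon>' * K powr p) * C"
    proof (rule sup_norm_le)
      fix x :: real assume x: "x \<in> {-1..1}"
      have "\<bar>u x - (E c x - 1)\<bar> = \<bar>sh.v (Lam \<eta>) ?\<beta> x - sh.v (Lam c) (slope c) x\<bar>" using vE[OF x] by (simp add: u_def)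
      also have "\<dots> \<le> (\<bar>?\<beta> - slope c\<bar> + \<bar>Lam \<eta> - Lam c\<bar> * K powr p) * C"
        unfolding C_def by (rule sh.v_dependence) (use L_le[OF \<eta>I(2)] x in auto)
      also have "\<dots> \<le> (\<epsilon>' + \<epsilon>' * K powr p) * C"
        using 1 2 C by (intro mult_right_mono add_mono) auto
      finally show "\<bar>u x - (E c x - 1)\<bar> \<le> (\<epsilon>' + \<epsilon>' * K powr p) * C" .
    qed
    then have "\<bar>Lam \<eta> - Lam c\<bar> + sup_norm (\<lambda>x. u x - (E c x - 1)) \<le> \<epsilon>' * (1 + C + K powr p * C)"
      using 1 by (simp add: algebra_simps)
    also have "\<dots> = \<epsilon> / 2"
    proof -
      define X where "X = 1 + C + K powr p * C"
      have "X \<noteq> 0" using den by (simp add: X_def)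
      then show ?thesis unfolding \<epsilon>'_def X_def[symmetric] by simp
    qed
    also have "\<dots> < \<epsilon>" using assms by simp
    finally show ?thesis .
  qed
  ultimately show thesis by (rule that)
qed

end

section \<open>Korman's parametrization\<close>

lemma korman_profile_exists:
  assumes l: "l > 0" and p: "p > 1"
  shows "\<exists>w r. korman_profile l p w r"
proof -
  \<comment> \<open>\<open>\<kappa>\<close> bounds from below the steepness gained between 1/4 and
    1/2, where the weight is at least \<open>(1/4) powr l\<close> and the solution at least 1/2.
    Falling from height at most 1 at that rate, the solution reaches 0 before
    \<open>R\<close>.\<close>
  define \<kappa> where "\<kappa> = (1/4) * ((1/4) powr l * (1/2) powr p)"
  have \<kappa>: "\<kappa> > 0" by (simp add: \<kappa>_def)
  define R where "R = 1 + 1 / \<kappa>"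
  have R: "R > 1" using \<kappa> by (simp add: R_def)
  define g where "g = truncated_powr p 1"
  have g: "0 \<le> g u" "g u \<le> 1" for u
    using truncated_powr_nonneg[of p 1 u] truncated_powr_le[of 1 p u] p by (auto simp: g_def)
  have L: "0 \<le> R powr l * p" using p by simp
  have c: "continuous_on ({0..R} \<times> UNIV) (\<lambda>(x,u). - (x powr l * g u))"
    unfolding case_prod_unfold g_def using p l
    by (intro continuous_intros continuous_on_powr' continuous_on_compose2[OF truncated_powr_cont[of p UNIV 1]]) auto
  obtain y y1 where y0: "y 0 = 1" "y1 0 = 0"
    and yd: "\<And>x. x \<in> {0..R} \<Longrightarrow> (y has_real_derivative y1 x) (at x within {0..R})"
    "\<And>x. x \<in> {0..R} \<Longrightarrow> (y1 has_real_derivative - (x powr l * g (y x))) (at x within {0..R})"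
  proof (rule picard2[where f="\<lambda>x u. - (x powr l * g u)" and a=0 and b=R and A=1 and B=0, OF _ L c])
    fix x u v assume x: "x \<in> {0..R}"
    have "- (x powr l * g u) - - (x powr l * g v) = - (x powr l * (g u - g v))" by (simp add: algebra_simps)
    then have "\<bar>- (x powr l * g u) - - (x powr l * g v)\<bar> = x powr l * \<bar>g u - g v\<bar>" 
      by (simp only: abs_minus_cancel abs_mult) simp
    also have "\<dots> \<le> R powr l * (p * \<bar>u - v\<bar>)"
      using truncated_powr_lipschitz[of 1 p u v] x l p unfolding g_def by (intro mult_mono powr_mono2) auto
    finally show "\<bar>- (x powr l * g u) - - (x powr l * g v)\<bar> \<le> R powr l * p * \<bar>u - v\<bar>" by simp
  qed (use R in auto)
  have o: "ode2 0 R y y1 (\<lambda>x. - (x powr l * g (y x)))" by (rule ode2_within[OF yd])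
  have y1_anti: "y1 t \<le> y1 s" if st: "0 \<le> s" "s < t" "t \<le> R" for s t
  proof -
    obtain \<xi> where \<xi>: "s < \<xi>" "\<xi> < t" "y1 t - y1 s = (t - s) * (- (\<xi> powr l * g (y \<xi>)))"
      by (rule ode2_MVT'[OF o st])
    have "0 \<le> (t - s) * (\<xi> powr l * g (y \<xi>))" using g st by simp
    then show ?thesis using \<xi>(3) by simp
  qed
  have y1_le0: "y1 x \<le> 0" if "0 \<le> x" "x \<le> R" for x using y1_anti[of 0 x] that y0 by (cases "x = 0") auto
  have y1_ge: "- x \<le> y1 x" if x: "0 < x" "x \<le> 1" for x
  proof -
    obtain \<xi> where \<xi>: "0 < \<xi>" "\<xi> < x" "y1 x - y1 0 = (x - 0) * (- (\<xi> powr l * g (y \<xi>)))"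
      by (rule ode2_MVT'[OF o, of 0 x]) (use x R in auto)
    have "\<xi> powr l \<le> 1 powr l" using \<xi> x l by (intro powr_mono2) auto
    then have "\<xi> powr l * g (y \<xi>) \<le> 1 * 1" using g by (intro mult_mono) auto
    then have "x * (\<xi> powr l * g (y \<xi>)) \<le> x * 1" using x by (intro mult_left_mono) auto
    then show ?thesis using \<xi>(3) y0 by simp
  qed
  have y_ge: "1/2 \<le> y x" if x: "0 \<le> x" "x \<le> 1/2" for x
  proof (cases "x = 0")
    case False
    obtain \<xi> where \<xi>: "0 < \<xi>" "\<xi> < x" "y x - y 0 = (x - 0) * y1 \<xi>"
      by (rule ode2_MVT[OF o, of 0 x]) (use x False R in auto)
    have "x * (-1) \<le> x * y1 \<xi>" using y1_ge[of \<xi>] \<xi> x by (intro mult_left_mono) auto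
    then show ?thesis using \<xi>(3) y0 x by simp
  qed (use y0 in auto)
  have "y1 (1/2) \<le> - \<kappa>"
  proof -
    obtain \<xi> where \<xi>: "1/4 < \<xi>" "\<xi> < 1/2" "y1 (1/2) - y1 (1/4) = (1/2 - 1/4) * (- (\<xi> powr l * g (y \<xi>)))"
      by (rule ode2_MVT'[OF o, of "1/4" "1/2"]) (use R in auto)
    have "(1/2) powr p \<le> g (y \<xi>)"
      unfolding g_def truncated_powr_def using y_ge[of \<xi>] \<xi> p by (intro powr_mono2) auto
    then have "(1/4) powr l * (1/2) powr p \<le> \<xi> powr l * g (y \<xi>)" using \<xi> l by (intro mult_mono powr_mono2) auto
    then have "\<kappa> \<le> (1/4) * (\<xi> powr l * g (y \<xi>))" unfolding \<kappa>_def by (intro mult_left_mono) auto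
    then show ?thesis using \<xi>(3) y1_le0[of "1/4"] R by simp
  qed
  then have y1_half: "y1 x \<le> - \<kappa>" if "1/2 < x" "x \<le> R" for x
    using y1_anti[of "1/2" x] that by simp
  have y_le: "y x \<le> 1" if x: "0 \<le> x" "x \<le> R" for x
  proof (cases "x = 0")
    case False
    obtain \<xi> where \<xi>: "0 < \<xi>" "\<xi> < x" "y x - y 0 = (x - 0) * y1 \<xi>"
      by (rule ode2_MVT[OF o, of 0 x]) (use x False in auto)
    have "x * y1 \<xi> \<le> 0" using y1_le0[of \<xi>] \<xi> x by (intro mult_nonneg_nonpos) auto
    then show ?thesis using \<xi>(3) y0 by simp
  qed (use y0 in auto)
  have "y R \<le> 0"
  proof -
    obtain \<xi> where \<xi>: "1/2 < \<xi>" "\<xi> < R" "y R - y (1/2) = (R - 1/2) * y1 \<xi>"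
      by (rule ode2_MVT[OF o, of "1/2" R]) (use R in auto)
    have "(R - 1/2) * y1 \<xi> \<le> (R - 1/2) * (- \<kappa>)" using y1_half[of \<xi>] \<xi> R by (intro mult_left_mono) auto
    also have "\<dots> \<le> - 1" using \<kappa> by (simp add: R_def field_simps)
    finally show ?thesis using \<xi>(3) y_le[of "1/2"] R by simp
  qed
  moreover have "y x > 0" if "0 < x" "x < 1/2" for x using y_ge[of x] that by simp
  ultimately obtain r where r: "0 < r" "r \<le> R" "y r = 0" "\<And>x. 0 < x \<Longrightarrow> x < r \<Longrightarrow> y x > 0"
    using first_zero[OF ode2D(1)[OF o], of "1/2"] R by auto
  have sub: "{0..r} \<subseteq> {0..R}" using r by auto
  have "korman_profile l p (\<lambda>x. y x - 1) r"
    unfolding korman_profile_def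
  proof (intro conjI exI[of _ y1] ballI)
    fix x assume x: "x \<in> {0..r}"
    have "((\<lambda>x. y x - 1) has_real_derivative y1 x) (at x within {0..R})"
      using yd(1)[of x] x sub by (auto intro!: derivative_eq_intros)
    then show "((\<lambda>x. y x - 1) has_real_derivative y1 x) (at x within {0..r})" by (rule has_field_derivative_subset) (rule sub)
    have "0 \<le> y x" using r(3) r(4)[of x] y0 x by (cases "x = 0 \<or> x = r") force+
    then have "g (y x) = y x powr p" unfolding g_def using y_le[of x] x r by (intro truncated_powr_eq) auto
    then have "(y1 has_real_derivative - (x powr l * (y x - 1 + 1) powr p)) (at x within {0..R})"
      using yd(2)[of x] x sub by auto
    then show "(y1 has_real_derivative - (x powr l * (y x - 1 + 1) powr p)) (at x within {0..r})" by (rule has_field_derivative_subset) (rule sub)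
  qed (use r y0 in auto)
  then show ?thesis by blast
qed

text \<open>For a given \<open>w\<close> the end point is unique, since \<open>w > -1\<close>
  strictly before it; the description defining \<open>korman_x1\<close> is thus legitimate for
  whichever profile was chosen.\<close>

lemma korman_profile_korman_w:
  assumes l: "l > 0" and p: "p > 1"
  shows "korman_profile l p (korman_w l p) (korman_x1 l p)"
proof -
  obtain r where r: "korman_profile l p (korman_w l p) r"
    unfolding korman_w_def using someI_ex[OF korman_profile_exists[OF assms]] by blast
  have "r' = r" if r': "korman_profile l p (korman_w l p) r'" for r'
  proof (rule ccontr)
    assume "r' \<noteq> r"
    then consider "r' < r" | "r < r'" by linarith
    then show False
      using r r' unfolding korman_profile_def by cases force+
  qed
  then have "korman_x1 l p = r" unfolding korman_x1_def using r by (rule the_equality[rotated])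
  then show ?thesis using r by simp
qed

lemma emden_korman:
  assumes "l > 0" "p > 1" "(p - 1) * l > 3"
  obtains V where "emden l p (korman_x1 l p) (\<lambda>x. korman_w l p x + 1) V"
proof -
  let ?w = "korman_w l p" and ?r = "korman_x1 l p"
  obtain V where V: "?r > 0" "?w 0 = 0" "V 0 = 0" "?w ?r = -1" "\<forall>x\<in>{0<..<?r}. - 1 < ?w x"
    "\<And>x. x \<in> {0..?r} \<Longrightarrow> (?w has_real_derivative V x) (at x within {0..?r})"
    "\<And>x. x \<in> {0..?r} \<Longrightarrow> (V has_real_derivative - (x powr l * (?w x + 1) powr p)) (at x within {0..?r})"
    using korman_profile_korman_w[OF assms(1,2)] unfolding korman_profile_def by blast
  have "emden l p ?r (\<lambda>x. ?w x + 1) V"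
  proof unfold_locales
    show "((\<lambda>x. ?w x + 1) has_real_derivative V x) (at x within {0..?r})" if "x \<in> {0..?r}" for x
      using DERIV_add[OF V(6)[OF that] DERIV_const[of 1]] by simp
    show "?w x + 1 > 0" if "0 \<le> x" "x < ?r" for x
      using V(2) V(5)[rule_format, of x] that by (cases "x = 0") auto
    show "(V has_real_derivative - (x powr l * (?w x + 1) powr p)) (at x within {0..?r})" if "x \<in> {0..?r}" for x
      by (rule V(7)[OF that])
  qed (use assms V(1-4) in auto)
  then show thesis by (rule that)
qed

lemma dirichlet_solution_cong:
  assumes "\<And>x t. x \<in> {-1<..<1} \<Longrightarrow> f x t = g x t"
  shows "dirichlet_solution f u \<longleftrightarrow> dirichlet_solution g u"
  unfolding dirichlet_solution_def by (intro conj_cong refl ex_cong1 ball_cong) (simp add: assms)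

lemma DERIV_reciprocal_minus_1:
  fixes f :: "real \<Rightarrow> real"
  assumes "(f has_real_derivative f') (at y)" "f y \<noteq> 0"
  shows "((\<lambda>y. 1 / f y - 1) has_real_derivative - f' / (f y)\<^sup>2) (at y)"
  using assms by (auto intro!: derivative_eq_intros simp: power2_eq_square)

section \<open>Change of parameter from \<open>\<eta>\<close> to \<open>\<alpha>\<close>\<close>

locale korman = emden_odd l p "korman_x1 l p" "\<lambda>x. korman_w l p x + 1" V z z1 e c
  for l p :: real and V z z1 e c
begin

abbreviation "r \<equiv> korman_x1 l p"
abbreviation "W \<equiv> \<lambda>x. korman_w l p x + 1"

definition \<eta> :: "real \<Rightarrow> real" where "\<eta> \<alpha> = korman_eta l p (\<alpha> / (\<alpha> + 1))"
text \<open>The central value of the even solution with parameter \<open>y\<close>, and the inverse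
  function of \<open>\<eta>\<close>.\<close>

definition height :: "real \<Rightarrow> real" where "height y = 1 / W y - 1"

lemma W_inj: "x \<in> {0..r} \<Longrightarrow> y \<in> {0..r} \<Longrightarrow> W x = W y \<Longrightarrow> x = y"
  using W_decr[of x y] W_decr[of y x] by (cases x y rule: linorder_cases) auto

lemma \<eta>_props:
  assumes "\<alpha> > 0"
  shows "0 < \<eta> \<alpha>" "\<eta> \<alpha> < r" "W (\<eta> \<alpha>) = 1 / (\<alpha> + 1)"
proof -
  define t where "t = 1 / (\<alpha> + 1)"
  have t: "0 < t" "t < 1" "\<alpha> / (\<alpha> + 1) = 1 - t" using assms by (auto simp: t_def field_simps)
  obtain x where x: "0 \<le> x" "x \<le> r" "W x = t"
    using IVT2'[of W r t 0] W_r W_0 t r W_cont by auto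
  then have m: "\<alpha> / (\<alpha> + 1) \<in> (\<lambda>x. - korman_w l p x) ` {0..r}" using t by (intro image_eqI[of _ _ x]) auto
  have i: "\<eta> \<alpha> \<in> {0..r}" "- korman_w l p (\<eta> \<alpha>) = \<alpha> / (\<alpha> + 1)"
    unfolding \<eta>_def korman_eta_def by (rule inv_into_into[OF m]) (rule f_inv_into_f[OF m])
  then show W: "W (\<eta> \<alpha>) = 1 / (\<alpha> + 1)" using t by (simp add: t_def)
  have "\<eta> \<alpha> \<noteq> 0" "\<eta> \<alpha> \<noteq> r" using W W_0 W_r t unfolding t_def by auto
  then show "0 < \<eta> \<alpha>" "\<eta> \<alpha> < r" using i by auto
qed

lemma height_\<eta>: "\<alpha> > 0 \<Longrightarrow> height (\<eta> \<alpha>) = \<alpha>"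
  unfolding height_def using \<eta>_props(3) by simp

lemma height_pos: "0 < y \<Longrightarrow> y < r \<Longrightarrow> height y > 0"
  using W_pos[of y] W_decr[of 0 y] W_0 by (simp add: height_def)

lemma \<eta>_height:
  assumes "0 < y" "y < r" shows "\<eta> (height y) = y"
proof (rule W_inj)
  have "W (\<eta> (height y)) = 1 / (height y + 1)" by (rule \<eta>_props(3)[OF height_pos[OF assms]])
  also have "\<dots> = W y" using W_pos[of y] assms by (simp add: height_def)
  finally show "W (\<eta> (height y)) = W y" .
qed (use \<eta>_props[OF height_pos[OF assms]] assms in auto)

lemma \<eta>_less_iff:
  assumes "\<alpha> > 0" "\<beta> > 0" shows "\<eta> \<alpha> < \<eta> \<beta> \<longleftrightarrow> \<alpha> < \<beta>"
proof -
  have lt: "\<eta> \<alpha> < \<eta> \<beta>" if "\<alpha> < \<beta>" "\<alpha> > 0" for \<alpha> \<beta>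
  proof (rule ccontr)
    assume "\<not> \<eta> \<alpha> < \<eta> \<beta>"
    then have "W (\<eta> \<alpha>) \<le> W (\<eta> \<beta>)"
      using W_decr[of "\<eta> \<beta>" "\<eta> \<alpha>"] \<eta>_props[of \<alpha>] \<eta>_props[of \<beta>] that by (cases "\<eta> \<alpha> = \<eta> \<beta>") auto
    then have "1 / (\<alpha> + 1) \<le> 1 / (\<beta> + 1)" using \<eta>_props(3)[of \<alpha>] \<eta>_props(3)[of \<beta>] that by simp
    then show False using that by (simp add: field_simps)
  qed
  show ?thesis using lt[of \<alpha> \<beta>] lt[of \<beta> \<alpha>] assms by (cases \<alpha> \<beta> rule: linorder_cases) auto
qed

lemma korman_lambda_eq:
  assumes "\<alpha> > 0" shows "korman_lambda l p \<alpha> = Lam (\<eta> \<alpha>)"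
proof -
  have "(\<alpha> + 1) powr (1 - p) = (1 / (\<alpha> + 1)) powr (p - 1)"
    using assms by (simp add: powr_divide powr_diff)
  then show ?thesis unfolding korman_lambda_def Lam_def \<eta>_props(3)[OF assms] by (simp add: \<eta>_def)
qed

lemma korman_U_eq:
  assumes "\<alpha> > 0" shows "korman_U l p \<alpha> x = E (\<eta> \<alpha>) x - 1"
  unfolding korman_U_def E_def \<eta>_props(3)[OF assms] using assms by (simp add: \<eta>_def algebra_simps)

lemma eigenvalue_iff_eig:
  assumes "\<alpha> > 0" shows "eigenvalue l p \<alpha> \<mu> \<longleftrightarrow> eig (\<eta> \<alpha>) \<mu>"
proof -
  have "dirichlet_solution (\<lambda>x t. korman_lambda l p \<alpha> * \<bar>x\<bar> powr l * p * (korman_U l p \<alpha> x + 1) powr (p - 1) * t + \<mu> * t) \<phi>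
    \<longleftrightarrow> dirichlet_solution (\<lambda>x t. (\<eta> \<alpha>)\<^sup>2 * q (\<eta> \<alpha> * \<bar>x\<bar>) * t + \<mu> * t) \<phi>" for \<phi>
  proof -
    have "korman_lambda l p \<alpha> * \<bar>x\<bar> powr l * p * (korman_U l p \<alpha> x + 1) powr (p - 1) = (\<eta> \<alpha>)\<^sup>2 * q (\<eta> \<alpha> * \<bar>x\<bar>)"
      if "x \<in> {-1<..<1}" for x
      unfolding korman_lambda_eq[OF assms] korman_U_eq[OF assms]
      using linearized_coefficient[OF \<eta>_props(1,2)[OF assms], of x] that by simp
    then show ?thesis by (intro dirichlet_solution_cong) simp
  qed
  then show ?thesis unfolding eigenvalue_def eig_def by simp
qed

lemma morse_index_eq:
  assumes "\<alpha> > 0"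
  shows "morse_index l p \<alpha> = (if \<eta> \<alpha> \<le> e then 0 else if \<eta> \<alpha> \<le> c then 1 else 2)"
  unfolding morse_index_def eigenvalue_iff_eig[OF assms]
  using negative_eigenvalues[OF \<eta>_props(1,2)[OF assms]] by (simp add: one_enat_def zero_enat_def numeral_eq_enat)

lemma degenerate_iff: "\<alpha> > 0 \<Longrightarrow> degenerate l p \<alpha> \<longleftrightarrow> \<eta> \<alpha> = e \<or> \<eta> \<alpha> = c"
  unfolding degenerate_def eigenvalue_iff_eig using eig_0_iff[OF \<eta>_props(1,2)] by simp

lemma height_deriv:
  assumes "0 < y" "y < r" shows "(height has_real_derivative - V y / (W y)\<^sup>2) (at y)"
  unfolding height_def by (rule DERIV_reciprocal_minus_1[OF W_D[OF assms]]) (use W_pos[of y] assms in auto)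

text \<open>\<open>\<eta>\<close> inverts \<open>height\<close>, which has positive derivative; its
  continuity is obtained first, as the inverse function rule requires it.\<close>

lemma \<eta>_deriv:
  assumes "\<alpha> > 0" shows "\<exists>d>0. (\<eta> has_real_derivative d) (at \<alpha>)"
proof -
  have \<eta>: "0 < \<eta> \<alpha>" "\<eta> \<alpha> < r" using \<eta>_props[OF assms] by auto
  define d where "d = - V (\<eta> \<alpha>) / (W (\<eta> \<alpha>))\<^sup>2"
  have d: "d > 0" using V_neg[of "\<eta> \<alpha>"] W_pos[of "\<eta> \<alpha>"] \<eta> by (simp add: d_def divide_neg_pos)
  have "isCont \<eta> (height (\<eta> \<alpha>))"
  proof (rule isCont_inverse_function2[where f=height and g=\<eta> and x="\<eta> \<alpha>" and a="\<eta> \<alpha> / 2" and b="(\<eta> \<alpha> + r) / 2"])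
    show "\<eta> \<alpha> / 2 < \<eta> \<alpha>" "\<eta> \<alpha> < (\<eta> \<alpha> + r) / 2" using \<eta> by auto
    fix y assume "\<eta> \<alpha> / 2 \<le> y" "y \<le> (\<eta> \<alpha> + r) / 2"
    then have y: "0 < y" "y < r" using \<eta> by auto
    show "\<eta> (height y) = y" by (rule \<eta>_height[OF y])
    show "isCont height y" by (rule DERIV_isCont[OF height_deriv[OF y]])
  qed
  then have "isCont \<eta> \<alpha>" by (simp add: height_\<eta>[OF assms])
  then have "(\<eta> has_real_derivative inverse d) (at \<alpha>)"
    using height_deriv[OF \<eta>] d assms
    by (intro DERIV_inverse_function[where f=height and a=0 and b="\<alpha> + 1"]) (auto simp: d_def height_\<eta>)
  then show ?thesis using d by (intro exI[of _ "inverse d"]) auto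
qed

lemma korman_lambda_deriv:
  assumes "\<alpha> > 0"
  obtains d where "d > 0" "(korman_lambda l p has_real_derivative d * \<psi> (\<eta> \<alpha>)) (at \<alpha>)"
proof -
  have \<eta>: "0 < \<eta> \<alpha>" "\<eta> \<alpha> < r" using \<eta>_props[OF assms] by auto
  obtain d where d: "d > 0" "(\<eta> has_real_derivative d) (at \<alpha>)" using \<eta>_deriv[OF assms] by blast
  define a where "a = (p - 1) * W (\<eta> \<alpha>) powr (p - 2) * \<eta> \<alpha> powr (l + 1)"
  have a: "a > 0" using p W_pos[of "\<eta> \<alpha>"] \<eta> by (simp add: a_def)
  have "((\<lambda>\<alpha>. Lam (\<eta> \<alpha>)) has_real_derivative a * \<psi> (\<eta> \<alpha>) * d) (at \<alpha>)"
    using DERIV_chain2[OF Lam_deriv[OF \<eta>] d(2)] by (simp add: a_def)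
  then have "(korman_lambda l p has_real_derivative a * \<psi> (\<eta> \<alpha>) * d) (at \<alpha>)"
    by (rule has_field_derivative_transform_within_open[of _ _ _ "{0<..}"]) (use assms korman_lambda_eq in auto)
  then show thesis using a d(1) by (intro that[of "a * d"]) (auto simp: mult_ac)
qed

lemma alpha_star_eq: "alpha_star l p = height e"
proof -
  have e: "0 < e" "e < r" using ec by auto
  have h: "height e > 0" by (rule height_pos[OF e])
  let ?P = "\<lambda>a. a > 0 \<and>
    (\<forall>\<alpha>. 0 < \<alpha> \<and> \<alpha> < a \<longrightarrow> (\<exists>d>0. (korman_lambda l p has_real_derivative d) (at \<alpha>))) \<and>
    (korman_lambda l p has_real_derivative 0) (at a) \<and>
    (\<forall>\<alpha>>a. \<exists>d<0. (korman_lambda l p has_real_derivative d) (at \<alpha>))"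
  have P: "?P (height e)"
  proof (intro conjI allI impI h)
    fix \<alpha> assume \<alpha>: "0 < \<alpha> \<and> \<alpha> < height e"
    then have "\<eta> \<alpha> < e" using \<eta>_less_iff[of \<alpha> "height e"] h \<eta>_height[OF e] by auto
    then have "\<psi> (\<eta> \<alpha>) > 0" using \<psi>_pos[of "\<eta> \<alpha>"] \<eta>_props[of \<alpha>] \<alpha> by auto
    then show "\<exists>d>0. (korman_lambda l p has_real_derivative d) (at \<alpha>)"
      using korman_lambda_deriv[of \<alpha>] \<alpha> by (metis mult_pos_pos)
  next
    show "(korman_lambda l p has_real_derivative 0) (at (height e))"
      using korman_lambda_deriv[OF h] \<eta>_height[OF e] \<psi>_e by (metis mult_zero_right)
  next
    fix \<alpha> assume \<alpha>: "height e < \<alpha>"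
    then have "e < \<eta> \<alpha>" using \<eta>_less_iff[of "height e" \<alpha>] h \<eta>_height[OF e] by auto
    then have "\<psi> (\<eta> \<alpha>) < 0" using \<psi>_neg[of "\<eta> \<alpha>"] \<eta>_props[of \<alpha>] \<alpha> h by auto
    then show "\<exists>d<0. (korman_lambda l p has_real_derivative d) (at \<alpha>)"
      using korman_lambda_deriv[of \<alpha>] \<alpha> h by (metis mult_pos_neg order.strict_trans)
  qed
  \<comment> \<open>Halfway between two candidates the derivative would be negative because of the
    smaller and positive because of the larger.\<close>
  have uniq: "\<not> a < b" if Pab: "?P a" "?P b" for a b
  proof
    assume "a < b"
    define m where "m = (a + b) / 2"
    have m: "a < m" "0 < m \<and> m < b" using \<open>a < b\<close> Pab(1) by (auto simp: m_def)
    obtain d where d: "d < 0" "(korman_lambda l p has_real_derivative d) (at m)" using Pab(1) m(1) by blast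
    obtain d' where d': "d' > 0" "(korman_lambda l p has_real_derivative d') (at m)" using Pab(2) m(2) by blast
    show False using DERIV_unique[OF d(2) d'(2)] d(1) d'(1) by simp
  qed
  show ?thesis unfolding alpha_star_def
  proof (rule the_equality[where P="?P" and a="height e"])
    show "?P (height e)" by (rule P)
    fix a assume "?P a"
    then have "\<not> a < height e" "\<not> height e < a" using uniq[OF _ P, of a] uniq[OF P, of a] by blast+
    then show "a = height e" by simp
  qed
qed

lemma non_even_bifurcation: "non_even_bifurcation_point l p (height c)"
  unfolding non_even_bifurcation_point_def
proof (intro allI impI)
  fix \<epsilon> :: real assume \<epsilon>: "\<epsilon> > 0"
  have c: "0 < c" "c < r" using ec by auto
  have h: "height c > 0" by (rule height_pos[OF c])
  obtain lam u where "positive_solution l p lam u" "\<not> even_fun u"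
    "\<bar>lam - Lam c\<bar> + sup_norm (\<lambda>x. u x - (E c x - 1)) < \<epsilon>"
    by (rule bifurcation[OF \<epsilon>])
  then show "\<exists>lam u. positive_solution l p lam u \<and> \<not> even_fun u \<and>
       \<bar>lam - korman_lambda l p (height c)\<bar> + sup_norm (\<lambda>x. u x - korman_U l p (height c) x) < \<epsilon>"
    unfolding korman_lambda_eq[OF h] korman_U_eq[OF h] \<eta>_height[OF c] by blast
qed

section \<open>Growth of the non-even solutions\<close>

lemma slope_unbounded:
  obtains y where "c < y" "y < r" "slope y \<ge> M"
proof -
  define A where "A = c * (- V c)"
  have A: "A > 0" using V_neg[of c] ec by (simp add: A_def mult_pos_neg)
  \<comment> \<open>Beyond \<open>c\<close> the numerator of the slope is at least \<open>A\<close>,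
    so \<open>W y = \<delta>\<close> makes the slope at least \<open>\<bar>M\<bar> + 1\<close>;
    \<open>\<delta> < W c\<close> places \<open>y\<close> beyond \<open>c\<close>.\<close>
  define \<delta> where "\<delta> = min (W c / 2) (A / (\<bar>M\<bar> + 1))"
  have Wc: "W c > 0" using W_pos[of c] ec by auto
  have \<delta>: "\<delta> > 0" "\<delta> < W c" using A Wc by (auto simp: \<delta>_def min_def field_simps)
  have "continuous_on {c..r} W" using W_cont by (rule continuous_on_subset) (use ec in auto)
  then obtain y where y: "c \<le> y" "y \<le> r" "W y = \<delta>"
    using IVT2'[of W r \<delta> c] W_r \<delta> ec by auto
  have y': "c < y" "y < r" using y \<delta> W_r by (auto simp: order.order_iff_strict)
  have "A \<le> y * (- V y)"
    unfolding A_def using V_decr[of c y] V_neg[of c] y' ec by (intro mult_mono) auto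
  then have "A / \<delta> \<le> y * (- V y) / \<delta>" using \<delta> by (intro divide_right_mono) auto
  also have "\<dots> = slope y" unfolding slope_def y(3) by simp
  finally have "A / \<delta> \<le> slope y" .
  moreover have "M \<le> A / \<delta>"
  proof -
    have "\<delta> \<le> A / (\<bar>M\<bar> + 1)" by (simp add: \<delta>_def)
    then have "\<delta> * (\<bar>M\<bar> + 1) \<le> A" by (simp add: pos_le_divide_eq)
    then have "\<bar>M\<bar> + 1 \<le> A / \<delta>" using \<delta> by (simp add: pos_le_divide_eq mult.commute)
    then show ?thesis by linarith
  qed
  ultimately show thesis using y' by (intro that[of y]) auto
qed

lemma noneven_family:
  "\<exists>u. (\<forall>lam. 0 < lam \<and> lam < Lam c \<longrightarrow> positive_solution l p lam (u lam) \<and> \<not> even_fun (u lam)) \<and>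
     filterlim (\<lambda>lam. sup_norm (u lam)) at_top (at_right 0)"
proof -
  have c: "0 < c" "c < r" using ec by auto
  have "\<exists>u. positive_solution l p lam u \<and> \<not> even_fun u \<and>
    (\<exists>y. c < y \<and> y < r \<and> Lam y = lam \<and> slope y < 2 * lam * (sup_norm u + 1) powr p)"
    if lam: "0 < lam" "lam < Lam c" for lam
  proof -
    have "continuous_on {c..r} Lam" using Lam_cont by (rule continuous_on_subset) (use c in auto)
    then obtain y where y: "c \<le> y" "y \<le> r" "Lam y = lam" using IVT2'[of Lam r lam c] Lam_r lam c by auto
    then have y': "c < y" "y < r" using lam Lam_r by (auto simp: order.order_iff_strict)
    then show ?thesis using noneven_solution_exists[OF y'] y(3) by metis
  qed
  then obtain u where u: "\<And>lam. 0 < lam \<Longrightarrow> lam < Lam c \<Longrightarrow> positive_solution l p lam (u lam) \<and> \<not> even_fun (u lam) \<and>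
    (\<exists>y. c < y \<and> y < r \<and> Lam y = lam \<and> slope y < 2 * lam * (sup_norm (u lam) + 1) powr p)" by metis
  have "filterlim (\<lambda>lam. sup_norm (u lam)) at_top (at_right 0)"
    unfolding filterlim_at_top eventually_at_right_field
  proof (intro allI)
    fix M0 :: real
    define M where "M = max M0 0"
    \<comment> \<open>For \<open>lam < Lam y0\<close> the parameter of \<open>u lam\<close> lies
      beyond \<open>y0\<close>, so its slope exceeds that of \<open>y0\<close>. The factor
      \<open>Lam c\<close>, an upper bound for every \<open>lam\<close> involved, lets the two sides
      be compared through the norm alone.\<close>
    obtain y0 where y0: "c < y0" "y0 < r" "slope y0 \<ge> 2 * Lam c * (M + 1) powr p" by (rule slope_unbounded)
    have L0: "Lam y0 < Lam c" "0 < Lam y0" using Lam_decr[of c y0] Lam_pos[of y0] y0 ec by auto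
    show "\<exists>b>0. \<forall>lam>0. lam < b \<longrightarrow> M0 \<le> sup_norm (u lam)"
    proof (intro exI[of _ "Lam y0"] conjI allI impI)
      fix lam assume lam: "0 < lam" "lam < Lam y0"
      then obtain y where y: "c < y" "y < r" "Lam y = lam" "slope y < 2 * lam * (sup_norm (u lam) + 1) powr p"
        and pos: "positive_solution l p lam (u lam)" using u[of lam] L0 by auto
      have "y0 < y"
      proof (rule ccontr)
        assume "\<not> y0 < y"
        then have "Lam y0 \<le> Lam y" using Lam_decr[of y y0] y y0 ec by (cases "y = y0") auto
        then show False using lam y by simp
      qed
      then have "slope y0 < slope y" using slope_strict_mono[of y0 y] y y0 c by auto
      then have lt: "2 * Lam c * (M + 1) powr p < 2 * lam * (sup_norm (u lam) + 1) powr p" using y0 y by linarith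
      have s0: "sup_norm (u lam) \<ge> 0"
        using sup_norm_ge[of "u lam" 0] pos unfolding positive_solution_def dirichlet_solution_def by auto
      have "M < sup_norm (u lam)"
      proof (rule ccontr)
        assume "\<not> M < sup_norm (u lam)"
        then have "(sup_norm (u lam) + 1) powr p \<le> (M + 1) powr p" using s0 p by (intro powr_mono2) auto
        then have "2 * lam * (sup_norm (u lam) + 1) powr p \<le> 2 * Lam c * (M + 1) powr p"
          using lam L0 by (intro mult_mono) auto
        then show False using lt by simp
      qed
      then show "M0 \<le> sup_norm (u lam)" by (simp add: M_def)
    qed (use L0 in auto)
  qed
  then show ?thesis using u by blast
qed

end

lemma korman_exists:
  assumes "l > 0" "p > 1" "(p - 1) * l > 3"
  obtains V z z1 e c where "korman l p V z z1 e c"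
proof -
  obtain V where "emden l p (korman_x1 l p) (\<lambda>x. korman_w l p x + 1) V"
    by (rule emden_korman[OF assms])
  then show thesis
    by (rule emden.emden_odd_exists) (rule that, simp add: korman_def)
qed

theorem theorem1p2:
  fixes l p :: real
  assumes "l > 0" and "p > 1" and "(p - 1) * l > 4"
  shows "\<exists>\<alpha>1 \<alpha>2 \<alpha>3. alpha_star l p < \<alpha>1 \<and> \<alpha>1 \<le> \<alpha>2 \<and> \<alpha>2 \<le> \<alpha>3 \<and>
    (\<forall>\<alpha>. 0 < \<alpha> \<and> \<alpha> < alpha_star l p \<longrightarrow> morse_index l p \<alpha> = 0 \<and> \<not> degenerate l p \<alpha>) \<and>
    (morse_index l p (alpha_star l p) = 0 \<and> degenerate l p (alpha_star l p)) \<and>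
    (\<forall>\<alpha>. alpha_star l p < \<alpha> \<and> \<alpha> < \<alpha>1 \<longrightarrow> morse_index l p \<alpha> = 1 \<and> \<not> degenerate l p \<alpha>) \<and>
    (morse_index l p \<alpha>1 = 1 \<and> degenerate l p \<alpha>1) \<and>
    (morse_index l p \<alpha>2 = 1 \<and> degenerate l p \<alpha>2 \<and> non_even_bifurcation_point l p \<alpha>2) \<and>
    (morse_index l p \<alpha>3 = 1 \<and> degenerate l p \<alpha>3) \<and>
    (\<forall>\<alpha>>\<alpha>3. morse_index l p \<alpha> = 2 \<and> \<not> degenerate l p \<alpha>) \<and>
    (\<exists>u. (\<forall>lam. 0 < lam \<and> lam < korman_lambda l p \<alpha>3 \<longrightarrow>
             positive_solution l p lam (u lam) \<and> \<not> even_fun (u lam)) \<and>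
         filterlim (\<lambda>lam. sup_norm (u lam)) at_top (at_right 0))"
proof -
  obtain V z z1 e c where "korman l p V z z1 e c"
    by (rule korman_exists) (use assms in auto)
  then interpret korman l p V z z1 e c .
  have e: "0 < e" "e < r" and c: "0 < c" "c < r" using ec by auto
  have he: "height e > 0" and hc: "height c > 0" by (rule height_pos[OF e], rule height_pos[OF c])
  \<comment> \<open>Since \<open>\<eta>\<close> increases strictly with inverse
    \<open>height\<close>, every condition on \<open>\<eta> \<alpha>\<close> relative to
    \<open>e\<close> and \<open>c\<close> becomes one on \<open>\<alpha>\<close>.\<close>
  have cmp: "\<eta> \<alpha> < e \<longleftrightarrow> \<alpha> < height e" "e < \<eta> \<alpha> \<longleftrightarrow> height e < \<alpha>"
    "\<eta> \<alpha> < c \<longleftrightarrow> \<alpha> < height c" "c < \<eta> \<alpha> \<longleftrightarrow> height c < \<alpha>" if "\<alpha> > 0" for \<alpha>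
    using \<eta>_less_iff[OF that he] \<eta>_less_iff[OF he that] \<eta>_less_iff[OF that hc] \<eta>_less_iff[OF hc that]
    unfolding \<eta>_height[OF e] \<eta>_height[OF c] by auto
  have hec: "height e < height c" using cmp(2)[OF hc] \<eta>_height[OF c] ec by simp
  have mi: "morse_index l p \<alpha> = (if \<alpha> \<le> height e then 0 else if \<alpha> \<le> height c then 1 else 2)" if "\<alpha> > 0" for \<alpha>
    using morse_index_eq[OF that] cmp[OF that] by (simp add: not_less[symmetric])
  have dg: "degenerate l p \<alpha> \<longleftrightarrow> \<alpha> = height e \<or> \<alpha> = height c" if "\<alpha> > 0" for \<alpha>
    using degenerate_iff[OF that] cmp[OF that] by (metis linorder_neq_iff)
  have lam: "korman_lambda l p (height c) = Lam c" using korman_lambda_eq[OF hc] \<eta>_height[OF c] by simp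
  show ?thesis
    unfolding alpha_star_eq
  proof (intro exI[of _ "height c"] conjI allI impI)
    show "\<exists>u. (\<forall>lam. 0 < lam \<and> lam < korman_lambda l p (height c) \<longrightarrow>
             positive_solution l p lam (u lam) \<and> \<not> even_fun (u lam)) \<and>
         filterlim (\<lambda>lam. sup_norm (u lam)) at_top (at_right 0)"
      unfolding lam by (rule noneven_family)
    show "non_even_bifurcation_point l p (height c)" by (rule non_even_bifurcation)
  qed (use mi dg he hc hec in auto)
qed

end
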